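(* Let $L=L_K(E)$ be the Leavitt path algebra of an arbitrary graph $E$ over an arbitrary field $K$. The following are equivalent. (1) Every proper ideal of $L$ is completely irreducible. (2) Every ideal of $L$ is graded, and the ideals of $L$ are well-ordered under set inclusion. (3) The graph $E$ satisfies condition (K), the admissible pairs $(H,S)$ form a chain under the partial order of admissible pairs, and $(E\backslash(H,S))^0$ satisfies the strong CSP for each admissible pair $(H,S)$ with $H\neq E^0$.
   Context: A graph $E=(E^0,E^1,r,s)$ is a directed graph: a nonempty set $E^0$ of vertices, a set $E^1$ of edges, and range and source maps $r,s:E^1\to E^0$ (no finiteness or countability assumptions). A vertex $v$ is regular if $s^{-1}(v)$ is finite and nonempty, and an infinite emitter if $s^{-1}(v)$ is infinite. For a field $K$, the Leavitt path algebra $L_K(E)$ is the (associative, not necessarily unital) $K$-algebra generated by $\{v\mid v\in E^0\}\cup\{e,e^*\mid e\in E^1\}$ subject to: $vw=\delta_{v,w}v$ for $v,w\in E^0$; $s(e)e=er(e)=e$ and $r(e)e^*=e^*s(e)=e^*$ for $e\in E^1$; $e^*f=\delta_{e,f}r(e)$ for $e,f\in E^1$; and $v=\sum_{e\in s^{-1}(v)}ee^*$ for every regular $v\in E^0$. A path is a finite sequence $\mu=e_1\cdots e_n$ of edges with $r(e_i)=s(e_{i+1})$; $s(\mu)=s(e_1)$, $r(\mu)=r(e_n)$, $|\mu|=n$; vertices are paths of length $0$; $\mu^*=e_n^*\cdots e_1^*$. $L$ is $\mathbb Z$-graded with $L_n$ the $K$-span of the elements $\mu\nu^*$ with $\mu,\nu$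 paths and $|\mu|-|\nu|=n$; an ideal $I$ is graded if $I=\bigoplus_n(I\cap L_n)$. A closed path is a path $e_1\cdots e_n$ ($n\ge1$) with $r(e_n)=s(e_1)$. The graph satisfies condition (K) if any vertex on a closed path $\mu$ is also the source of a closed path different from $\mu$ (i.e. having a different set of edges). Write $u\ge v$ if there is a path (possibly of length $0$) from $u$ to $v$. A set $X$ of vertices is hereditary if $u\in X$ and $u\ge v$ imply $v\in X$; saturated if for every regular vertex $v$, $r(s^{-1}(v))\subseteq X$ implies $v\in X$. For $H\subseteq E^0$ hereditary and saturated, the set $B_H$ of breaking vertices consists of the infinite emitters $v\in E^0\setminus H$ with $0<|s^{-1}(v)\cap r^{-1}(E^0\setminus H)|<\aleph_0$. An admissible pair is $(H,S)$ with $H$ hereditary saturated and $S\subseteq B_H$. The partial order of admissible pairs is: $(H_1,S_1)\le(H_2,S_2)$ iff $H_1\subseteq H_2$ and $S_1\subseteq H_2\cup S_2$. The quotient graph $E\backslash(H,S)$ has vertex set $(E^0\setminus H)\cup\{v'\mid v\in B_H\setminus S\}$ and edge set $\{e\in E^1\mid r(e)\notin H\}\cup\{e'\mid e\in E^1,\ r(e)\in B_H\setminus S\}$ (the $v'$, $e'$ being new symbols), with $r,s$ as in $E$ on the old edges and $s(e')=s(e)$, $r(e')=r(e)'$. A nonempty set $X$ of vertices of a graph $F$ satisfies the countable separation property (CSP) with respect to a countable subset $T\subseteq X$ if for every $u\in X$ there is $v\in T$ with $u\ge v$. $X$ satisfies the strong CSP if it satisfies the CSP with respect to some countable $T\subseteq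 X$ that is contained in every nonempty hereditary saturated subset of $X$ (hereditary and saturated as subsets of $F^0$). For $X=(E\backslash(H,S))^0$ the graph $F$ is $E\backslash(H,S)$. "Ideal" means two-sided ideal. A proper ideal $I$ is completely irreducible if it is not the intersection of any set of ideals properly containing $I$. *)

theory Defs
  imports
    "HOL-Library.Poly_Mapping"
    "HOL-Library.Countable_Set"
    "HOL-Algebra.AbelCoset"
    "HOL-Algebra.Module"
    "Graph_Theory.Arc_Walk"
begin

section \<open>Graphs\<close>

text \<open>
  A graph is a \<open>wf_digraph\<close> with \<open>verts E \<noteq> {}\<close>; the source and range maps \<open>s\<close>, \<open>r\<close> are
  \<open>tail\<close> and \<open>head\<close>, and \<open>s\<^sup>-\<^sup>1(v)\<close> is \<open>out_arcs E v\<close>. A path from \<open>u\<close> to \<open>v\<close> is an arc list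
  \<open>p\<close> with \<open>pre_digraph.awalk E u p v\<close>; the vertex \<open>u\<close>, as a path of length 0, is
  the empty walk from \<open>u\<close> to \<open>u\<close>.
\<close>

definition regular_vertex :: "('v, 'e) pre_digraph \<Rightarrow> 'v \<Rightarrow> bool" where
  "regular_vertex E v \<longleftrightarrow> v \<in> verts E \<and> finite (out_arcs E v) \<and> out_arcs E v \<noteq> {}"

definition infinite_emitter :: "('v, 'e) pre_digraph \<Rightarrow> 'v \<Rightarrow> bool" where
  "infinite_emitter E v \<longleftrightarrow> v \<in> verts E \<and> infinite (out_arcs E v)"

definition closed_path :: "('v, 'e) pre_digraph \<Rightarrow> 'v \<Rightarrow> 'e list \<Rightarrow> bool" where
  "closed_path E v p \<longleftrightarrow> pre_digraph.awalk E v p v \<and> p \<noteq> []"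

definition condition_K :: "('v, 'e) pre_digraph \<Rightarrow> bool" where
  "condition_K E \<longleftrightarrow>
     (\<forall>u p. closed_path E u p \<longrightarrow>
        (\<forall>v \<in> set (pre_digraph.awalk_verts E u p). \<exists>q. closed_path E v q \<and> set q \<noteq> set p))"

definition connects :: "('v, 'e) pre_digraph \<Rightarrow> 'v \<Rightarrow> 'v \<Rightarrow> bool" where
  "connects E u v \<longleftrightarrow> (\<exists>p. pre_digraph.awalk E u p v)"

definition hereditary :: "('v, 'e) pre_digraph \<Rightarrow> 'v set \<Rightarrow> bool" where
  "hereditary E X \<longleftrightarrow> X \<subseteq> verts E \<and> (\<forall>u v. u \<in> X \<longrightarrow> connects E u v \<longrightarrow> v \<in> X)"

definition saturated :: "('v, 'e) pre_digraph \<Rightarrow> 'v set \<Rightarrow> bool" where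
  "saturated E X \<longleftrightarrow>
     X \<subseteq> verts E \<and> (\<forall>v. regular_vertex E v \<longrightarrow> head E ` out_arcs E v \<subseteq> X \<longrightarrow> v \<in> X)"

definition breaking_vertices :: "('v, 'e) pre_digraph \<Rightarrow> 'v set \<Rightarrow> 'v set" where
  "breaking_vertices E H =
     {v \<in> verts E - H. infinite_emitter E v
        \<and> {e \<in> out_arcs E v. head E e \<notin> H} \<noteq> {}
        \<and> finite {e \<in> out_arcs E v. head E e \<notin> H}}"

definition admissible_pairs :: "('v, 'e) pre_digraph \<Rightarrow> ('v set \<times> 'v set) set" where
  "admissible_pairs E =
     {(H, S). hereditary E H \<and> saturated E H \<and> S \<subseteq> breaking_vertices E H}"

definition admissible_le :: "'v set \<times> 'v set \<Rightarrow> 'v set \<times> 'v set \<Rightarrow> bool" where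
  "admissible_le = (\<lambda>(H1, S1) (H2, S2). H1 \<subseteq> H2 \<and> S1 \<subseteq> H2 \<union> S2)"

text \<open>
  In the quotient graph \<open>Inl v\<close> and \<open>Inl e\<close> are the old vertices and edges, \<open>Inr v\<close> and
  \<open>Inr e\<close> are the new symbols \<open>v'\<close> and \<open>e'\<close>.
\<close>

definition quotient_graph ::
  "('v, 'e) pre_digraph \<Rightarrow> 'v set \<Rightarrow> 'v set \<Rightarrow> ('v + 'v, 'e + 'e) pre_digraph" where
  "quotient_graph E H S =
     \<lparr> verts = Inl ` (verts E - H) \<union> Inr ` (breaking_vertices E H - S),
       arcs = Inl ` {e \<in> arcs E. head E e \<notin> H}
              \<union> Inr ` {e \<in> arcs E. head E e \<in> breaking_vertices E H - S},
       tail = (\<lambda>x. case x of Inl e \<Rightarrow> Inl (tail E e) | Inr e \<Rightarrow> Inl (tail E e)),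
       head = (\<lambda>x. case x of Inl e \<Rightarrow> Inl (head E e) | Inr e \<Rightarrow> Inr (head E e)) \<rparr>"

definition csp_wrt :: "('v, 'e) pre_digraph \<Rightarrow> 'v set \<Rightarrow> 'v set \<Rightarrow> bool" where
  "csp_wrt F X T \<longleftrightarrow>
     X \<noteq> {} \<and> X \<subseteq> verts F \<and> T \<subseteq> X \<and> countable T \<and> (\<forall>u\<in>X. \<exists>v\<in>T. connects F u v)"

definition strong_csp :: "('v, 'e) pre_digraph \<Rightarrow> 'v set \<Rightarrow> bool" where
  "strong_csp F X \<longleftrightarrow>
     (\<exists>T. csp_wrt F X T
        \<and> (\<forall>Y. Y \<subseteq> X \<longrightarrow> Y \<noteq> {} \<longrightarrow> hereditary F Y \<longrightarrow> saturated F Y \<longrightarrow> T \<subseteq> Y))"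


section \<open>The free algebra\<close>

datatype ('v, 'e) generator = Vertex 'v | Edge 'e | Ghost 'e

text \<open>
  Words form a monoid under concatenation, written additively because the multiplication of
  \<^theory>\<open>HOL-Library.Poly_Mapping\<close> is convolution over an additive monoid of exponents. Thus
  \<open>('v, 'e) gen_word \<Rightarrow>\<^sub>0 'k\<close> is the unital free associative algebra over \<open>'k\<close> on all
  symbols.
\<close>

datatype ('v, 'e) gen_word = Word (letters: "('v, 'e) generator list")

instantiation gen_word :: (type, type) monoid_add
begin

definition zero_gen_word :: "('a, 'b) gen_word" where
  "zero_gen_word = Word []"

definition plus_gen_word :: "('a, 'b) gen_word \<Rightarrow> ('a, 'b) gen_word \<Rightarrow> ('a, 'b) gen_word" where
  "plus_gen_word x y = Word (letters x @ letters y)"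

instance
  by standard (simp_all add: zero_gen_word_def plus_gen_word_def)

end

type_synonym ('v, 'e, 'k) free_elem = "('v, 'e) gen_word \<Rightarrow>\<^sub>0 'k"

definition monomial :: "('v, 'e) generator list \<Rightarrow> ('v, 'e, 'k::field) free_elem" where
  "monomial w = Poly_Mapping.single (Word w) 1"

abbreviation vx :: "'v \<Rightarrow> ('v, 'e, 'k::field) free_elem" where "vx v \<equiv> monomial [Vertex v]"
abbreviation ed :: "'e \<Rightarrow> ('v, 'e, 'k::field) free_elem" where "ed e \<equiv> monomial [Edge e]"
abbreviation gh :: "'e \<Rightarrow> ('v, 'e, 'k::field) free_elem" where "gh e \<equiv> monomial [Ghost e]"

definition scale :: "'k::field \<Rightarrow> ('v, 'e, 'k) free_elem \<Rightarrow> ('v, 'e, 'k) free_elem" where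
  "scale c x = Poly_Mapping.single 0 c * x"

definition generators :: "('v, 'e) pre_digraph \<Rightarrow> ('v, 'e) generator set" where
  "generators E = Vertex ` verts E \<union> Edge ` arcs E \<union> Ghost ` arcs E"

text \<open>The free non-unital algebra on the generators of \<open>E\<close>: the empty word is excluded.\<close>

definition free_algebra :: "('v, 'e) pre_digraph \<Rightarrow> ('v, 'e, 'k::field) free_elem set" where
  "free_algebra E =
     {x. \<forall>w \<in> Poly_Mapping.keys x. letters w \<noteq> [] \<and> set (letters w) \<subseteq> generators E}"


section \<open>The Leavitt path algebra\<close>

inductive_set leavitt_relations :: "('v, 'e) pre_digraph \<Rightarrow> ('v, 'e, 'k::field) free_elem set"
  for E :: "('v, 'e) pre_digraph" where
  vertex: "v \<in> verts E \<Longrightarrow> w \<in> verts E \<Longrightarrow>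
    vx v * vx w - (if v = w then vx v else 0) \<in> leavitt_relations E"
| edge_source: "e \<in> arcs E \<Longrightarrow> vx (tail E e) * ed e - ed e \<in> leavitt_relations E"
| edge_range: "e \<in> arcs E \<Longrightarrow> ed e * vx (head E e) - ed e \<in> leavitt_relations E"
| ghost_range: "e \<in> arcs E \<Longrightarrow> vx (head E e) * gh e - gh e \<in> leavitt_relations E"
| ghost_source: "e \<in> arcs E \<Longrightarrow> gh e * vx (tail E e) - gh e \<in> leavitt_relations E"
| CK1: "e \<in> arcs E \<Longrightarrow> f \<in> arcs E \<Longrightarrow>
    gh e * ed f - (if e = f then vx (head E e) else 0) \<in> leavitt_relations E"
| CK2: "regular_vertex E v \<Longrightarrow>
    vx v - (\<Sum>e\<in>out_arcs E v. ed e * gh e) \<in> leavitt_relations E"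

text \<open>
  The algebra ideal of \<open>free_algebra E\<close> generated by the relations. Closure under scalars is not
  automatic, since \<open>free_algebra E\<close> has no unit.
\<close>

inductive_set leavitt_kernel :: "('v, 'e) pre_digraph \<Rightarrow> ('v, 'e, 'k::field) free_elem set"
  for E :: "('v, 'e) pre_digraph" where
  relation: "x \<in> leavitt_relations E \<Longrightarrow> x \<in> leavitt_kernel E"
| zero: "0 \<in> leavitt_kernel E"
| add: "x \<in> leavitt_kernel E \<Longrightarrow> y \<in> leavitt_kernel E \<Longrightarrow> x + y \<in> leavitt_kernel E"
| scale: "x \<in> leavitt_kernel E \<Longrightarrow> scale c x \<in> leavitt_kernel E"
| mult_left: "a \<in> free_algebra E \<Longrightarrow> x \<in> leavitt_kernel E \<Longrightarrow> a * x \<in> leavitt_kernel E"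
| mult_right: "a \<in> free_algebra E \<Longrightarrow> x \<in> leavitt_kernel E \<Longrightarrow> x * a \<in> leavitt_kernel E"

definition leavitt_class ::
  "('v, 'e) pre_digraph \<Rightarrow> ('v, 'e, 'k::field) free_elem \<Rightarrow> ('v, 'e, 'k) free_elem set" where
  "leavitt_class E x = {y. y - x \<in> leavitt_kernel E}"

text \<open>
  The quotient of \<open>free_algebra E\<close> by \<open>leavitt_kernel E\<close>. The operations are those of
  representatives (each union is over equal cosets). The Leavitt path algebra has no unit in
  general; the field \<open>one\<close> of the record is not used.
\<close>

definition leavitt_path_algebra ::
  "('v, 'e) pre_digraph \<Rightarrow> ('k::field, ('v, 'e, 'k) free_elem set) module" where
  "leavitt_path_algebra E =
     \<lparr> carrier = leavitt_class E ` free_algebra E,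
       mult = (\<lambda>X Y. \<Union>x\<in>X. \<Union>y\<in>Y. leavitt_class E (x * y)),
       one = undefined,
       zero = leavitt_class E 0,
       add = (\<lambda>X Y. \<Union>x\<in>X. \<Union>y\<in>Y. leavitt_class E (x + y)),
       smult = (\<lambda>c X. \<Union>x\<in>X. leavitt_class E (scale c x)) \<rparr>"


section \<open>Ideals\<close>

text \<open>\<open>ideal\<close> of HOL-Algebra cannot be used, as it requires a ring with unit.\<close>

definition two_sided_ideal :: "'a set \<Rightarrow> ('a, 'm) ring_scheme \<Rightarrow> bool" where
  "two_sided_ideal I R \<longleftrightarrow> additive_subgroup I R
     \<and> (\<forall>a\<in>I. \<forall>x\<in>carrier R. x \<otimes>\<^bsub>R\<^esub> a \<in> I \<and> a \<otimes>\<^bsub>R\<^esub> x \<in> I)"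

definition proper_ideal :: "'a set \<Rightarrow> ('a, 'm) ring_scheme \<Rightarrow> bool" where
  "proper_ideal I R \<longleftrightarrow> two_sided_ideal I R \<and> I \<noteq> carrier R"

text \<open>The intersection of the empty set of ideals is the whole ring.\<close>

definition completely_irreducible :: "'a set \<Rightarrow> ('a, 'm) ring_scheme \<Rightarrow> bool" where
  "completely_irreducible I R \<longleftrightarrow> proper_ideal I R
     \<and> \<not> (\<exists>\<J>. (\<forall>J\<in>\<J>. two_sided_ideal J R \<and> I \<subset> J) \<and> I = carrier R \<inter> \<Inter>\<J>)"

inductive_set linear_span :: "('k, 'a, 'm) module_scheme \<Rightarrow> 'a set \<Rightarrow> 'a set"
  for M :: "('k, 'a, 'm) module_scheme" and X :: "'a set" where
  zero: "\<zero>\<^bsub>M\<^esub> \<in> linear_span M X"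
| step: "x \<in> X \<Longrightarrow> y \<in> linear_span M X \<Longrightarrow> (c \<odot>\<^bsub>M\<^esub> x) \<oplus>\<^bsub>M\<^esub> y \<in> linear_span M X"

definition path_word :: "'v \<Rightarrow> 'e list \<Rightarrow> ('v, 'e) generator list" where
  "path_word u p = (if p = [] then [Vertex u] else map Edge p)"

definition ghost_word :: "'v \<Rightarrow> 'e list \<Rightarrow> ('v, 'e) generator list" where
  "ghost_word u p = (if p = [] then [Vertex u] else map Ghost (rev p))"

text \<open>The component \<open>L\<^sub>n\<close>, spanned by the \<open>\<mu>\<nu>\<^sup>*\<close> with \<open>\<mu> = p\<close> starting at \<open>u\<close> and \<open>\<nu> = q\<close> starting at \<open>w\<close>.\<close>

definition leavitt_component ::
  "('v, 'e) pre_digraph \<Rightarrow> int \<Rightarrow> ('v, 'e, 'k::field) free_elem set set" where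
  "leavitt_component E n =
     linear_span (leavitt_path_algebra E)
       {leavitt_class E (monomial (path_word u p @ ghost_word w q)) | u p w q.
          (\<exists>a. pre_digraph.awalk E u p a) \<and> (\<exists>b. pre_digraph.awalk E w q b)
          \<and> int (length p) - int (length q) = n}"

text \<open>
  \<open>A\<close> is the internal direct sum of the \<open>B n\<close>: summation is a bijection onto \<open>A\<close> from the
  families with \<open>f n \<in> B n\<close> and only finitely many nonzero members.
\<close>

definition internal_direct_sum ::
  "('a, 'm) ring_scheme \<Rightarrow> ('i \<Rightarrow> 'a set) \<Rightarrow> 'a set \<Rightarrow> bool" where
  "internal_direct_sum R B A \<longleftrightarrow>
     bij_betw (\<lambda>f. \<Oplus>\<^bsub>R\<^esub>n\<in>{n. f n \<noteq> \<zero>\<^bsub>R\<^esub>}. f n)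
       {f. (\<forall>n. f n \<in> B n) \<and> finite {n. f n \<noteq> \<zero>\<^bsub>R\<^esub>}} A"

definition graded_ideal ::
  "('v, 'e) pre_digraph \<Rightarrow> ('v, 'e, 'k::field) free_elem set set \<Rightarrow> bool" where
  "graded_ideal E I \<longleftrightarrow> two_sided_ideal I (leavitt_path_algebra E)
     \<and> internal_direct_sum (leavitt_path_algebra E) (\<lambda>n. I \<inter> leavitt_component E n) I"

end

theory Submission
  imports Defs "HOL-Library.Sublist"
begin

text \<open>
  The ideals of \<open>L\<close> are compared with the admissible pairs of the graph. The pair of an ideal \<open>I\<close>
  consists of the set \<open>H\<close> of the vertices in \<open>I\<close> and of the set \<open>S\<close> of those breaking vertices \<open>v\<close>
  of \<open>H\<close> for which \<open>I\<close> contains \<open>v\<^sup>H = v - \<Sum>ee\<^sup>*\<close>, the sum being over the edges \<open>e\<close> from \<open>v\<close> with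
  range outside \<open>H\<close>. Three facts about this map carry the proof.

  It is monotone and hits every admissible pair (\<open>pair_mono\<close>, \<open>ex_ideal_of_pair\<close>): a pair
  \<open>(H, S)\<close> is the pair of the annihilator of the representation of \<open>L\<close> on functions on the boundary
  paths that avoid \<open>H\<close> and do not stop at a vertex in \<open>S\<close>.

  Under condition (K) it is an order embedding (\<open>ideal_le_of_pair\<close>). If \<open>I\<close> had an element outside an
  ideal \<open>J \<subseteq> I\<close> that contains \<open>H\<close> and the \<open>v\<^sup>H\<close> with \<open>v \<in> S\<close>, one could multiply it by paths and
  ghost paths until a scalar multiple of a vertex outside \<open>H\<close> remains or, up to terms \<open>ee\<^sup>*\<close> with range
  in \<open>H\<close>, of some \<open>v\<^sup>H\<close> with \<open>v \<notin> S\<close>; but this product is still in \<open>I\<close>. Condition (K) is used to get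
  rid of closed paths.

  If condition (K) fails, there are two incomparable ideals (\<open>condition_K_if_chain\<close>). Some vertex \<open>v\<close>
  then has a single first return path \<open>c\<close>, so for every \<open>m > 0\<close> there is a representation in which
  \<open>c\<^sup>*\<close> permutes \<open>m\<close> points over \<open>v\<close> cyclically; \<open>v - (c\<^sup>*)\<^sup>2\<close> and \<open>v - (c\<^sup>*)\<^sup>3\<close> tell the
  annihilators for \<open>m = 2\<close> and \<open>m = 3\<close> apart.

  By pure order theory, all proper ideals are completely irreducible iff every nonempty family of
  ideals has a least member, iff inclusion well-orders the ideals (\<open>irreducible_iff_has_least\<close>,
  \<open>well_order_on_inclusion_iff\<close>). This property makes the ideals a chain, so it implies condition
  (K), and then all ideals are graded: the elements of \<open>I\<close> whose homogeneous components all lie in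
  \<open>I\<close> form an ideal that contains \<open>H\<close> and all \<open>v\<^sup>H\<close> with \<open>v \<in> S\<close>, hence it is \<open>I\<close>.

  What is left is combinatorics. The strong CSP of a graph says that some vertex lies in all nonempty
  hereditary saturated sets (\<open>strong_csp_iff\<close>). Every admissible pair strictly above \<open>(H, S)\<close> has a
  nonempty hereditary saturated trace in the quotient graph of \<open>(H, S)\<close>, and every such set lifts to
  an admissible pair strictly above \<open>(H, S)\<close>. Hence a vertex common to all of these sets yields an
  element that is common to all ideals strictly above the ideal of \<open>(H, S)\<close> but not in that ideal.
  Conversely, such a vertex is found where the least admissible pair strictly above \<open>(H, S)\<close> exceeds
  \<open>(H, S)\<close>.
\<close>

section \<open>Hereditary saturated closures and the strong CSP\<close>

context wf_digraph
begin

lemma connects_refl: "v \<in> verts G \<Longrightarrow> connects G v v"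
  unfolding connects_def by (auto simp: awalk_Nil_iff intro!: exI[of _ "[]"])

lemma connects_arc: "e \<in> arcs G \<Longrightarrow> connects G (tail G e) (head G e)"
  unfolding connects_def by (auto intro: arc_implies_awalk)

lemma connects_trans: "connects G u v \<Longrightarrow> connects G v w \<Longrightarrow> connects G u w"
  unfolding connects_def by (meson awalk_appendI)

lemma hereditary_iff_arcs:
  "hereditary G X \<longleftrightarrow> X \<subseteq> verts G \<and> (\<forall>e\<in>arcs G. tail G e \<in> X \<longrightarrow> head G e \<in> X)"
proof
  assume "hereditary G X"
  then show "X \<subseteq> verts G \<and> (\<forall>e\<in>arcs G. tail G e \<in> X \<longrightarrow> head G e \<in> X)"
    unfolding hereditary_def using connects_arc by blast
next
  assume X: "X \<subseteq> verts G \<and> (\<forall>e\<in>arcs G. tail G e \<in> X \<longrightarrow> head G e \<in> X)"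
  have "v \<in> X" if "awalk u p v" "u \<in> X" for u p v
    using that by (induction p arbitrary: u) (use X in \<open>auto simp: awalk_simps\<close>)
  with X show "hereditary G X" unfolding hereditary_def connects_def by blast
qed

text \<open>
  The least hereditary saturated set that contains \<open>u\<close>.
\<close>

inductive_set hs_closure :: "'a \<Rightarrow> 'a set" for u where
  reach: "connects G u w \<Longrightarrow> w \<in> hs_closure u"
| saturate: "regular_vertex G v \<Longrightarrow> (\<And>e. e \<in> out_arcs G v \<Longrightarrow> head G e \<in> hs_closure u) \<Longrightarrow>
    v \<in> hs_closure u"

lemma hs_closure_subset_verts: "hs_closure u \<subseteq> verts G"
proof
  fix x assume "x \<in> hs_closure u"
  then show "x \<in> verts G"
    by cases (auto simp: regular_vertex_def connects_def)
qed

lemma hereditary_hs_closure: "hereditary G (hs_closure u)"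
  unfolding hereditary_iff_arcs
proof (intro conjI ballI impI hs_closure_subset_verts)
  fix e assume e: "e \<in> arcs G" and "tail G e \<in> hs_closure u"
  from this(2) show "head G e \<in> hs_closure u"
    by cases (use e connects_arc connects_trans in \<open>auto intro: hs_closure.reach\<close>)
qed

lemma saturated_hs_closure: "saturated G (hs_closure u)"
  unfolding saturated_def using hs_closure_subset_verts by (blast intro: hs_closure.saturate)

text \<open>
  The vertices that \<open>t\<close> reaches through regular vertices only. This set is the countable witness for
  the strong CSP.
\<close>

inductive_set regular_reach :: "'a \<Rightarrow> 'a set" for t where
  start: "t \<in> regular_reach t"
| step: "v \<in> regular_reach t \<Longrightarrow> regular_vertex G v \<Longrightarrow> e \<in> out_arcs G v \<Longrightarrow>
    head G e \<in> regular_reach t"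

text \<open>
  A regular vertex emits finitely many edges, so only finitely many vertices are reached by paths of a
  given length.
\<close>

lemma countable_regular_reach: "countable (regular_reach t)"
proof -
  define level where
    "level = rec_nat {t} (\<lambda>_ A. \<Union>v\<in>{v\<in>A. regular_vertex G v}. head G ` out_arcs G v)"
  have level_Suc: "level (Suc n) = (\<Union>v\<in>{v\<in>level n. regular_vertex G v}. head G ` out_arcs G v)" for n
    by (simp add: level_def)
  have "finite (level n)" for n
  proof (induction n)
    case (Suc n)
    then show ?case unfolding level_Suc by (auto simp: regular_vertex_def)
  qed (simp add: level_def)
  then have "countable (\<Union>n. level n)" by (auto intro: countable_finite)
  moreover have "x \<in> (\<Union>n. level n)" if "x \<in> regular_reach t" for x
    using that
  proof induction
    case start
    have "t \<in> level 0" by (simp add: level_def)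
    then show ?case by blast
  next
    case (step v e)
    then obtain n where "v \<in> level n" by blast
    with step have "head G e \<in> level (Suc n)" unfolding level_Suc by auto
    then show ?case by blast
  qed
  ultimately show ?thesis by (meson countable_subset subsetI)
qed

text \<open>
  Induction on the saturation steps that put \<open>x\<close> into the closure: if \<open>x\<close> was added as a regular
  vertex, any of its edges leads to a vertex that was added earlier and is still reached from \<open>t\<close>
  through regular vertices.
\<close>

lemma hs_closure_meets_regular_reach:
  assumes "x \<in> hs_closure u" "x \<in> regular_reach t"
  shows "\<exists>v\<in>regular_reach t. connects G u v"
  using assms
proof induction
  case (saturate v)
  from saturate.hyps(1) obtain e where "e \<in> out_arcs G v" unfolding regular_vertex_def by blast
  with saturate show ?case by (blast intro: regular_reach.step)
qed blast

text \<open>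
  If \<open>t\<close> lies in every nonempty hereditary saturated set, then it lies in the closure of every vertex
  \<open>u\<close>, so \<open>u\<close> reaches one of the countably many vertices in \<open>regular_reach t\<close>. These are themselves in
  every nonempty hereditary saturated set because such a set is hereditary.
\<close>

lemma strong_csp_iff:
  "strong_csp G (verts G) \<longleftrightarrow>
    (\<exists>t\<in>verts G. \<forall>Y. Y \<noteq> {} \<longrightarrow> hereditary G Y \<longrightarrow> saturated G Y \<longrightarrow> t \<in> Y)"
proof
  assume "strong_csp G (verts G)"
  then obtain T where T: "csp_wrt G (verts G) T"
    and min: "\<forall>Y. Y \<subseteq> verts G \<longrightarrow> Y \<noteq> {} \<longrightarrow> hereditary G Y \<longrightarrow> saturated G Y \<longrightarrow> T \<subseteq> Y"
    unfolding strong_csp_def by blast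
  from T obtain t where "t \<in> T" "t \<in> verts G" unfolding csp_wrt_def by blast
  with min show "\<exists>t\<in>verts G. \<forall>Y. Y \<noteq> {} \<longrightarrow> hereditary G Y \<longrightarrow> saturated G Y \<longrightarrow> t \<in> Y"
    unfolding hereditary_def by blast
next
  assume "\<exists>t\<in>verts G. \<forall>Y. Y \<noteq> {} \<longrightarrow> hereditary G Y \<longrightarrow> saturated G Y \<longrightarrow> t \<in> Y"
  then obtain t where t: "t \<in> verts G"
    and min: "\<And>Y. Y \<noteq> {} \<Longrightarrow> hereditary G Y \<Longrightarrow> saturated G Y \<Longrightarrow> t \<in> Y" by blast
  have sub: "regular_reach t \<subseteq> Y" if Y: "Y \<noteq> {}" "hereditary G Y" "saturated G Y" for Y
  proof
    fix x assume "x \<in> regular_reach t"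
    then show "x \<in> Y"
      by induction (use Y min in \<open>auto simp: hereditary_iff_arcs\<close>)
  qed
  have verts: "regular_reach t \<subseteq> verts G"
    using sub[of "verts G"] t by (auto simp: hereditary_iff_arcs saturated_def regular_vertex_def)
  have "\<exists>v\<in>regular_reach t. connects G u v" if "u \<in> verts G" for u
  proof -
    have "u \<in> hs_closure u" using that by (intro hs_closure.reach connects_refl)
    then have "t \<in> hs_closure u"
      using min[OF _ hereditary_hs_closure saturated_hs_closure] by blast
    then show ?thesis by (rule hs_closure_meets_regular_reach) (rule regular_reach.start)
  qed
  then have "csp_wrt G (verts G) (regular_reach t)"
    unfolding csp_wrt_def using t verts countable_regular_reach by auto
  with sub show "strong_csp G (verts G)" unfolding strong_csp_def by blast
qed

section \<open>Hereditary saturated sets of a quotient graph\<close>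

lemma breaking_vertices_iff:
  "v \<in> breaking_vertices G H \<longleftrightarrow> v \<in> verts G \<and> v \<notin> H \<and> infinite (out_arcs G v)
    \<and> {e \<in> out_arcs G v. head G e \<notin> H} \<noteq> {} \<and> finite {e \<in> out_arcs G v. head G e \<notin> H}"
  unfolding breaking_vertices_def infinite_emitter_def by auto

lemma breaking_vertices_subset: "breaking_vertices G H \<subseteq> verts G - H"
  by (auto simp: breaking_vertices_iff)

context
  fixes H S :: "'a set"
  assumes hered: "hereditary G H" and sat: "saturated G H"
begin

abbreviation "quo \<equiv> quotient_graph G H S"
abbreviation "brv \<equiv> breaking_vertices G H"

lemma wf_quotient_graph: "wf_digraph quo"
proof
  fix e assume "e \<in> arcs quo"
  then show "tail quo e \<in> verts quo" "head quo e \<in> verts quo"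
    using hered breaking_vertices_subset[of H] by (auto simp: quotient_graph_def hereditary_iff_arcs)
qed

lemma out_arcs_quotient:
  "out_arcs quo (Inl w) = Inl ` {e \<in> out_arcs G w. head G e \<notin> H} \<union>
     Inr ` {e \<in> out_arcs G w. head G e \<in> brv - S}"
  "out_arcs quo (Inr w) = {}"
  by (auto simp: quotient_graph_def)

text \<open>
  The edges of \<open>Inl w\<close> are at most two copies of the edges from \<open>w\<close> that avoid \<open>H\<close>. A regular \<open>w\<close>
  keeps at least one of them by saturation of \<open>H\<close>, and a vertex with infinitely many edges keeps
  finitely many and at least one exactly if it is a breaking vertex.
\<close>

lemma regular_quotient_iff:
  "regular_vertex quo (Inl w) \<longleftrightarrow> w \<notin> H \<and> (regular_vertex G w \<or> w \<in> brv)"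
  "\<not> regular_vertex quo (Inr w)"
proof -
  let ?Z = "{e \<in> out_arcs G w. head G e \<notin> H}"
  have "finite {e \<in> out_arcs G w. head G e \<in> brv - S}" if "finite ?Z"
    by (rule finite_subset[OF _ that]) (auto simp: breaking_vertices_iff)
  moreover have "{e \<in> out_arcs G w. head G e \<in> brv - S} = {}" if "?Z = {}"
    using that by (auto simp: breaking_vertices_iff)
  ultimately have "regular_vertex quo (Inl w) \<longleftrightarrow> w \<in> verts G \<and> w \<notin> H \<and> finite ?Z \<and> ?Z \<noteq> {}"
    unfolding regular_vertex_def out_arcs_quotient
    by (auto simp: quotient_graph_def finite_image_iff inj_on_def)
  also have "\<dots> \<longleftrightarrow> w \<notin> H \<and> (regular_vertex G w \<or> w \<in> brv)"
  proof -
    have "finite ?Z" if "finite (out_arcs G w)"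
      by (rule finite_subset[OF _ that]) auto
    moreover have "?Z \<noteq> {}" if "regular_vertex G w" "w \<notin> H"
      using sat that unfolding saturated_def by blast
    ultimately show ?thesis
      unfolding breaking_vertices_iff regular_vertex_def by blast
  qed
  finally show "regular_vertex quo (Inl w) \<longleftrightarrow> w \<notin> H \<and> (regular_vertex G w \<or> w \<in> brv)" .
qed (simp add: regular_vertex_def out_arcs_quotient)

lemma hereditary_quotient_iff:
  "hereditary quo Y \<longleftrightarrow> Y \<subseteq> verts quo \<and>
     (\<forall>e\<in>arcs G. head G e \<notin> H \<longrightarrow> Inl (tail G e) \<in> Y \<longrightarrow>
        Inl (head G e) \<in> Y \<and> (head G e \<in> brv - S \<longrightarrow> Inr (head G e) \<in> Y))"
proof -
  have "(\<forall>e\<in>arcs quo. tail quo e \<in> Y \<longrightarrow> head quo e \<in> Y) \<longleftrightarrow>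
    (\<forall>e\<in>arcs G. Inl (tail G e) \<in> Y \<longrightarrow>
       (head G e \<notin> H \<longrightarrow> Inl (head G e) \<in> Y) \<and> (head G e \<in> brv - S \<longrightarrow> Inr (head G e) \<in> Y))"
    by (auto simp: quotient_graph_def ball_Un)
  also have "\<dots> \<longleftrightarrow> (\<forall>e\<in>arcs G. head G e \<notin> H \<longrightarrow> Inl (tail G e) \<in> Y \<longrightarrow>
        Inl (head G e) \<in> Y \<and> (head G e \<in> brv - S \<longrightarrow> Inr (head G e) \<in> Y))"
    using breaking_vertices_subset[of H] by blast
  finally show ?thesis
    unfolding wf_digraph.hereditary_iff_arcs[OF wf_quotient_graph] by simp
qed

lemma saturated_quotient_iff:
  "saturated quo Y \<longleftrightarrow> Y \<subseteq> verts quo \<and>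
     (\<forall>w. w \<notin> H \<longrightarrow> regular_vertex G w \<or> w \<in> brv \<longrightarrow>
        (\<forall>e\<in>out_arcs G w. head G e \<notin> H \<longrightarrow>
           Inl (head G e) \<in> Y \<and> (head G e \<in> brv - S \<longrightarrow> Inr (head G e) \<in> Y))
        \<longrightarrow> Inl w \<in> Y)"
proof -
  have "saturated quo Y \<longleftrightarrow> Y \<subseteq> verts quo \<and>
     (\<forall>w. regular_vertex quo (Inl w) \<longrightarrow> head quo ` out_arcs quo (Inl w) \<subseteq> Y \<longrightarrow> Inl w \<in> Y)"
    unfolding saturated_def by (simp add: split_sum_all regular_quotient_iff(2))
  moreover have "head quo ` out_arcs quo (Inl w) = Inl ` head G ` {e \<in> out_arcs G w. head G e \<notin> H} \<union>
     Inr ` head G ` {e \<in> out_arcs G w. head G e \<in> brv - S}" for w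
    unfolding out_arcs_quotient by (auto simp: quotient_graph_def image_Un image_image)
  moreover have "Inl ` head G ` {e \<in> out_arcs G w. head G e \<notin> H} \<union>
      Inr ` head G ` {e \<in> out_arcs G w. head G e \<in> brv - S} \<subseteq> Y \<longleftrightarrow>
     (\<forall>e\<in>out_arcs G w. head G e \<notin> H \<longrightarrow>
       Inl (head G e) \<in> Y \<and> (head G e \<in> brv - S \<longrightarrow> Inr (head G e) \<in> Y))" for w
    using breaking_vertices_subset[of H] by blast
  ultimately show ?thesis
    unfolding regular_quotient_iff by (simp only: imp_conjL)
qed

lemma verts_quotient [simp]:
  "Inl w \<in> verts quo \<longleftrightarrow> w \<in> verts G \<and> w \<notin> H" "Inr w \<in> verts quo \<longleftrightarrow> w \<in> brv - S"
  by (auto simp: quotient_graph_def)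

text \<open>
  The vertices of the quotient graph that belong to an ideal with pair \<open>(H', S')\<close>, where \<open>Inr w\<close> stands
  for \<open>w\<^sup>H\<close> and \<open>Inl w\<close> for \<open>w - w\<^sup>H\<close> or, if \<open>w\<close> has no copy, for \<open>w\<close>. The element
  \<open>w - w\<^sup>H = \<Sum>ee\<^sup>*\<close> belongs to the ideal when all the ranges of its edges do, even if \<open>w\<close> does not.
\<close>

definition trace :: "'a set \<Rightarrow> 'a set \<Rightarrow> ('a + 'a) set" where
  "trace H' S' =
     Inl ` {w \<in> verts G - H. w \<in> H' \<or> w \<in> brv \<and> head G ` out_arcs G w \<subseteq> H'} \<union>
     Inr ` ((brv - S) \<inter> (H' \<union> S'))"

lemma trace_iff:
  "Inl w \<in> trace H' S' \<longleftrightarrow>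
     w \<in> verts G \<and> w \<notin> H \<and> (w \<in> H' \<or> w \<in> brv \<and> head G ` out_arcs G w \<subseteq> H')"
  "Inr w \<in> trace H' S' \<longleftrightarrow> w \<in> brv - S \<and> w \<in> H' \<union> S'"
  unfolding trace_def by blast+

lemma trace_hereditary_saturated:
  assumes H': "hereditary G H'" "saturated G H'" and S': "S' \<subseteq> breaking_vertices G H'"
    and le: "H \<subseteq> H'" "S \<subseteq> H' \<union> S'"
  shows "hereditary quo (trace H' S')" "saturated quo (trace H' S')"
proof -
  have emit: "w \<in> H'" if "w \<in> H' \<union> S'" "head G ` out_arcs G w \<subseteq> H'" for w
  proof (rule ccontr)
    assume "w \<notin> H'"
    with that S' have "w \<in> breaking_vertices G H'" by blast
    then obtain e where "e \<in> out_arcs G w" "head G e \<notin> H'"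
      unfolding breaking_vertices_iff by blast
    with that(2) show False by blast
  qed
  have sub: "trace H' S' \<subseteq> verts quo"
    unfolding trace_def using verts_quotient by blast
  show "hereditary quo (trace H' S')"
    unfolding hereditary_quotient_iff

  proof (intro conjI ballI impI sub)
    fix e assume e: "e \<in> arcs G" "head G e \<notin> H" and "Inl (tail G e) \<in> trace H' S'"
    then have "tail G e \<in> H' \<or> head G ` out_arcs G (tail G e) \<subseteq> H'"
      by (auto simp: trace_iff)
    then have "head G e \<in> H'" using e H'(1) unfolding hereditary_iff_arcs by auto
    with e show "Inl (head G e) \<in> trace H' S'" "head G e \<in> brv - S \<Longrightarrow> Inr (head G e) \<in> trace H' S'"
      unfolding trace_iff by auto
  qed
  show "saturated quo (trace H' S')"
    unfolding saturated_quotient_iff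
  proof (intro conjI allI impI sub)
    fix w assume w: "w \<notin> H" "regular_vertex G w \<or> w \<in> brv"
      and out: "\<forall>e\<in>out_arcs G w. head G e \<notin> H \<longrightarrow> Inl (head G e) \<in> trace H' S' \<and>
         (head G e \<in> brv - S \<longrightarrow> Inr (head G e) \<in> trace H' S')"
    have "head G e \<in> H'" if e: "e \<in> out_arcs G w" for e
    proof (cases "head G e \<in> H")
      case False
      with out e have "head G e \<in> H' \<or> head G e \<in> brv \<and> head G ` out_arcs G (head G e) \<subseteq> H'"
        "head G e \<in> brv - S \<longrightarrow> head G e \<in> H' \<union> S'" unfolding trace_iff by blast+
      then show ?thesis using emit le(2) by blast
    qed (use le in auto)
    then have *: "head G ` out_arcs G w \<subseteq> H'" by auto
    have "w \<in> verts G" using w by (auto simp: regular_vertex_def breaking_vertices_iff)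
    with * w show "Inl w \<in> trace H' S'"
      using H'(2) by (auto simp: trace_iff saturated_def)
  qed
qed

lemma trace_nonempty:
  assumes S': "S' \<subseteq> breaking_vertices G H'" and H': "H' \<subseteq> verts G"
    and le: "H \<subseteq> H'" and nle: "\<not> admissible_le (H', S') (H, S)"
  shows "trace H' S' \<noteq> {}"
proof (cases "H' \<subseteq> H")
  case True
  with nle obtain w where "w \<in> S'" "w \<notin> H \<union> S"
    unfolding admissible_le_def split_conv by blast
  moreover have "H' = H" using True le by blast
  ultimately have "Inr w \<in> trace H' S'" using S' unfolding trace_iff by blast
  then show ?thesis by blast
next
  case False
  then obtain w where "w \<in> H'" "w \<notin> H" by blast
  then have "Inl w \<in> trace H' S'" using H' unfolding trace_iff by blast
  then show ?thesis by blast
qed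

text \<open>
  Together with \<open>lift_S\<close> this leads back from sets in the quotient graph to admissible pairs. Since \<open>w\<close>
  is the sum of the elements for which \<open>Inl w\<close> and \<open>Inr w\<close> stand, both copies are required.
\<close>

definition lift_H :: "('a + 'a) set \<Rightarrow> 'a set" where
  "lift_H Y = H \<union> {w. Inl w \<in> Y \<and> (w \<in> brv - S \<longrightarrow> Inr w \<in> Y)}"

definition lift_S :: "('a + 'a) set \<Rightarrow> 'a set" where
  "lift_S Y = {w \<in> breaking_vertices G (lift_H Y). w \<in> S \<or> Inr w \<in> Y}"

context
  fixes Y assumes Y: "hereditary quo Y" "saturated quo Y" and S: "S \<subseteq> brv"
begin

lemma Y_verts: "Inl w \<in> Y \<Longrightarrow> w \<in> verts G \<and> w \<notin> H" "Inr w \<in> Y \<Longrightarrow> w \<in> brv - S"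
  using Y(1) verts_quotient unfolding hereditary_quotient_iff by blast+

lemma Inl_mem_if_out_in_lift:
  assumes w: "w \<notin> H" "regular_vertex G w \<or> w \<in> brv" and out: "head G ` out_arcs G w \<subseteq> lift_H Y"
  shows "Inl w \<in> Y"
proof -
  have "\<forall>e\<in>out_arcs G w. head G e \<notin> H \<longrightarrow>
    Inl (head G e) \<in> Y \<and> (head G e \<in> brv - S \<longrightarrow> Inr (head G e) \<in> Y)"
    using out by (auto simp: lift_H_def)
  with w Y(2) show ?thesis unfolding saturated_quotient_iff by blast
qed

text \<open>
  If all edges from \<open>w\<close> led into the lifted set, saturation of \<open>Y\<close> would give \<open>Inl w \<in> Y\<close>, and
  together with \<open>Inr w \<in> Y\<close> (or the absence of the copy) \<open>w\<close> itself would be lifted.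
\<close>

lemma breaking_lift:
  assumes w: "w \<in> brv" "w \<notin> lift_H Y" and Inr: "w \<in> S \<or> Inr w \<in> Y"
  shows "w \<in> breaking_vertices G (lift_H Y)"
proof -
  have fin: "finite {e \<in> out_arcs G w. head G e \<notin> lift_H Y}"
    by (rule finite_subset[of _ "{e \<in> out_arcs G w. head G e \<notin> H}"])
      (use w(1) in \<open>auto simp: lift_H_def breaking_vertices_iff\<close>)
  have "{e \<in> out_arcs G w. head G e \<notin> lift_H Y} \<noteq> {}"
  proof
    assume "{e \<in> out_arcs G w. head G e \<notin> lift_H Y} = {}"
    then have "Inl w \<in> Y"
      using w by (intro Inl_mem_if_out_in_lift) (auto simp: breaking_vertices_iff)
    with w Inr show False by (auto simp: lift_H_def)
  qed
  with fin w show ?thesis by (auto simp: breaking_vertices_iff)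
qed

lemma lift_admissible: "(lift_H Y, lift_S Y) \<in> admissible_pairs G"
proof -
  have verts: "lift_H Y \<subseteq> verts G"
    using Y_verts hered by (auto simp: lift_H_def hereditary_iff_arcs)
  have "hereditary G (lift_H Y)"
    using verts hered Y(1) unfolding hereditary_quotient_iff hereditary_iff_arcs
    by (auto simp: lift_H_def)
  moreover have "saturated G (lift_H Y)"
    unfolding saturated_def
  proof (intro conjI allI impI verts)
    fix w assume w: "regular_vertex G w" "head G ` out_arcs G w \<subseteq> lift_H Y"
    then have "w \<notin> brv" by (auto simp: regular_vertex_def breaking_vertices_iff)
    with Inl_mem_if_out_in_lift w show "w \<in> lift_H Y"
      by (auto simp: lift_H_def)
  qed
  ultimately show ?thesis by (auto simp: admissible_pairs_def lift_S_def)
qed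

lemma lift_ge: "admissible_le (H, S) (lift_H Y, lift_S Y)"
  using breaking_lift S by (auto simp: admissible_le_def lift_S_def) (auto simp: lift_H_def)

lemma lift_not_le:
  assumes "Y \<noteq> {}"
  shows "\<not> admissible_le (lift_H Y, lift_S Y) (H, S)"
proof
  assume le: "admissible_le (lift_H Y, lift_S Y) (H, S)"
  then have le: "lift_H Y \<subseteq> H" "lift_S Y \<subseteq> H \<union> S" by (auto simp: admissible_le_def)
  have Inr: "Inr w \<notin> Y" for w
  proof
    assume "Inr w \<in> Y"
    moreover from this have "w \<in> brv - S" by (rule Y_verts)
    ultimately show False using le breaking_lift[of w]
      by (auto simp: lift_S_def breaking_vertices_iff)
  qed
  from assms obtain y where "y \<in> Y" by blast
  with Inr obtain w where w: "Inl w \<in> Y" by (cases y) auto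
  then have "w \<in> brv" using le(1) Y_verts(1)[OF w] by (auto simp: lift_H_def)
  then obtain e where e: "e \<in> out_arcs G w" "head G e \<notin> H" by (auto simp: breaking_vertices_iff)
  with w Y(1) have "Inl (head G e) \<in> Y \<and> (head G e \<in> brv - S \<longrightarrow> Inr (head G e) \<in> Y)"
    unfolding hereditary_quotient_iff by auto
  with le(1) e(2) show False by (auto simp: lift_H_def)
qed

end

text \<open>
  Every nonempty hereditary saturated \<open>Y\<close> lifts to a pair strictly above \<open>(H, S)\<close>, hence above the
  least such pair \<open>(H0, S0)\<close>. So a vertex in which \<open>(H0, S0)\<close> exceeds \<open>(H, S)\<close> belongs to all \<open>Y\<close>: as
  \<open>Inl w\<close> if it is new in \<open>H0\<close>, and as \<open>Inr w\<close> if it is new in \<open>S0\<close>.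
\<close>

lemma common_vertex_of_least_pair:
  assumes S: "S \<subseteq> brv"
    and adm0: "H0 \<subseteq> verts G" "S0 \<subseteq> breaking_vertices G H0"
    and ge: "H \<subseteq> H0" and nle: "\<not> admissible_le (H0, S0) (H, S)"
    and least: "\<And>H' S'. (H', S') \<in> admissible_pairs G \<Longrightarrow> admissible_le (H, S) (H', S') \<Longrightarrow>
        \<not> admissible_le (H', S') (H, S) \<Longrightarrow> admissible_le (H0, S0) (H', S')"
  shows "\<exists>t\<in>verts quo. \<forall>Y. Y \<noteq> {} \<longrightarrow> hereditary quo Y \<longrightarrow> saturated quo Y \<longrightarrow> t \<in> Y"
proof -
  have le: "H0 \<subseteq> lift_H Y" "S0 \<subseteq> lift_H Y \<union> lift_S Y"
    if "Y \<noteq> {}" "hereditary quo Y" "saturated quo Y" for Y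
    using least[OF lift_admissible[OF that(2,3) S] lift_ge[OF that(2,3) S]
        lift_not_le[OF that(2,3) S that(1)]] by (auto simp: admissible_le_def)
  show ?thesis
  proof (cases "H0 \<subseteq> H")
    case True
    then obtain w where w: "w \<in> S0" "w \<notin> H" "w \<notin> S"
      using nle unfolding admissible_le_def split_conv by blast
    have "H0 = H" using True ge by blast
    with w have "w \<in> brv - S" using adm0 by blast
    moreover have "Inr w \<in> Y" if "Y \<noteq> {}" "hereditary quo Y" "saturated quo Y" for Y
      using le[OF that] w \<open>w \<in> brv - S\<close> by (auto simp: lift_H_def lift_S_def)
    ultimately show ?thesis using verts_quotient(2) by blast
  next
    case False
    then obtain w where w: "w \<in> H0" "w \<notin> H" by blast
    then have "Inl w \<in> Y" if "Y \<noteq> {}" "hereditary quo Y" "saturated quo Y" for Y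
      using le[OF that] by (auto simp: lift_H_def)
    then show ?thesis using w adm0 verts_quotient(1) by blast
  qed
qed

end

end

section \<open>The free algebra and congruence modulo the kernel\<close>

abbreviation "keys \<equiv> Poly_Mapping.keys"
abbreviation "single \<equiv> Poly_Mapping.single"
abbreviation "lookup \<equiv> Poly_Mapping.lookup"

text \<open>
  The induction rule for statements that are linear in \<open>x\<close>. The set \<open>A\<close> of admitted keys is what
  singles out subspaces such as the span of the real paths.
\<close>

lemma poly_mapping_keys_induct [consumes 1, case_names zero add]:
  fixes x :: "'a \<Rightarrow>\<^sub>0 'k::ab_group_add"
  assumes "keys x \<subseteq> A" "P 0"
    and step: "\<And>k c y. k \<in> A \<Longrightarrow> c \<noteq> 0 \<Longrightarrow> k \<notin> keys y \<Longrightarrow> keys y \<subseteq> A \<Longrightarrow>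
      P y \<Longrightarrow> P (single k c + y)"
  shows "P x"
  using assms(1)
proof (induction "card (keys x)" arbitrary: x)
  case 0
  then have "x = 0" by simp
  with assms(2) show ?case by simp
next
  case (Suc n)
  then obtain k where k: "k \<in> keys x" by fastforce
  define y where "y = x - single k (lookup x k)"
  have keys: "keys y = keys x - {k}"
    unfolding y_def by (auto simp: in_keys_iff lookup_minus lookup_single when_def split: if_splits)
  have "P y"
    by (rule Suc.hyps) (use Suc.hyps(2) Suc.prems k in \<open>auto simp: keys\<close>)
  then have "P (single k (lookup x k) + y)"
    using Suc.prems k by (intro step) (auto simp: keys in_keys_iff)
  then show ?case by (simp add: y_def)
qed

lemma lookup_scale: "lookup (scale c x) k = c * lookup x k"
  unfolding scale_def mult_map_scale_conv_mult[symmetric]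
  by (simp add: Poly_Mapping.map.rep_eq when_def)

lemma scale_simps [simp]:
  "scale c 0 = 0" "scale 0 x = 0" "scale 1 x = x"
  "scale c (x + y) = scale c x + scale c y" "scale c (x - y) = scale c x - scale c y"
  "scale c (scale d x) = scale (c * d) x" "scale (- 1) x = - x"
  by (rule poly_mapping_eqI; simp add: lookup_scale lookup_add lookup_minus algebra_simps)+

lemma scale_mult_left: "scale c x * y = scale c (x * y)"
  by (simp add: scale_def mult.assoc)

lemma single_eq_scale: "single k c = scale c (monomial (letters k))"
  by (rule poly_mapping_eqI) (simp add: lookup_scale monomial_def lookup_single when_def)

lemma monomial_append: "monomial (v @ w) = monomial v * monomial w"
  by (simp add: monomial_def mult_single plus_gen_word_def)

lemma keys_monomial [simp]: "keys (monomial w) = {Word w}"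
  by (simp add: monomial_def)

lemma scale_mult_right: "x * scale c y = scale c (x * (y :: ('v, 'e, 'k::field) free_elem))"
proof -
  have "x * single 0 c = single 0 c * x"
    using subset_UNIV[of "keys x"]
    by (induction x rule: poly_mapping_keys_induct) (simp_all add: algebra_simps mult_single)
  then show ?thesis by (simp add: scale_def mult.assoc[symmetric])
qed

lemma keys_scale: "keys (scale c x) \<subseteq> keys x"
  by (auto simp: in_keys_iff lookup_scale)

lemma free_algebra_iff:
  "x \<in> free_algebra E \<longleftrightarrow>
     keys x \<subseteq> {w. letters w \<noteq> [] \<and> set (letters w) \<subseteq> generators E}"
  by (auto simp: free_algebra_def)

lemma free_algebra_zero [simp]: "0 \<in> free_algebra E"
  by (simp add: free_algebra_def)

lemma free_algebra_monomial:
  "monomial w \<in> free_algebra E \<longleftrightarrow> w \<noteq> [] \<and> set w \<subseteq> generators E"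
  by (simp add: free_algebra_def)

lemma free_algebra_generator [simp]:
  "vx v \<in> free_algebra E \<longleftrightarrow> v \<in> verts E" "ed e \<in> free_algebra E \<longleftrightarrow> e \<in> arcs E"
  "gh e \<in> free_algebra E \<longleftrightarrow> e \<in> arcs E"
  by (auto simp: free_algebra_monomial generators_def)

lemma free_algebra_add [simp]: "x \<in> free_algebra E \<Longrightarrow> y \<in> free_algebra E \<Longrightarrow> x + y \<in> free_algebra E"
  unfolding free_algebra_iff using keys_add[of x y] by blast

lemma free_algebra_scale [simp]: "x \<in> free_algebra E \<Longrightarrow> scale c x \<in> free_algebra E"
  unfolding free_algebra_iff using keys_scale[of c x] by blast

lemma free_algebra_uminus [simp]: "x \<in> free_algebra E \<Longrightarrow> - x \<in> free_algebra E"
  using free_algebra_scale[of x E "-1"] by simp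

lemma free_algebra_diff [simp]: "x \<in> free_algebra E \<Longrightarrow> y \<in> free_algebra E \<Longrightarrow> x - y \<in> free_algebra E"
  using free_algebra_add[of x E "- y"] by simp

lemma free_algebra_sum [simp]: "(\<And>a. a \<in> A \<Longrightarrow> f a \<in> free_algebra E) \<Longrightarrow> sum f A \<in> free_algebra E"
  by (induction A rule: infinite_finite_induct) auto

lemma free_algebra_mult [simp]:
  assumes "x \<in> free_algebra E" "y \<in> free_algebra E" shows "x * y \<in> free_algebra E"
  unfolding free_algebra_iff
proof
  fix w assume "w \<in> keys (x * y)"
  then obtain a b where "a \<in> keys x" "b \<in> keys y" "w = a + b"
    using keys_mult[of x y] by blast
  with assms show "w \<in> {w. letters w \<noteq> [] \<and> set (letters w) \<subseteq> generators E}"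
    by (auto simp: free_algebra_def plus_gen_word_def)
qed

lemma generators_iff [simp]:
  "Vertex v \<in> generators E \<longleftrightarrow> v \<in> verts E" "Edge e \<in> generators E \<longleftrightarrow> e \<in> arcs E"
  "Ghost e \<in> generators E \<longleftrightarrow> e \<in> arcs E"
  by (auto simp: generators_def)

lemma leavitt_kernel_uminus: "x \<in> leavitt_kernel E \<Longrightarrow> - x \<in> leavitt_kernel E"
  using leavitt_kernel.scale[of x E "-1"] by simp

text \<open>
  The preimages of the algebra ideals of the Leavitt path algebra in the free algebra. Almost all of
  the proof takes place there, where the elements form a type that is a ring.
\<close>

definition lpa_ideal :: "('v, 'e) pre_digraph \<Rightarrow> ('v, 'e, 'k::field) free_elem set \<Rightarrow> bool" where
  "lpa_ideal E A \<longleftrightarrow> A \<subseteq> free_algebra E \<and> leavitt_kernel E \<subseteq> A \<and>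
     (\<forall>x\<in>A. \<forall>y\<in>A. x + y \<in> A) \<and> (\<forall>c. \<forall>x\<in>A. scale c x \<in> A) \<and>
     (\<forall>a\<in>free_algebra E. \<forall>x\<in>A. a * x \<in> A \<and> x * a \<in> A)"

lemma lpa_idealD:
  assumes "lpa_ideal E A"
  shows "x \<in> A \<Longrightarrow> x \<in> free_algebra E" "x \<in> leavitt_kernel E \<Longrightarrow> x \<in> A" "0 \<in> A"
    "x \<in> A \<Longrightarrow> y \<in> A \<Longrightarrow> x + y \<in> A" "x \<in> A \<Longrightarrow> scale c x \<in> A" "x \<in> A \<Longrightarrow> - x \<in> A"
    "x \<in> A \<Longrightarrow> y \<in> A \<Longrightarrow> x - y \<in> A"
    "a \<in> free_algebra E \<Longrightarrow> x \<in> A \<Longrightarrow> a * x \<in> A" "a \<in> free_algebra E \<Longrightarrow> x \<in> A \<Longrightarrow> x * a \<in> A"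
proof -
  have scale: "scale c x \<in> A" if "x \<in> A" for c x using assms that by (auto simp: lpa_ideal_def)
  then have um: "- x \<in> A" if "x \<in> A" for x using that by (metis scale_simps(7))
  have add: "x + y \<in> A" if "x \<in> A" "y \<in> A" for x y using assms that by (auto simp: lpa_ideal_def)
  show "x \<in> A \<Longrightarrow> y \<in> A \<Longrightarrow> x - y \<in> A" using add um by (metis uminus_add_conv_diff)
  show "x \<in> A \<Longrightarrow> scale c x \<in> A" "x \<in> A \<Longrightarrow> - x \<in> A" "x \<in> A \<Longrightarrow> y \<in> A \<Longrightarrow> x + y \<in> A"
    using scale um add by auto
qed (use assms leavitt_kernel.zero in \<open>auto simp: lpa_ideal_def\<close>)

lemma lpa_ideal_sum: "lpa_ideal E A \<Longrightarrow> (\<And>i. i \<in> I \<Longrightarrow> f i \<in> A) \<Longrightarrow> sum f I \<in> A"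
  by (induction I rule: infinite_finite_induct) (auto intro: lpa_idealD)

text \<open>
  The parameter \<open>K\<close> fixes the scalars, so that statements need not mention their type.
\<close>

locale leavitt = wf_digraph G for G :: "('v, 'e) pre_digraph" +
  fixes K :: "'k::field itself"
begin

lemma leavitt_relations_subset:
  "(leavitt_relations G :: ('v, 'e, 'k) free_elem set) \<subseteq> free_algebra G"
proof
  fix x :: "('v, 'e, 'k) free_elem"
  assume "x \<in> leavitt_relations G"
  then show "x \<in> free_algebra G"
    proof cases
    case (CK2 v)
    then have "v \<in> verts G" by (simp add: regular_vertex_def)
    then show ?thesis unfolding CK2(1) by (intro free_algebra_diff free_algebra_sum) auto
  qed auto
qed

lemma leavitt_kernel_subset:
  "(leavitt_kernel G :: ('v, 'e, 'k) free_elem set) \<subseteq> free_algebra G"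
proof
  fix x :: "('v, 'e, 'k) free_elem"
  assume "x \<in> leavitt_kernel G"
  then show "x \<in> free_algebra G"
    by induction (use leavitt_relations_subset in auto)
qed

lemma lpa_ideal_kernel: "lpa_ideal G (leavitt_kernel G :: ('v, 'e, 'k) free_elem set)"
  using leavitt_kernel_subset by (auto simp: lpa_ideal_def intro: leavitt_kernel.intros)

lemma lpa_ideal_free_algebra: "lpa_ideal G (free_algebra G :: ('v, 'e, 'k) free_elem set)"
  using leavitt_kernel_subset by (auto simp: lpa_ideal_def)

lemma lpa_ideal_Inter:
  fixes \<A> :: "('v, 'e, 'k) free_elem set set"
  assumes "\<A> \<noteq> {}" "\<And>A. A \<in> \<A> \<Longrightarrow> lpa_ideal G A"
  shows "lpa_ideal G (\<Inter>\<A>)"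
proof -
  have "\<Inter>\<A> \<subseteq> free_algebra G" using assms lpa_idealD(1) by blast
  moreover have "leavitt_kernel G \<subseteq> \<Inter>\<A>" using assms(2) lpa_idealD(2) by blast
  moreover have "\<forall>x\<in>\<Inter>\<A>. \<forall>y\<in>\<Inter>\<A>. x + y \<in> \<Inter>\<A>"
    using assms(2) lpa_idealD(4) by blast
  moreover have "\<forall>c. \<forall>x\<in>\<Inter>\<A>. scale c x \<in> \<Inter>\<A>"
    using assms(2) lpa_idealD(5) by blast
  moreover have "\<forall>a\<in>free_algebra G. \<forall>x\<in>\<Inter>\<A>. a * x \<in> \<Inter>\<A> \<and> x * a \<in> \<Inter>\<A>"
    using assms(2) lpa_idealD(8,9) by blast
  ultimately show ?thesis unfolding lpa_ideal_def by blast
qed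

text \<open>
  Equality in the Leavitt path algebra. Membership in the free algebra is part of it, so that it is a
  congruence for multiplication without side conditions; it is reflexive only on the free algebra.
\<close>

definition eqv :: "('v, 'e, 'k) free_elem \<Rightarrow> ('v, 'e, 'k) free_elem \<Rightarrow> bool"
  (infix "\<doteq>" 50) where
  "x \<doteq> y \<longleftrightarrow> x \<in> free_algebra G \<and> y \<in> free_algebra G \<and> x - y \<in> leavitt_kernel G"

lemma eqvD: "x \<doteq> y \<Longrightarrow> x \<in> free_algebra G" "x \<doteq> y \<Longrightarrow> y \<in> free_algebra G"
  by (auto simp: eqv_def)

lemma eqv_refl: "x \<in> free_algebra G \<Longrightarrow> x \<doteq> x"
  by (simp add: eqv_def leavitt_kernel.zero)

lemma eqv_sym: "x \<doteq> y \<Longrightarrow> y \<doteq> x"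
  unfolding eqv_def using leavitt_kernel_uminus by fastforce

lemma eqv_trans [trans]: "x \<doteq> y \<Longrightarrow> y \<doteq> z \<Longrightarrow> x \<doteq> z"
  unfolding eqv_def using leavitt_kernel.add by fastforce

lemma eqv_add: "x \<doteq> x' \<Longrightarrow> y \<doteq> y' \<Longrightarrow> x + y \<doteq> x' + y'"
  unfolding eqv_def using leavitt_kernel.add by (metis add_diff_add free_algebra_add)

lemma eqv_scale: "x \<doteq> x' \<Longrightarrow> scale c x \<doteq> scale c x'"
  unfolding eqv_def by (metis leavitt_kernel.scale free_algebra_scale scale_simps(5))

lemma eqv_uminus: "x \<doteq> x' \<Longrightarrow> - x \<doteq> - x'"
  using eqv_scale[of x x' "-1"] by simp

lemma eqv_diff: "x \<doteq> x' \<Longrightarrow> y \<doteq> y' \<Longrightarrow> x - y \<doteq> x' - y'"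
  using eqv_add[of x x' "- y" "- y'"] eqv_uminus[of y y'] by simp

lemma eqv_mult:
  assumes "x \<doteq> x'" "y \<doteq> y'" shows "x * y \<doteq> x' * y'"
proof -
  have "x * y - x' * y' = (x - x') * y + x' * (y - y')" by (simp add: algebra_simps)
  with assms show ?thesis unfolding eqv_def
    by (auto intro: leavitt_kernel.add leavitt_kernel.mult_left leavitt_kernel.mult_right)
qed

lemma eqv_mult_left: "y \<doteq> y' \<Longrightarrow> x \<in> free_algebra G \<Longrightarrow> x * y \<doteq> x * y'"
  by (rule eqv_mult[OF eqv_refl])

lemma eqv_mult_right: "x \<doteq> x' \<Longrightarrow> y \<in> free_algebra G \<Longrightarrow> x * y \<doteq> x' * y"
  by (rule eqv_mult[OF _ eqv_refl])

lemma eqv_sum: "(\<And>a. a \<in> A \<Longrightarrow> f a \<doteq> g a) \<Longrightarrow> sum f A \<doteq> sum g A"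
  by (induction A rule: infinite_finite_induct) (auto intro: eqv_add eqv_refl)

lemma eqv_zero_iff: "x \<doteq> 0 \<longleftrightarrow> x \<in> leavitt_kernel G"
  using leavitt_kernel_subset by (auto simp: eqv_def)

lemma lpa_ideal_eqv: "lpa_ideal G A \<Longrightarrow> x \<doteq> y \<Longrightarrow> x \<in> A \<longleftrightarrow> y \<in> A"
proof -
  assume A: "lpa_ideal G A" and "x \<doteq> y"
  then have d: "x - y \<in> A" by (auto simp: eqv_def intro: lpa_idealD)
  show "x \<in> A \<longleftrightarrow> y \<in> A"
  proof
    assume "x \<in> A" then show "y \<in> A" using lpa_idealD(7)[OF A _ d, of x] by simp
  next
    assume "y \<in> A" then show "x \<in> A" using lpa_idealD(4)[OF A d, of y] by simp
  qed
qed

lemma eqv_relation: "x - y \<in> leavitt_relations G \<Longrightarrow> x \<in> free_algebra G \<Longrightarrow> y \<in> free_algebra G \<Longrightarrow> x \<doteq> y"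
  by (auto simp: eqv_def intro: leavitt_kernel.relation)

lemma vx_vx: "v \<in> verts G \<Longrightarrow> w \<in> verts G \<Longrightarrow> vx v * vx w \<doteq> (if v = w then vx v else 0)"
  by (rule eqv_relation[OF leavitt_relations.vertex]) auto

lemma tail_ed: "e \<in> arcs G \<Longrightarrow> vx (tail G e) * ed e \<doteq> ed e"
  by (rule eqv_relation[OF leavitt_relations.edge_source]) auto

lemma ed_head: "e \<in> arcs G \<Longrightarrow> ed e * vx (head G e) \<doteq> ed e"
  by (rule eqv_relation[OF leavitt_relations.edge_range]) auto

lemma head_gh: "e \<in> arcs G \<Longrightarrow> vx (head G e) * gh e \<doteq> gh e"
  by (rule eqv_relation[OF leavitt_relations.ghost_range]) auto

lemma gh_tail: "e \<in> arcs G \<Longrightarrow> gh e * vx (tail G e) \<doteq> gh e"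
  by (rule eqv_relation[OF leavitt_relations.ghost_source]) auto

lemma gh_ed: "e \<in> arcs G \<Longrightarrow> f \<in> arcs G \<Longrightarrow> gh e * ed f \<doteq> (if e = f then vx (head G e) else 0)"
  by (rule eqv_relation[OF leavitt_relations.CK1]) auto

lemma vx_absorb_left:
  assumes x: "vx v * x \<doteq> x" and v: "v \<in> verts G" "w \<in> verts G"
  shows "vx w * x \<doteq> (if w = v then x else 0)"
proof (cases "w = v")
  case False
  have F: "vx w \<in> free_algebra G" "x \<in> free_algebra G" using v eqvD(2)[OF x] by auto
  have "vx w * x \<doteq> vx w * (vx v * x)" by (rule eqv_mult_left[OF eqv_sym[OF x] F(1)])
  also have "vx w * (vx v * x) = (vx w * vx v) * x" by (simp add: mult.assoc)
  also have "\<dots> \<doteq> 0 * x" using vx_vx[OF v(2,1)] False F by (intro eqv_mult_right) auto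
  finally show ?thesis using False by simp
qed (use x in simp)

lemma vx_absorb_right:
  assumes x: "x * vx v \<doteq> x" and v: "v \<in> verts G" "w \<in> verts G"
  shows "x * vx w \<doteq> (if w = v then x else 0)"
proof (cases "w = v")
  case False
  have F: "vx w \<in> free_algebra G" "x \<in> free_algebra G" using v eqvD(2)[OF x] by auto
  have "x * vx w \<doteq> (x * vx v) * vx w" by (rule eqv_mult_right[OF eqv_sym[OF x] F(1)])
  also have "(x * vx v) * vx w = x * (vx v * vx w)" by (simp add: mult.assoc)
  also have "\<dots> \<doteq> x * 0" using vx_vx[OF v(1,2)] False F by (intro eqv_mult_left) auto
  finally show ?thesis using False by simp
qed (use x in simp)

abbreviation pw :: "'v \<Rightarrow> 'e list \<Rightarrow> ('v, 'e, 'k) free_elem" where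
  "pw u p \<equiv> monomial (path_word u p)"

abbreviation gw :: "'v \<Rightarrow> 'e list \<Rightarrow> ('v, 'e, 'k) free_elem" where
  "gw u p \<equiv> monomial (ghost_word u p)"

lemma pw_Nil: "pw u [] = vx u" and gw_Nil: "gw u [] = vx u"
  by (simp_all add: path_word_def ghost_word_def)

lemma path_word_generators:
  assumes "awalk u p v"
  shows "path_word u p \<noteq> []" "set (path_word u p) \<subseteq> generators G"
    "ghost_word u p \<noteq> []" "set (ghost_word u p) \<subseteq> generators G"
  using assms by (auto simp: path_word_def ghost_word_def awalk_def)

lemma pw_in [simp]: "awalk u p v \<Longrightarrow> pw u p \<in> free_algebra G"
  and gw_in [simp]: "awalk u p v \<Longrightarrow> gw u p \<in> free_algebra G"
  using path_word_generators by (auto simp: free_algebra_monomial)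

lemma pw_Cons:
  assumes "awalk u (e # p) v" shows "pw u (e # p) \<doteq> ed e * pw (head G e) p"
proof (cases "p = []")
  case True
  then show ?thesis using assms eqv_sym[OF ed_head[of e]] by (simp add: path_word_def awalk_simps)
next
  case False
  then have "pw u (e # p) = ed e * pw (head G e) p"
    by (simp add: path_word_def monomial_append[symmetric])
  then show ?thesis using eqv_refl[OF pw_in[OF assms]] by metis
qed

lemma gw_Cons:
  assumes "awalk u (e # p) v" shows "gw u (e # p) \<doteq> gw (head G e) p * gh e"
proof (cases "p = []")
  case True
  then show ?thesis using assms eqv_sym[OF head_gh[of e]] by (simp add: ghost_word_def awalk_simps)
next
  case False
  then have "gw u (e # p) = gw (head G e) p * gh e"
    by (simp add: ghost_word_def monomial_append[symmetric])
  then show ?thesis using eqv_refl[OF gw_in[OF assms]] by metis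
qed

lemma gh_vx: "e \<in> arcs G \<Longrightarrow> v \<in> verts G \<Longrightarrow> gh e * vx v \<doteq> (if v = tail G e then gh e else 0)"
  by (rule vx_absorb_right[OF gh_tail]) auto

lemma vx_pw:
  assumes p: "awalk u p a" and v: "v \<in> verts G"
  shows "vx v * pw u p \<doteq> (if v = u then pw u p else 0)"
proof (rule vx_absorb_left[OF _ _ v])
  show u: "u \<in> verts G" using p by auto
  show "vx u * pw u p \<doteq> pw u p"
  proof (cases p)
    case Nil
    then show ?thesis using vx_vx[OF u u] by (simp add: pw_Nil)
  next
    case (Cons e q)
    then have e: "e \<in> arcs G" "tail G e = u" "awalk (head G e) q a" using p by (auto simp: awalk_simps)
    have eq: "pw u p \<doteq> ed e * pw (head G e) q" using pw_Cons p Cons by simp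
    have "vx u * pw u p \<doteq> vx u * (ed e * pw (head G e) q)"
      using eq u by (intro eqv_mult_left) auto
    also have "\<dots> = (vx u * ed e) * pw (head G e) q" by (simp add: mult.assoc)
    also have "\<dots> \<doteq> ed e * pw (head G e) q"
      using tail_ed[OF e(1)] e by (intro eqv_mult_right pw_in[OF e(3)]) auto
    also have "\<dots> \<doteq> pw u p" using eq by (rule eqv_sym)
    finally show ?thesis .
  qed
qed

lemma gw_vx:
  assumes p: "awalk u p a" and v: "v \<in> verts G"
  shows "gw u p * vx v \<doteq> (if v = u then gw u p else 0)"
proof (rule vx_absorb_right[OF _ _ v])
  show u: "u \<in> verts G" using p by auto
  show "gw u p * vx u \<doteq> gw u p"
  proof (cases p)
    case Nil
    then show ?thesis using vx_vx[OF u u] by (simp add: gw_Nil)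
  next
    case (Cons e q)
    then have e: "e \<in> arcs G" "tail G e = u" "awalk (head G e) q a" using p by (auto simp: awalk_simps)
    have eq: "gw u p \<doteq> gw (head G e) q * gh e" using gw_Cons p Cons by simp
    have "gw u p * vx u \<doteq> (gw (head G e) q * gh e) * vx u"
      using eq u by (intro eqv_mult_right) auto
    also have "\<dots> = gw (head G e) q * (gh e * vx u)" by (simp add: mult.assoc)
    also have "\<dots> \<doteq> gw (head G e) q * gh e"
      using gh_tail[OF e(1)] e by (intro eqv_mult_left gw_in[OF e(3)]) auto
    also have "\<dots> \<doteq> gw u p" using eq by (rule eqv_sym)
    finally show ?thesis .
  qed
qed

lemma pw_append:
  assumes "awalk u p a" "awalk a r b"
  shows "pw u (p @ r) \<doteq> pw u p * pw a r"
  using assms(1)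
proof (induction p arbitrary: u)
  case Nil
  then have "u = a" by (simp add: awalk_simps)
  with vx_pw[OF assms(2), of a] assms(2) show ?case by (auto simp: pw_Nil intro: eqv_sym)
next
  case (Cons e p)
  then have e: "e \<in> arcs G" "tail G e = u" "awalk (head G e) p a" by (auto simp: awalk_simps)
  have w: "awalk u (e # p @ r) b" using Cons.prems assms(2) by (auto simp: awalk_simps)
  have "pw u ((e # p) @ r) \<doteq> ed e * pw (head G e) (p @ r)" using pw_Cons[OF w] by simp
  also have "\<dots> \<doteq> ed e * (pw (head G e) p * pw a r)"
    using Cons.IH[OF e(3)] e by (intro eqv_mult_left) auto
  also have "\<dots> = (ed e * pw (head G e) p) * pw a r" by (simp add: mult.assoc)
  also have "\<dots> \<doteq> pw u (e # p) * pw a r"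
    by (rule eqv_mult_right[OF eqv_sym[OF pw_Cons[OF Cons.prems]] pw_in[OF assms(2)]])
  finally show ?case .
qed

lemma pw_vx:
  assumes p: "awalk u p a" and v: "v \<in> verts G"
  shows "pw u p * vx v \<doteq> (if v = a then pw u p else 0)"
proof (rule vx_absorb_right[OF _ _ v])
  show a: "a \<in> verts G" using p by auto
  have "awalk a [] a" using a by (simp add: awalk_simps)
  from pw_append[OF p this] show "pw u p * vx a \<doteq> pw u p" by - (rule eqv_sym, simp add: pw_Nil)
qed

lemma gw_append:
  assumes "awalk u p a" "awalk a r b"
  shows "gw u (p @ r) \<doteq> gw a r * gw u p"
  using assms(1)
proof (induction p arbitrary: u)
  case Nil
  then have "u = a" by (simp add: awalk_simps)
  with gw_vx[OF assms(2), of a] assms(2) show ?case by (auto simp: gw_Nil intro: eqv_sym)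
next
  case (Cons e p)
  then have e: "e \<in> arcs G" "tail G e = u" "awalk (head G e) p a" by (auto simp: awalk_simps)
  have w: "awalk u (e # p @ r) b" using Cons.prems assms(2) by (auto simp: awalk_simps)
  have "gw u ((e # p) @ r) \<doteq> gw (head G e) (p @ r) * gh e" using gw_Cons[OF w] by simp
  also have "\<dots> \<doteq> (gw a r * gw (head G e) p) * gh e"
    using Cons.IH[OF e(3)] e by (intro eqv_mult_right) auto
  also have "\<dots> = gw a r * (gw (head G e) p * gh e)" by (simp add: mult.assoc)
  also have "\<dots> \<doteq> gw a r * gw u (e # p)"
    by (rule eqv_mult_left[OF eqv_sym[OF gw_Cons[OF Cons.prems]] gw_in[OF assms(2)]])
  finally show ?case .
qed

lemma vx_gw:
  assumes p: "awalk u p a" and v: "v \<in> verts G"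
  shows "vx v * gw u p \<doteq> (if v = a then gw u p else 0)"
proof (rule vx_absorb_left[OF _ _ v])
  show a: "a \<in> verts G" using p by auto
  have "awalk a [] a" using a by (simp add: awalk_simps)
  from gw_append[OF p this] show "vx a * gw u p \<doteq> gw u p" by - (rule eqv_sym, simp add: gw_Nil)
qed

text \<open>
  The key computation in a Leavitt path algebra: \<open>\<nu>\<^sup>*\<mu>\<close> cancels \<open>\<nu>\<close> if it is an initial segment of
  \<open>\<mu>\<close>, and vanishes if \<open>\<mu>\<close> and \<open>\<nu>\<close> diverge.
\<close>

lemma gw_pw:
  assumes "awalk z q b" "awalk u p a" "length q \<le> length p"
  shows "gw z q * pw u p \<doteq>
    (if u = z \<and> take (length q) p = q then pw b (drop (length q) p) else 0)"
  using assms
proof (induction q arbitrary: z u p)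
  case Nil
  then have "b = z" "z \<in> verts G" by (auto simp: awalk_simps)
  with vx_pw[OF Nil.prems(2), of z] show ?case by (cases "u = z") (auto simp: gw_Nil)
next
  case (Cons e q)
  then obtain f r where p: "p = f # r" by (cases p) auto
  with Cons.prems have e: "e \<in> arcs G" "tail G e = z" "awalk (head G e) q b"
    and f: "f \<in> arcs G" "tail G f = u" "awalk (head G f) r a"
    by (auto simp: awalk_simps)
  have "gw z (e # q) * pw u p \<doteq> (gw (head G e) q * gh e) * (ed f * pw (head G f) r)"
    using gw_Cons Cons.prems pw_Cons p by (intro eqv_mult) auto
  also have "\<dots> = gw (head G e) q * (gh e * ed f) * pw (head G f) r" by (simp add: mult.assoc)
  also have "\<dots> \<doteq> gw (head G e) q * (if e = f then vx (head G e) else 0) * pw (head G f) r"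
    using e f gh_ed[OF e(1) f(1)] by (intro eqv_mult_right eqv_mult_left) auto
  finally have *: "gw z (e # q) * pw u p \<doteq> \<dots>" .
  show ?case
  proof (cases "e = f")
    case True
    have "gw (head G e) q * vx (head G e) * pw (head G e) r \<doteq> gw (head G e) q * pw (head G e) r"
      using gw_vx[OF e(3), of "head G e"] e f True by (intro eqv_mult_right) auto
    also have "\<dots> \<doteq> (if take (length q) r = q then pw b (drop (length q) r) else 0)"
      using Cons.IH[OF e(3), of "head G e" r] f True Cons.prems p by simp
    finally show ?thesis using eqv_trans[OF *] True p e f by (simp split: if_splits)
  next
    case False
    then show ?thesis using * p by auto
  qed
qed

end

section \<open>Normal forms and local units\<close>

primrec letter_degree :: "('v, 'e) generator \<Rightarrow> int" where
  "letter_degree (Vertex v) = 0" | "letter_degree (Edge e) = 1" | "letter_degree (Ghost e) = - 1"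

text \<open>
  The degree of a word for the \<open>\<int>\<close>-grading. For the word of \<open>\<mu>\<nu>\<^sup>*\<close> it is \<open>|\<mu>| - |\<nu>|\<close>.
\<close>

definition word_degree :: "('v, 'e) gen_word \<Rightarrow> int" where
  "word_degree w = (\<Sum>g\<leftarrow>letters w. letter_degree g)"

lemma word_degree_add: "word_degree (v + w) = word_degree v + word_degree w"
  by (simp add: word_degree_def plus_gen_word_def)

context leavitt
begin

lemma generator_normal_form:
  assumes "g \<in> generators G"
  shows "\<exists>u p a z q. awalk u p a \<and> awalk z q a \<and> letter_degree g = int (length p) - int (length q) \<and>
    monomial [g] \<doteq> pw u p * gw z q"
  using assms
proof (cases g)
  case (Vertex v)
  with assms have v: "v \<in> verts G" by simp
  show ?thesis
    by (rule exI[of _ v], rule exI[of _ "[]"], rule exI[of _ v], rule exI[of _ v], rule exI[of _ "[]"])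
      (use Vertex v eqv_sym[OF vx_vx[OF v v]] in \<open>simp add: pw_Nil gw_Nil awalk_simps\<close>)
next
  case (Edge e)
  with assms have e: "e \<in> arcs G" by simp
  show ?thesis
    by (rule exI[of _ "tail G e"], rule exI[of _ "[e]"], rule exI[of _ "head G e"],
        rule exI[of _ "head G e"], rule exI[of _ "[]"])
      (use Edge e eqv_sym[OF ed_head[OF e]] in \<open>simp add: path_word_def gw_Nil awalk_simps\<close>)
next
  case (Ghost e)
  with assms have e: "e \<in> arcs G" by simp
  show ?thesis
    by (rule exI[of _ "head G e"], rule exI[of _ "[]"], rule exI[of _ "head G e"],
        rule exI[of _ "tail G e"], rule exI[of _ "[e]"])
      (use Ghost e eqv_sym[OF head_gh[OF e]] in \<open>simp add: ghost_word_def pw_Nil awalk_simps\<close>)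
qed

lemma generator_times_normal_form:
  assumes "g \<in> generators G" and p: "awalk u p a" and q: "awalk z q a"
  shows "monomial [g] * (pw u p * gw z q) \<doteq> 0 \<or>
    (\<exists>u' p' a' z' q'. awalk u' p' a' \<and> awalk z' q' a' \<and>
      int (length p') - int (length q') = letter_degree g + int (length p) - int (length q) \<and>
      monomial [g] * (pw u p * gw z q) \<doteq> pw u' p' * gw z' q')"
proof -
  have u: "u \<in> verts G" and gwF: "gw z q \<in> free_algebra G" using p q by auto
  have mult: "monomial [g] * (pw u p * gw z q) \<doteq> y * gw z q" if "monomial [g] * pw u p \<doteq> y" for y
    unfolding mult.assoc[symmetric] by (rule eqv_mult_right[OF that gwF])
  show ?thesis
  proof (cases g)
    case (Vertex v)
    with assms have v: "v \<in> verts G" by simp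
    have *: "monomial [g] * pw u p \<doteq> (if v = u then pw u p else 0)"
      unfolding Vertex by (rule vx_pw[OF p v])
    show ?thesis
    proof (cases "v = u")
      case True
      with mult[OF *] Vertex p q show ?thesis by auto
    next
      case False
      with mult[OF *] show ?thesis by simp
    qed
  next
    case (Edge e)
    with assms have e: "e \<in> arcs G" by simp
    show ?thesis
    proof (cases "head G e = u")
      case True
      then have w: "awalk (tail G e) (e # p) a" using p e by (auto simp: awalk_simps)
      have "monomial [g] * pw u p \<doteq> pw (tail G e) (e # p)"
        using eqv_sym[OF pw_Cons[OF w]] True Edge by simp
      from mult[OF this] w q Edge show ?thesis by fastforce
    next
      case False
      have "monomial [g] * pw u p \<doteq> (ed e * vx (head G e)) * pw u p"
        unfolding Edge by (rule eqv_mult_right[OF eqv_sym[OF ed_head[OF e]] pw_in[OF p]])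
      also have "\<dots> = ed e * (vx (head G e) * pw u p)" by (simp add: mult.assoc)
      also have "\<dots> \<doteq> ed e * 0"
        using vx_pw[OF p, of "head G e"] False e by (intro eqv_mult_left) auto
      finally show ?thesis using mult[of 0] by simp
    qed
  next
    case (Ghost e)
    with assms have e: "e \<in> arcs G" by simp
    have w: "awalk (tail G e) [e] (head G e)" using e by (simp add: awalk_simps)
    have ghe: "gw (tail G e) [e] = gh e" by (simp add: ghost_word_def)
    show ?thesis
    proof (cases p)
      case Nil
      then have ua: "u = a" using p by (simp add: awalk_simps)
      have *: "monomial [g] * pw u p \<doteq> (if u = tail G e then gh e else 0)"
        unfolding Ghost Nil pw_Nil by (rule gh_vx[OF e u])
      show ?thesis
      proof (cases "u = tail G e")
        case True
        then have w2: "awalk z (q @ [e]) (head G e)" using q w ua by auto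
        have "monomial [g] * (pw u p * gw z q) \<doteq> gh e * gw z q" using mult[OF *] True by simp
        also have "\<dots> \<doteq> gw z (q @ [e])"
          using eqv_sym[OF gw_append[OF q, of "[e]" "head G e"]] w True ua ghe by simp
        also have "\<dots> \<doteq> pw (head G e) [] * gw z (q @ [e])"
          using eqv_sym[OF vx_gw[OF w2, of "head G e"]] e by (simp add: pw_Nil)
        finally show ?thesis
          using w2 e Ghost Nil by (intro disjI2 exI[of _ "head G e"] exI[of _ "[]"] exI[of _ z]
              exI[of _ "q @ [e]"]) (auto simp: awalk_simps)
      next
        case False
        with mult[OF *] show ?thesis by simp
      qed
    next
      case (Cons f r)
      have len: "length [e] = 1" by simp
      have "length [e] \<le> length p" using Cons by simp
      from gw_pw[OF w p this] have *: "monomial [g] * pw u p \<doteq>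
          (if u = tail G e \<and> take 1 p = [e] then pw (head G e) (drop 1 p) else 0)"
        unfolding Ghost ghe len .
      show ?thesis
      proof (cases "u = tail G e \<and> take 1 p = [e]")
        case True
        then have "awalk (head G e) r a" "drop 1 p = r" using Cons p by (auto simp: awalk_simps)
        moreover have "monomial [g] * (pw u p * gw z q) \<doteq> pw (head G e) r * gw z q"
          using mult[OF *] True Cons by simp
        ultimately show ?thesis using q Ghost Cons
          by (intro disjI2 exI[of _ "head G e"] exI[of _ r] exI[of _ a] exI[of _ z] exI[of _ q]) simp
      next
        case False
        then have "monomial [g] * pw u p \<doteq> 0" using * by (simp only: if_False)
        from mult[OF this] show ?thesis by simp
      qed
    qed
  qed
qed

text \<open>
  A ghost edge to the left of a path is cancelled or annihilates the product, so letters can be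
  multiplied from the left onto a product \<open>\<mu>\<nu>\<^sup>*\<close> one at a time.
\<close>

lemma word_normal_form:
  assumes "w \<noteq> []" "set w \<subseteq> generators G"
  shows "monomial w \<doteq> 0 \<or> (\<exists>u p a z q. awalk u p a \<and> awalk z q a \<and>
    word_degree (Word w) = int (length p) - int (length q) \<and> monomial w \<doteq> pw u p * gw z q)"
  using assms
proof (induction w)
  case (Cons g w)
  then have g: "g \<in> generators G" by simp
  show ?case
  proof (cases "w = []")
    case True
    then show ?thesis using generator_normal_form[OF g] by (auto simp: word_degree_def)
  next
    case False
    have eq: "monomial (g # w) = monomial [g] * monomial w"
      using monomial_append[of "[g]" w] by simp
    have gF: "monomial [g] \<in> free_algebra G" using g by (simp add: free_algebra_monomial)
    from Cons False have "monomial w \<doteq> 0 \<or> (\<exists>u p a z q. awalk u p a \<and> awalk z q a \<and>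
      word_degree (Word w) = int (length p) - int (length q) \<and> monomial w \<doteq> pw u p * gw z q)" by simp
    then show ?thesis
    proof (elim disjE exE conjE)
      assume "monomial w \<doteq> 0"
      then have "monomial (g # w) \<doteq> monomial [g] * 0" unfolding eq by (rule eqv_mult_left[OF _ gF])
      then show ?thesis by simp
    next
      fix u p a z q
      assume w: "awalk u p a" "awalk z q a" "word_degree (Word w) = int (length p) - int (length q)"
        and "monomial w \<doteq> pw u p * gw z q"
      then have *: "monomial (g # w) \<doteq> monomial [g] * (pw u p * gw z q)"
        unfolding eq by (intro eqv_mult_left[OF _ gF])
      have deg: "word_degree (Word (g # w)) = letter_degree g + int (length p) - int (length q)"
        using w(3) by (simp add: word_degree_def)
      from generator_times_normal_form[OF g w(1,2)] show ?thesis
      proof (elim disjE exE conjE)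
        assume "monomial [g] * (pw u p * gw z q) \<doteq> 0"
        with * show ?thesis using eqv_trans by blast
      next
        fix u' p' a' z' q'
        assume "awalk u' p' a'" "awalk z' q' a'"
          "int (length p') - int (length q') = letter_degree g + int (length p) - int (length q)"
          "monomial [g] * (pw u p * gw z q) \<doteq> pw u' p' * gw z' q'"
        with eqv_trans[OF *] deg show ?thesis by metis
      qed
    qed
  qed
qed simp

definition normal_words :: "nat \<Rightarrow> 'v \<Rightarrow> ('v, 'e) gen_word set" where
  "normal_words m w =
     {Word (path_word u p @ ghost_word w q) | u p q a. awalk u p a \<and> awalk w q a \<and> length q \<le> m}"

definition real_words :: "'v \<Rightarrow> ('v, 'e) gen_word set" where
  "real_words w = {Word (path_word u p) | u p. awalk u p w}"

definition cycle_words :: "'v \<Rightarrow> ('v, 'e) gen_word set" where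
  "cycle_words w = {Word (path_word w p) | p. awalk w p w \<and> p \<noteq> []}"

lemma keys_free_algebra:
  assumes "keys x \<subseteq> A" "\<And>k. k \<in> A \<Longrightarrow> letters k \<noteq> [] \<and> set (letters k) \<subseteq> generators G"
  shows "x \<in> free_algebra G"
  using assms by (auto simp: free_algebra_def)

lemma normal_words_in: "keys x \<subseteq> normal_words m w \<Longrightarrow> x \<in> free_algebra G"
  by (erule keys_free_algebra)
    (auto simp: normal_words_def path_word_generators dest: path_word_generators(2,4)[THEN subsetD])

lemma real_words_in: "keys x \<subseteq> real_words w \<Longrightarrow> x \<in> free_algebra G"
  by (erule keys_free_algebra)
    (auto simp: real_words_def path_word_generators dest: path_word_generators(2,4)[THEN subsetD])

text \<open>
  For a linear map it suffices to look at words: if each word of \<open>x\<close> is mapped into the span of \<open>D\<close>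
  modulo the kernel, so is \<open>x\<close>.
\<close>

lemma keys_linear_eqv:
  assumes x: "keys x \<subseteq> A"
    and T: "T 0 = 0" "\<And>x y. T (x + y) = T x + T y" "\<And>c x. T (scale c x) = scale c (T x)"
    and word: "\<And>k. k \<in> A \<Longrightarrow> k \<in> keys x \<Longrightarrow> \<exists>y. keys y \<subseteq> D \<and> T (monomial (letters k)) \<doteq> y"
  shows "\<exists>y. keys y \<subseteq> D \<and> T x \<doteq> y"
proof -
  have "keys x \<subseteq> A \<inter> keys x" using x by blast
  then show ?thesis
  proof (induction x rule: poly_mapping_keys_induct)
    case zero
    show ?case using T(1) eqv_refl[of 0] by (intro exI[of _ 0]) simp
  next
    case (add k c x)
    from word add obtain y where y: "keys y \<subseteq> D" "T (monomial (letters k)) \<doteq> y" by blast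
    from add obtain z where z: "keys z \<subseteq> D" "T x \<doteq> z" by blast
    have "T (single k c + x) \<doteq> scale c y + z"
      unfolding single_eq_scale T using y z by (intro eqv_add eqv_scale)
    moreover have "keys (scale c y + z) \<subseteq> D"
      using keys_add[of "scale c y" z] keys_scale[of c y] y z by blast
    ultimately show ?case by blast
  qed
qed

lemma keys_linear_zero:
  assumes x: "keys x \<subseteq> A"
    and T: "T 0 = 0" "\<And>x y. T (x + y) = T x + T y" "\<And>c x. T (scale c x) = scale c (T x)"
    and word: "\<And>k. k \<in> A \<Longrightarrow> k \<in> keys x \<Longrightarrow> T (monomial (letters k)) \<doteq> 0"
  shows "T x \<doteq> 0"
  using keys_linear_eqv[OF x T, of "{}"] word by auto

lemma normal_words_mono: "m \<le> n \<Longrightarrow> normal_words m w \<subseteq> normal_words n w"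
proof -
  assume "m \<le> n"
  then have "\<And>q :: 'e list. length q \<le> m \<Longrightarrow> length q \<le> n" by simp
  then show ?thesis unfolding normal_words_def by blast
qed

lemma normal_form:
  assumes x: "x \<in> free_algebra G" and w: "w \<in> verts G"
  shows "\<exists>m y. keys y \<subseteq> normal_words m w \<and> x * vx w \<doteq> y"
proof -
  have "\<exists>y. keys y \<subseteq> (\<Union>m. normal_words m w) \<and> x * vx w \<doteq> y"
  proof (rule keys_linear_eqv[where T = "\<lambda>x. x * vx w"])
    show "keys x \<subseteq> {k. letters k \<noteq> [] \<and> set (letters k) \<subseteq> generators G}"
      using x by (simp add: free_algebra_iff)
    fix k :: "('v, 'e) gen_word" assume "k \<in> {k. letters k \<noteq> [] \<and> set (letters k) \<subseteq> generators G}"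
    then have "letters k \<noteq> []" "set (letters k) \<subseteq> generators G" by auto
    from word_normal_form[OF this]
    show "\<exists>y. keys y \<subseteq> (\<Union>m. normal_words m w) \<and> monomial (letters k) * vx w \<doteq> y"
    proof (elim disjE exE conjE)
      assume "monomial (letters k) \<doteq> 0"
      then have "monomial (letters k) * vx w \<doteq> 0 * vx w" using w by (intro eqv_mult_right) auto
      then show ?thesis by (intro exI[of _ 0]) simp
    next
      fix u p a z q
      assume p: "awalk u p a" and q: "awalk z q a" and eq: "monomial (letters k) \<doteq> pw u p * gw z q"
      have "monomial (letters k) * vx w \<doteq> (pw u p * gw z q) * vx w"
        using eq w by (intro eqv_mult_right) auto
      also have "\<dots> = pw u p * (gw z q * vx w)" by (simp add: mult.assoc)
      also have "\<dots> \<doteq> pw u p * (if w = z then gw z q else 0)"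
        by (rule eqv_mult_left[OF gw_vx[OF q w] pw_in[OF p]])
      finally have *: "monomial (letters k) * vx w \<doteq> pw u p * (if w = z then gw z q else 0)" .
      show ?thesis
      proof (cases "w = z")
        case True
        then have "Word (path_word u p @ ghost_word z q) \<in> normal_words (length q) w"
          using p q by (auto simp: normal_words_def)
        then have "keys (monomial (path_word u p @ ghost_word z q) :: ('v, 'e, 'k) free_elem)
            \<subseteq> (\<Union>m. normal_words m w)"
          using True by auto
        then show ?thesis using * True unfolding monomial_append by auto
      next
        case False
        with * show ?thesis by (intro exI[of _ 0]) simp
      qed
    qed
  qed (simp_all add: algebra_simps scale_mult_left)
  then obtain y where y: "keys y \<subseteq> (\<Union>m. normal_words m w)" "x * vx w \<doteq> y" by blast
  have "\<exists>m. M \<subseteq> normal_words m w" if "finite M" "M \<subseteq> (\<Union>m. normal_words m w)" for M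
    using that
  proof (induction M)
    case (insert k M)
    then obtain m n where "M \<subseteq> normal_words m w" "k \<in> normal_words n w" by blast
    then have "insert k M \<subseteq> normal_words (max m n) w"
      using normal_words_mono[of m "max m n" w] normal_words_mono[of n "max m n" w] by auto
    then show ?case by blast
  qed auto
  from this[OF finite_keys y(1)] y(2) show ?thesis by blast
qed

text \<open>
  Only finitely many vertices occur as the first or last vertex of a word of \<open>x\<close>; their sum acts as a
  unit on \<open>x\<close>, and adding further vertices to the sum changes nothing.
\<close>

lemma local_unit:
  assumes x: "x \<in> free_algebra G"
  shows "\<exists>V. finite V \<and> V \<subseteq> verts G \<and> (\<forall>W. finite W \<and> V \<subseteq> W \<and> W \<subseteq> verts G \<longrightarrow>
    (\<Sum>v\<in>W. vx v) * x \<doteq> x \<and> x * (\<Sum>v\<in>W. vx v) \<doteq> x)"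
proof -
  have word: "\<exists>V. finite V \<and> V \<subseteq> verts G \<and> (\<forall>W. finite W \<and> V \<subseteq> W \<and> W \<subseteq> verts G \<longrightarrow>
    (\<Sum>v\<in>W. vx v) * monomial k \<doteq> monomial k \<and> monomial k * (\<Sum>v\<in>W. vx v) \<doteq> monomial k)"
    if "k \<noteq> []" "set k \<subseteq> generators G" for k
    using word_normal_form[OF that]
  proof (elim disjE exE conjE)
    assume 0: "monomial k \<doteq> 0"
    have "y * monomial k \<doteq> monomial k \<and> monomial k * y \<doteq> monomial k"
      if "y \<in> free_algebra G" for y
      using eqv_trans[OF _ eqv_sym[OF 0], of "y * monomial k"] eqv_mult_left[OF 0 that]
        eqv_trans[OF _ eqv_sym[OF 0], of "monomial k * y"] eqv_mult_right[OF 0 that] by simp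
    moreover have "(\<Sum>v\<in>W. vx v) \<in> free_algebra G" if "W \<subseteq> verts G" for W
      using that by (intro free_algebra_sum) auto
    ultimately show ?thesis by (intro exI[of _ "{}"]) blast
  next
    fix u p a z q
    assume p: "awalk u p a" and q: "awalk z q a" and eq: "monomial k \<doteq> pw u p * gw z q"
    have uz: "u \<in> verts G" "z \<in> verts G" using p q by auto
    have "(\<Sum>v\<in>W. vx v) * monomial k \<doteq> monomial k \<and> monomial k * (\<Sum>v\<in>W. vx v) \<doteq> monomial k"
      if W: "finite W" "{u, z} \<subseteq> W" "W \<subseteq> verts G" for W
    proof
      have WF: "(\<Sum>v\<in>W. vx v) \<in> free_algebra G" using W by (intro free_algebra_sum) auto
      have "(\<Sum>v\<in>W. vx v) * monomial k \<doteq> (\<Sum>v\<in>W. vx v) * (pw u p * gw z q)"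
        by (rule eqv_mult_left[OF eq WF])
      also have "\<dots> = (\<Sum>v\<in>W. vx v * pw u p) * gw z q"
        by (simp add: sum_distrib_right mult.assoc)
      also have "\<dots> \<doteq> (\<Sum>v\<in>W. if v = u then pw u p else 0) * gw z q"
        using W by (intro eqv_mult_right[OF _ gw_in[OF q]] eqv_sum vx_pw[OF p]) auto
      also have "\<dots> = pw u p * gw z q" using W by simp
      also have "\<dots> \<doteq> monomial k" by (rule eqv_sym[OF eq])
      finally show "(\<Sum>v\<in>W. vx v) * monomial k \<doteq> monomial k" .
      have "monomial k * (\<Sum>v\<in>W. vx v) \<doteq> (pw u p * gw z q) * (\<Sum>v\<in>W. vx v)"
        by (rule eqv_mult_right[OF eq WF])
      also have "\<dots> = pw u p * (\<Sum>v\<in>W. gw z q * vx v)"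
        by (simp add: sum_distrib_left mult.assoc)
      also have "\<dots> \<doteq> pw u p * (\<Sum>v\<in>W. if v = z then gw z q else 0)"
        using W by (intro eqv_mult_left[OF _ pw_in[OF p]] eqv_sum gw_vx[OF q]) auto
      also have "\<dots> = pw u p * gw z q" using W by simp
      also have "\<dots> \<doteq> monomial k" by (rule eqv_sym[OF eq])
      finally show "monomial k * (\<Sum>v\<in>W. vx v) \<doteq> monomial k" .
    qed
    then show ?thesis using uz by (intro exI[of _ "{u, z}"]) auto
  qed
  have "keys x \<subseteq> {w. letters w \<noteq> [] \<and> set (letters w) \<subseteq> generators G}"
    using x by (simp add: free_algebra_iff)
  then show ?thesis
  proof (induction x rule: poly_mapping_keys_induct)
    case zero
    show ?case by (intro exI[of _ "{}"]) (simp add: eqv_refl)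
  next
    case (add k c y)
    then obtain V where V: "finite V" "V \<subseteq> verts G" and Vy: "\<And>W. finite W \<and> V \<subseteq> W \<and> W \<subseteq> verts G \<Longrightarrow>
      (\<Sum>v\<in>W. vx v) * y \<doteq> y \<and> y * (\<Sum>v\<in>W. vx v) \<doteq> y" by blast
    from word[of "letters k"] add obtain V' where V': "finite V'" "V' \<subseteq> verts G"
      and Vk: "\<And>W. finite W \<and> V' \<subseteq> W \<and> W \<subseteq> verts G \<Longrightarrow>
      (\<Sum>v\<in>W. vx v) * monomial (letters k) \<doteq> monomial (letters k) \<and>
      monomial (letters k) * (\<Sum>v\<in>W. vx v) \<doteq> monomial (letters k)" by blast
    have "(\<Sum>v\<in>W. vx v) * (single k c + y) \<doteq> single k c + y \<and>
      (single k c + y) * (\<Sum>v\<in>W. vx v) \<doteq> single k c + y"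
      if W: "finite W" "V \<union> V' \<subseteq> W" "W \<subseteq> verts G" for W
      unfolding single_eq_scale distrib_left distrib_right scale_mult_left scale_mult_right
      using Vy[of W] Vk[of W] W by (auto intro!: eqv_add eqv_scale)
    with V V' show ?case by (intro exI[of _ "V \<union> V'"]) auto
  qed
qed

end

section \<open>Closed walks under condition (K)\<close>

context wf_digraph
begin

lemma awalk_remainder: "awalk u p v \<Longrightarrow> awalk u (p @ r) w \<Longrightarrow> awalk v r w"
  by auto

text \<open>
  Suppose all closed walks at \<open>w\<close> were comparable, and let \<open>c\<close> be a shortest one. Each other closed
  walk begins with \<open>c\<close>, and what follows is again closed at \<open>w\<close>; so it is a power of \<open>c\<close> and has the
  same edges, against condition (K).
\<close>

lemma closed_walks_incomparable:
  assumes K: "condition_K G" and p: "awalk w p w" "p \<noteq> []"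
  shows "\<exists>c d. awalk w c w \<and> awalk w d w \<and> \<not> prefix c d \<and> \<not> prefix d c"
proof (rule ccontr)
  assume "\<not> ?thesis"
  then have comp: "prefix c d \<or> prefix d c" if "awalk w c w" "awalk w d w" for c d
    using that by blast
  obtain c where c: "awalk w c w" "c \<noteq> []"
    and short: "\<And>q. awalk w q w \<Longrightarrow> q \<noteq> [] \<Longrightarrow> length c \<le> length q"
    using ex_has_least_nat[of "\<lambda>q. awalk w q w \<and> q \<noteq> []" p length] p by blast
  have "set q = set c" if "awalk w q w" "q \<noteq> []" for q
    using that
  proof (induction "length q" arbitrary: q rule: less_induct)
    case less
    have "prefix c q"
      using comp[OF c(1) less.prems(1)] short[OF less.prems] by (auto simp: prefix_def)
    then obtain r where q: "q = c @ r" by (auto simp: prefix_def)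
    then have r: "awalk w r w" using less.prems(1) awalk_remainder[OF c(1)] by blast
    show ?case
    proof (cases "r = []")
      case False
      then have "set r = set c" using less.hyps[OF _ r] q c(2) by simp
      with q show ?thesis by simp
    qed (use q in simp)
  qed
  moreover have "\<exists>q. closed_path G w q \<and> set q \<noteq> set c"
  proof -
    have "w \<in> set (awalk_verts w c)" using c by (cases c) (auto simp: awalk_simps)
    moreover have "closed_path G w c" using c by (simp add: closed_path_def)
    ultimately show ?thesis using K unfolding condition_K_def by blast
  qed
  ultimately show False unfolding closed_path_def by blast
qed

lemma prefix_power:
  assumes "prefix c (g @ c)" shows "prefix c (concat (replicate n g) @ c)"
proof (induction n)
  case (Suc n)
  then have "prefix (g @ c) (g @ concat (replicate n g) @ c)" by simp
  with assms show ?case by (simp add: prefix_order.trans)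
qed simp

text \<open>
  A walk \<open>c\<close> that is a prefix of \<open>g @ c\<close> is a prefix of a power of \<open>g\<close>. Two incomparable closed walks
  cannot both be prefixes of a long power of \<open>g\<close>.
\<close>

lemma ex_closed_walk_not_prefix:
  assumes K: "condition_K G" and g: "awalk w g w" "g \<noteq> []"
  shows "\<exists>c. awalk w c w \<and> \<not> prefix c (g @ c)"
proof (rule ccontr)
  assume "\<not> ?thesis"
  then have pre: "prefix c (g @ c)" if "awalk w c w" for c using that by blast
  obtain c d where cd: "awalk w c w" "awalk w d w" "\<not> prefix c d" "\<not> prefix d c"
    using closed_walks_incomparable[OF K g] by blast
  \<comment> \<open>The \<open>n\<close>-th power of \<open>g\<close> is at least as long as \<open>c\<close> and as \<open>d\<close>.\<close>
  define n where "n = length c + length d"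
  have len: "n \<le> length (concat (replicate n g))"
  proof -
    have "length (concat (replicate n g)) = n * length g" by (simp add: length_concat sum_list_replicate)
    then show ?thesis using g(2) by (cases g) auto
  qed
  have "prefix x (concat (replicate n g))" if "awalk w x w" "length x \<le> n" for x
    using prefix_power[OF pre[OF that(1)], of n] len that(2)
    by (meson prefix_length_prefix prefixI le_trans)
  from this[OF cd(1)] this[OF cd(2)] cd(3,4) show False
    using prefix_same_cases by (auto simp: n_def)
qed

text \<open>
  Extending \<open>c\<close> to the right keeps the property for the walks already dealt with. If \<open>c\<close> is a prefix of
  \<open>g @ c = c @ d\<close>, then extending it by a walk that is not a prefix after \<open>d\<close> deals with \<open>g\<close> as well.
\<close>

lemma ex_closed_walk_kills:
  assumes K: "condition_K G" and w: "w \<in> verts G"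
    and "finite M" "\<And>g. g \<in> M \<Longrightarrow> awalk w g w \<and> g \<noteq> []"
  shows "\<exists>c. awalk w c w \<and> (\<forall>g\<in>M. \<not> prefix c (g @ c))"
  using assms(3,4)
proof (induction M)
  case empty
  have "awalk w [] w" using w by (simp add: awalk_simps)
  then show ?case by blast
next
  case (insert g M)
  then obtain c where c: "awalk w c w" and cM: "\<And>h. h \<in> M \<Longrightarrow> \<not> prefix c (h @ c)" by auto
  show ?case
  proof (cases "prefix c (g @ c)")
    case True
    then obtain d where d: "g @ c = c @ d" by (auto simp: prefix_def)
    have "awalk w (g @ c) w" using insert.prems c by (meson awalk_appendI insertI1)
    then have "awalk w d w" unfolding d by (rule awalk_remainder[OF c])
    moreover have "d \<noteq> []" using d insert.prems by auto
    ultimately obtain c' where c': "awalk w c' w" "\<not> prefix c' (d @ c')"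
      using ex_closed_walk_not_prefix[OF K] by blast
    have "awalk w (c @ c') w" using c c' by (meson awalk_appendI)
    moreover have "\<not> prefix (c @ c') (h @ c @ c')" if "h \<in> M" for h
    proof
      assume "prefix (c @ c') (h @ c @ c')"
      then have "prefix c ((h @ c) @ c')" by (simp add: append_prefixD)
      then have "prefix c (h @ c)" by (rule prefix_length_prefix) auto
      with cM that show False by blast
    qed
    moreover have "\<not> prefix (c @ c') (g @ c @ c')"
      using c'(2) d by (metis append.assoc same_prefix_prefix)
    ultimately show ?thesis by blast
  next
    case False
    with c cM show ?thesis by blast
  qed
qed

end

section \<open>The admissible pair of an ideal\<close>

context leavitt
begin

text \<open>
  The idempotent of the paths from \<open>w\<close> that do not begin with an edge in \<open>X\<close>. For \<open>X = {}\<close> it is \<open>w\<close>,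
  for the edges of a regular \<open>w\<close> it is zero by the last relation, and for the edges avoiding \<open>H\<close> it is
  the element \<open>w\<^sup>H\<close> of a breaking vertex.
\<close>

definition gap :: "'v \<Rightarrow> 'e set \<Rightarrow> ('v, 'e, 'k) free_elem" where
  "gap w X = vx w - (\<Sum>e\<in>X. ed e * gh e)"

lemma gap_in [simp]: "w \<in> verts G \<Longrightarrow> X \<subseteq> out_arcs G w \<Longrightarrow> gap w X \<in> free_algebra G"
  unfolding gap_def by (intro free_algebra_diff free_algebra_sum) auto

lemma gap_out_arcs: "regular_vertex G w \<Longrightarrow> gap w (out_arcs G w) \<in> leavitt_kernel G"
  unfolding gap_def by (intro leavitt_kernel.relation leavitt_relations.CK2)

lemma gap_subset: "finite Y \<Longrightarrow> X \<subseteq> Y \<Longrightarrow> gap w X = gap w Y + (\<Sum>e\<in>Y - X. ed e * gh e)"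
  by (simp add: gap_def sum_diff finite_subset)

lemma gap_empty: "gap w {} = vx w"
  by (simp add: gap_def)

lemma gh_gap:
  assumes X: "finite X" "X \<subseteq> out_arcs G w" and e: "e \<in> out_arcs G w"
  shows "gh e * gap w X \<doteq> (if e \<in> X then 0 else gh e)"
proof -
  have w: "w \<in> verts G" and e': "e \<in> arcs G" "tail G e = w" using e by auto
  have summand: "gh e * (ed f * gh f) \<doteq> (if f = e then gh e else 0)" if "f \<in> X" for f
  proof -
    have f: "f \<in> arcs G" using X that by auto
    have "gh e * ed f * gh f \<doteq> (if e = f then vx (head G e) else 0) * gh f"
      using gh_ed[OF e'(1) f] f by (intro eqv_mult_right) auto
    then show ?thesis
      using head_gh[OF e'(1)] by (auto simp: mult.assoc intro: eqv_trans)
  qed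
  have "gh e * gap w X = gh e * vx w - (\<Sum>f\<in>X. gh e * (ed f * gh f))"
    by (simp add: gap_def right_diff_distrib sum_distrib_left)
  also have "\<dots> \<doteq> gh e - (\<Sum>f\<in>X. if f = e then gh e else 0)"
    using gh_tail[OF e'(1)] e' by (intro eqv_diff eqv_sum summand) auto
  also have "\<dots> = (if e \<in> X then 0 else gh e)" using X by simp
  finally show ?thesis .
qed

lemma gap_ed:
  assumes X: "finite X" "X \<subseteq> out_arcs G w" and e: "e \<in> out_arcs G w"
  shows "gap w X * ed e \<doteq> (if e \<in> X then 0 else ed e)"
proof -
  have w: "w \<in> verts G" and e': "e \<in> arcs G" "tail G e = w" using e by auto
  have summand: "(ed f * gh f) * ed e \<doteq> (if f = e then ed e else 0)" if "f \<in> X" for f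
  proof -
    have f: "f \<in> arcs G" using X that by auto
    have "ed f * (gh f * ed e) \<doteq> ed f * (if f = e then vx (head G f) else 0)"
      using gh_ed[OF f e'(1)] f by (intro eqv_mult_left) auto
    then show ?thesis
      using ed_head[OF e'(1)] by (auto simp: mult.assoc intro: eqv_trans)
  qed
  have "gap w X * ed e = vx w * ed e - (\<Sum>f\<in>X. (ed f * gh f) * ed e)"
    by (simp add: gap_def left_diff_distrib sum_distrib_right)
  also have "\<dots> \<doteq> ed e - (\<Sum>f\<in>X. if f = e then ed e else 0)"
    using tail_ed[OF e'(1)] e' by (intro eqv_diff eqv_sum summand) auto
  also have "\<dots> = (if e \<in> X then 0 else ed e)" using X by simp
  finally show ?thesis .
qed

lemma vx_gap:
  assumes X: "finite X" "X \<subseteq> out_arcs G w" and w: "w \<in> verts G"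
  shows "vx w * gap w X \<doteq> gap w X"
proof -
  have "vx w * gap w X = vx w * vx w - (\<Sum>f\<in>X. (vx w * ed f) * gh f)"
    by (simp add: gap_def right_diff_distrib sum_distrib_left mult.assoc)
  also have "\<dots> \<doteq> vx w - (\<Sum>f\<in>X. ed f * gh f)"
  proof (intro eqv_diff eqv_sum eqv_mult_right)
    show "vx w * vx w \<doteq> vx w" using vx_vx[OF w w] by simp
    fix f assume "f \<in> X"
    with X have f: "f \<in> arcs G" "tail G f = w" by auto
    then show "vx w * ed f \<doteq> ed f" "gh f \<in> free_algebra G" using tail_ed[OF f(1)] by auto
  qed
  finally show ?thesis by (simp add: gap_def)
qed

lemma gap_vx:
  assumes X: "finite X" "X \<subseteq> out_arcs G w" and w: "w \<in> verts G"
  shows "gap w X * vx w \<doteq> gap w X"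
proof -
  have "gap w X * vx w = vx w * vx w - (\<Sum>f\<in>X. ed f * (gh f * vx w))"
    by (simp add: gap_def left_diff_distrib sum_distrib_right mult.assoc)
  also have "\<dots> \<doteq> vx w - (\<Sum>f\<in>X. ed f * gh f)"
  proof (intro eqv_diff eqv_sum eqv_mult_left)
    show "vx w * vx w \<doteq> vx w" using vx_vx[OF w w] by simp
    fix f assume "f \<in> X"
    with X have f: "f \<in> arcs G" "tail G f = w" by auto
    then show "gh f * vx w \<doteq> gh f" "ed f \<in> free_algebra G" using gh_tail[OF f(1)] by auto
  qed
  finally show ?thesis by (simp add: gap_def)
qed

lemma gap_gap:
  assumes X: "finite X" "X \<subseteq> out_arcs G w" and w: "w \<in> verts G"
  shows "gap w X * gap w X \<doteq> gap w X"
proof -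
  have "gap w X * gap w X = gap w X * vx w - (\<Sum>f\<in>X. (gap w X * ed f) * gh f)"
    by (subst (2) gap_def) (simp add: right_diff_distrib sum_distrib_left mult.assoc)
  also have "\<dots> \<doteq> gap w X - (\<Sum>f\<in>X. 0 * gh f)"
  proof (intro eqv_diff eqv_sum eqv_mult_right)
    show "gap w X * vx w \<doteq> gap w X" by (rule gap_vx[OF X w])
    fix f assume "f \<in> X"
    with gap_ed[OF X, of f] X show "gap w X * ed f \<doteq> 0" by auto
    show "gh f \<in> free_algebra G" using X \<open>f \<in> X\<close> by auto
  qed
  finally show ?thesis by simp
qed

definition vertex_set :: "('v, 'e, 'k) free_elem set \<Rightarrow> 'v set" where
  "vertex_set A = {v \<in> verts G. vx v \<in> A}"

definition breaking_element :: "'v set \<Rightarrow> 'v \<Rightarrow> ('v, 'e, 'k) free_elem" where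
  "breaking_element H v = gap v {e \<in> out_arcs G v. head G e \<notin> H}"

definition breaking_set :: "('v, 'e, 'k) free_elem set \<Rightarrow> 'v set" where
  "breaking_set A = {v \<in> breaking_vertices G (vertex_set A). breaking_element (vertex_set A) v \<in> A}"

lemma breaking_element_in [simp]: "v \<in> verts G \<Longrightarrow> breaking_element H v \<in> free_algebra G"
  unfolding breaking_element_def by (intro gap_in) auto

context
  fixes A :: "('v, 'e, 'k) free_elem set"
  assumes A: "lpa_ideal G A"
begin

lemma scale_mem_iff: "k \<noteq> 0 \<Longrightarrow> scale k x \<in> A \<longleftrightarrow> x \<in> A"
  using lpa_idealD(5)[OF A, of x k] lpa_idealD(5)[OF A, of "scale k x" "inverse k"] by auto

lemma diff_mem_iff: "x - y \<in> A \<Longrightarrow> x \<in> A \<longleftrightarrow> y \<in> A"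
  using lpa_idealD(4)[OF A, of "x - y" y] lpa_idealD(7)[OF A, of x "x - y"] by auto

lemma ed_mem: "e \<in> arcs G \<Longrightarrow> vx (head G e) \<in> A \<Longrightarrow> ed e \<in> A"
  using lpa_ideal_eqv[OF A ed_head, of e] lpa_idealD(8)[OF A, of "ed e" "vx (head G e)"] by simp

lemma ed_gh_mem_iff:
  assumes e: "e \<in> arcs G" shows "ed e * gh e \<in> A \<longleftrightarrow> vx (head G e) \<in> A"
proof
  assume "vx (head G e) \<in> A"
  then show "ed e * gh e \<in> A" using e by (intro lpa_idealD(9)[OF A] ed_mem) simp_all
next
  assume mem: "ed e * gh e \<in> A"
  have "gh e * (ed e * gh e) * ed e = (gh e * ed e) * (gh e * ed e)" by (simp add: mult.assoc)
  also have "\<dots> \<doteq> vx (head G e) * vx (head G e)"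
    using gh_ed[OF e e] by (intro eqv_mult) auto
  also have "\<dots> \<doteq> vx (head G e)" using vx_vx[of "head G e" "head G e"] e by simp
  finally have eq: "gh e * (ed e * gh e) * ed e \<doteq> vx (head G e)" .
  have "gh e * (ed e * gh e) * ed e \<in> A"
    using e by (intro lpa_idealD(9)[OF A _ lpa_idealD(8)[OF A _ mem]]) auto
  then show "vx (head G e) \<in> A" using lpa_ideal_eqv[OF A eq] by simp
qed

lemma vx_head_mem:
  assumes e: "e \<in> arcs G" and "vx (tail G e) \<in> A" shows "vx (head G e) \<in> A"
proof -
  have "vx (tail G e) * (ed e * gh e) \<in> A" using assms by (intro lpa_idealD(9)[OF A]) auto
  moreover have "(vx (tail G e) * ed e) * gh e \<doteq> ed e * gh e"
    using tail_ed[OF e] e by (intro eqv_mult_right) auto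
  ultimately show ?thesis using lpa_ideal_eqv[OF A] ed_gh_mem_iff[OF e] by (simp add: mult.assoc)
qed

text \<open>
  The two elements differ by terms \<open>ee\<^sup>*\<close>, which lie in the ideal together with the ranges of the \<open>e\<close>.
\<close>

lemma gap_mem_iff:
  assumes Y: "finite Y" "X \<subseteq> Y" "Y \<subseteq> arcs G" and head: "head G ` (Y - X) \<subseteq> vertex_set A"
  shows "gap w X \<in> A \<longleftrightarrow> gap w Y \<in> A"
proof (rule diff_mem_iff)
  have "(\<Sum>e\<in>Y - X. ed e * gh e) \<in> A"
  proof (rule lpa_ideal_sum[OF A])
    fix e assume e: "e \<in> Y - X"
    then have "e \<in> arcs G" "vx (head G e) \<in> A" using Y head by (auto simp: vertex_set_def)
    then show "ed e * gh e \<in> A" using ed_gh_mem_iff by simp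
  qed
  then show "gap w X - gap w Y \<in> A" using gap_subset[OF Y(1,2)] by simp
qed

lemma pair_admissible: "(vertex_set A, breaking_set A) \<in> admissible_pairs G"
proof -
  have "hereditary G (vertex_set A)"
    unfolding hereditary_iff_arcs using vx_head_mem by (auto simp: vertex_set_def)
  moreover have "saturated G (vertex_set A)"
    unfolding saturated_def
  proof (intro conjI allI impI)
    fix v assume v: "regular_vertex G v" "head G ` out_arcs G v \<subseteq> vertex_set A"
    then have fin: "finite (out_arcs G v)" "v \<in> verts G" by (auto simp: regular_vertex_def)
    have "gap v {} \<in> A \<longleftrightarrow> gap v (out_arcs G v) \<in> A"
      using v fin by (intro gap_mem_iff) auto
    with fin lpa_idealD(2)[OF A gap_out_arcs[OF v(1)]] show "v \<in> vertex_set A"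
      by (simp add: gap_empty vertex_set_def)
  qed (auto simp: vertex_set_def)
  ultimately show ?thesis by (auto simp: admissible_pairs_def breaking_set_def)
qed

text \<open>
  Replacing \<open>H\<close> by the larger vertex set of the ideal changes \<open>v\<^sup>H\<close> only by elements of the ideal. If
  no edge from \<open>v\<close> avoids the vertex set, the element becomes \<open>v\<close> itself; this is the case in which \<open>v\<close>
  is no breaking vertex any more.
\<close>

lemma breaking_element_mem_iff:
  assumes v: "v \<in> breaking_vertices G H" and H: "H \<subseteq> vertex_set A"
  shows "breaking_element H v \<in> A \<longleftrightarrow> v \<in> vertex_set A \<union> breaking_set A"
proof -
  let ?Z = "{e \<in> out_arcs G v. head G e \<notin> H}" and ?Z' = "{e \<in> out_arcs G v. head G e \<notin> vertex_set A}"
  have vv: "v \<in> verts G" and inf: "infinite (out_arcs G v)" and fin: "finite ?Z"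
    using v by (auto simp: breaking_vertices_iff)
  have sub: "?Z' \<subseteq> ?Z" using H by auto
  have eq: "breaking_element H v \<in> A \<longleftrightarrow> breaking_element (vertex_set A) v \<in> A"
    unfolding breaking_element_def by (rule gap_mem_iff[OF fin sub, symmetric]) auto
  show ?thesis
  proof (cases "v \<in> vertex_set A")
    case True
    then have "vx v * breaking_element H v \<in> A" using vv by (intro lpa_idealD(9)[OF A]) (auto simp: vertex_set_def)
    moreover have "vx v * breaking_element H v \<doteq> breaking_element H v" unfolding breaking_element_def by (rule vx_gap[OF fin _ vv]) auto
    ultimately show ?thesis using True lpa_ideal_eqv[OF A] by blast
  next
    case False
    have "v \<in> breaking_vertices G (vertex_set A)" if "breaking_element (vertex_set A) v \<in> A"
    proof -
      have "?Z' \<noteq> {}" using that False vv by (auto simp only: breaking_element_def gap_empty vertex_set_def)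
      then show ?thesis using False vv inf finite_subset[OF sub fin] unfolding breaking_vertices_iff by blast
    qed
    then show ?thesis using False eq by (auto simp: breaking_set_def)
  qed
qed

lemma admissible_le_pair_iff:
  assumes "S \<subseteq> breaking_vertices G H"
  shows "admissible_le (H, S) (vertex_set A, breaking_set A) \<longleftrightarrow>
    H \<subseteq> vertex_set A \<and> (\<forall>v\<in>S. breaking_element H v \<in> A)"
proof (cases "H \<subseteq> vertex_set A")
  case True
  have "(\<forall>v\<in>S. breaking_element H v \<in> A) \<longleftrightarrow> S \<subseteq> vertex_set A \<union> breaking_set A"
    using breaking_element_mem_iff[OF _ True] assms by blast
  with True show ?thesis by (simp add: admissible_le_def)
qed (simp add: admissible_le_def)

end

lemma vertex_set_eq_verts_iff:
  fixes A :: "('v, 'e, 'k) free_elem set"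
  assumes A: "lpa_ideal G A" shows "vertex_set A = verts G \<longleftrightarrow> A = free_algebra G"
proof
  assume vs: "vertex_set A = verts G"
  have "x \<in> A" if x: "x \<in> free_algebra G" for x
  proof -
    from local_unit[OF x] obtain V where V: "finite V" "V \<subseteq> verts G" and eq: "(\<Sum>v\<in>V. vx v) * x \<doteq> x"
      by blast
    have "(\<Sum>v\<in>V. vx v) \<in> A" using V vs by (intro lpa_ideal_sum[OF A]) (auto simp: vertex_set_def)
    then have "(\<Sum>v\<in>V. vx v) * x \<in> A" by (rule lpa_idealD(9)[OF A x])
    with eq show ?thesis using lpa_ideal_eqv[OF A] by blast
  qed
  with lpa_idealD(1)[OF A] show "A = free_algebra G" by blast
qed (auto simp: vertex_set_def)

lemma word_degree_path: "word_degree (Word (path_word u p)) = int (length p)"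
  by (simp add: word_degree_def path_word_def o_def sum_list_triv)

text \<open>
  Multiplying by the ghost path of a shortest path \<open>p\<close> in \<open>a\<close> turns \<open>p\<close> into the vertex \<open>w\<close> and each
  other path in \<open>a\<close> into zero or a nonempty closed path at \<open>w\<close>.
\<close>

lemma shortest_path_extract:
  assumes a: "keys a \<subseteq> real_words w" "a \<noteq> 0"
  shows "\<exists>u p k b. awalk u p w \<and> k \<noteq> 0 \<and> keys b \<subseteq> cycle_words w \<and>
    gw u p * a \<doteq> scale k (vx w) + b"
proof -
  have fin: "finite (keys a)" "keys a \<noteq> {}" using a by auto
  obtain k0 where k0: "k0 \<in> keys a"
    and min: "\<And>k. k \<in> keys a \<Longrightarrow> word_degree k0 \<le> word_degree k"
    using arg_min_if_finite[OF fin, of word_degree] by (metis linorder_not_less)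
  then obtain u p where p: "k0 = Word (path_word u p)" "awalk u p w"
    using a by (auto simp: real_words_def)
  define c where "c = lookup a k0"
  define a' where "a' = a - single k0 c"
  have keys: "keys a' = keys a - {k0}"
    unfolding a'_def c_def by (auto simp: in_keys_iff lookup_minus lookup_single when_def split: if_splits)
  have "\<exists>b. keys b \<subseteq> cycle_words w \<and> gw u p * a' \<doteq> b"
  proof (rule keys_linear_eqv[where T = "\<lambda>x. gw u p * x", OF subset_refl])
    fix k assume "k \<in> keys a'"
    then have k: "k \<in> keys a" "k \<noteq> k0" by (auto simp: keys)
    then obtain u' p' where p': "k = Word (path_word u' p')" "awalk u' p' w"
      using a by (auto simp: real_words_def)
    have "length p \<le> length p'" using min[OF k(1)] p p' by (simp add: word_degree_path)
    from gw_pw[OF p(2) p'(2) this] have eq: "gw u p * monomial (letters k) \<doteq>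
      (if u' = u \<and> take (length p) p' = p then pw w (drop (length p) p') else 0)"
      using p' by simp
    show "\<exists>y. keys y \<subseteq> cycle_words w \<and> gw u p * monomial (letters k) \<doteq> y"
    proof (cases "u' = u \<and> take (length p) p' = p")
      case True
      then obtain r where r: "p' = p @ r" by (metis append_take_drop_id)
      have "awalk w r w" using awalk_remainder[OF p(2)] p'(2) True r by blast
      moreover have "r \<noteq> []" using k(2) p p' r True by auto
      ultimately have cyc: "keys (pw w r :: ('v, 'e, 'k) free_elem) \<subseteq> cycle_words w"
        by (auto simp: cycle_words_def)
      from eq True r have "gw u p * monomial (letters k) \<doteq> pw w r" by simp
      with cyc show ?thesis by blast
    next
      case False
      with eq have "gw u p * monomial (letters k) \<doteq> 0" by (simp only: if_False)
      then show ?thesis by (intro exI[of _ 0]) simp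
    qed
  qed (simp_all add: distrib_left scale_mult_right)
  then obtain b where b: "keys b \<subseteq> cycle_words w" "gw u p * a' \<doteq> b" by blast
  have "gw u p * pw u p \<doteq> vx w" using gw_pw[OF p(2) p(2)] by (simp add: pw_Nil)
  then have "scale c (gw u p * pw u p) + gw u p * a' \<doteq> scale c (vx w) + b"
    using b by (intro eqv_add eqv_scale)
  moreover have "a = scale c (pw u p) + a'"
    by (simp add: a'_def single_eq_scale p(1))
  ultimately have "gw u p * a \<doteq> scale c (vx w) + b"
    by (simp add: distrib_left scale_mult_right)
  moreover have "c \<noteq> 0" using k0 by (simp add: c_def in_keys_iff)
  ultimately show ?thesis using p b by blast
qed

lemma finite_cycles_of_keys:
  "finite {p. p \<noteq> [] \<and> Word (path_word w p) \<in> keys (b :: ('v, 'e, 'k) free_elem)}"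
proof (rule finite_imageD)
  show "finite ((\<lambda>p. Word (path_word w p)) ` {p. p \<noteq> [] \<and> Word (path_word w p) \<in> keys b})"
    by (rule finite_subset[of _ "keys b"]) auto
  show "inj_on (\<lambda>p. Word (path_word w p)) {p. p \<noteq> [] \<and> Word (path_word w p) \<in> keys b}"
    by (auto simp: inj_on_def path_word_def dest: map_injective intro: injI)
qed

text \<open>
  Conjugating by a closed path that is no initial segment of its product with a closed path in \<open>b\<close>
  fixes \<open>w\<close> and kills \<open>b\<close>.
\<close>

lemma vx_mem_of_cycles:
  fixes A :: "('v, 'e, 'k) free_elem set"
  assumes K: "condition_K G" and A: "lpa_ideal G A" and w: "w \<in> verts G" and k: "k \<noteq> 0"
    and b: "keys b \<subseteq> cycle_words w" and mem: "scale k (vx w) + b \<in> A"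
  shows "vx w \<in> A"
proof -
  let ?M = "{p. awalk w p w \<and> p \<noteq> [] \<and> Word (path_word w p) \<in> keys b}"
  have "finite ?M" by (rule finite_subset[OF _ finite_cycles_of_keys[of w b]]) auto
  then obtain c where c: "awalk w c w" and cM: "\<And>p. p \<in> ?M \<Longrightarrow> \<not> prefix c (p @ c)"
    using ex_closed_walk_kills[OF K w, of ?M] by blast
  have "gw w c * b * pw w c \<doteq> 0"
  proof (rule keys_linear_zero[where T = "\<lambda>x. gw w c * x * pw w c", OF b])
    fix k assume "k \<in> cycle_words w" "k \<in> keys b"
    then obtain p where p: "k = Word (path_word w p)" "p \<in> ?M" by (auto simp: cycle_words_def)
    then have p': "awalk w p w" by simp
    have w2: "awalk w (p @ c) w" using p' c by (meson awalk_appendI)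
    have "gw w c * pw w p * pw w c = gw w c * (pw w p * pw w c)" by (simp add: mult.assoc)
    also have "\<dots> \<doteq> gw w c * pw w (p @ c)"
      by (rule eqv_mult_left[OF eqv_sym[OF pw_append[OF p' c]] gw_in[OF c]])
    also have "\<dots> \<doteq> (if w = w \<and> take (length c) (p @ c) = c then pw w (drop (length c) (p @ c)) else 0)"
      by (rule gw_pw[OF c w2]) simp
    also have "\<dots> = 0"
    proof -
      have "take (length c) (p @ c) \<noteq> c" using cM[OF p(2)] by (metis take_is_prefix)
      then show ?thesis by simp
    qed
    finally show "gw w c * monomial (letters k) * pw w c \<doteq> 0" using p by simp
  qed (simp_all add: algebra_simps scale_mult_left scale_mult_right)
  moreover have "gw w c * vx w * pw w c \<doteq> vx w"
  proof -
    have "gw w c * vx w * pw w c \<doteq> gw w c * pw w c"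
      using gw_vx[OF c w] c by (intro eqv_mult_right pw_in[OF c]) simp
    also have "\<dots> \<doteq> vx w" using gw_pw[OF c c] by (simp add: pw_Nil)
    finally show ?thesis .
  qed
  ultimately have "scale k (gw w c * vx w * pw w c) + gw w c * b * pw w c \<doteq> scale k (vx w) + 0"
    by (intro eqv_add eqv_scale)
  then have "gw w c * (scale k (vx w) + b) * pw w c \<doteq> scale k (vx w)"
    by (simp add: algebra_simps scale_mult_left scale_mult_right)
  moreover have "gw w c * (scale k (vx w) + b) * pw w c \<in> A"
    using mem by (intro lpa_idealD(8,9)[OF A] pw_in[OF c] gw_in[OF c])
  ultimately show ?thesis using lpa_ideal_eqv[OF A] scale_mem_iff[OF A k] by blast
qed

end

section \<open>Ideals are determined by their pairs\<close>

context leavitt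
begin

lemma real_words_vx:
  assumes "keys a \<subseteq> real_words w" and w: "w \<in> verts G"
  shows "a * vx w \<doteq> a"
proof -
  have "a * vx w - a \<doteq> 0"
  proof (rule keys_linear_zero[where T = "\<lambda>x. x * vx w - x", OF assms(1)])
    fix k assume "k \<in> real_words w"
    then obtain u p where "k = Word (path_word u p)" "awalk u p w" by (auto simp: real_words_def)
    with pw_vx[OF this(2) w] show "monomial (letters k) * vx w - monomial (letters k) \<doteq> 0"
      by (simp add: eqv_zero_iff eqv_def)
  qed (simp_all add: algebra_simps scale_mult_left)
  then show ?thesis using real_words_in[OF assms(1)] w by (simp add: eqv_zero_iff) (simp add: eqv_def)
qed

lemma normal_word_cases:
  assumes "k \<in> normal_words (Suc m) w"
  obtains (real) u p where "awalk u p w" "monomial (letters k) \<doteq> pw u p"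
  | (ghost) u p f q a where "awalk u p a" "f \<in> arcs G" "tail G f = w" "awalk (head G f) q a"
      "length q \<le> m" "monomial (letters k) \<doteq> pw u p * (gw (head G f) q * gh f)"
proof -
  obtain u p q a where k: "k = Word (path_word u p @ ghost_word w q)" "awalk u p a" "awalk w q a"
    "length q \<le> Suc m" using assms by (auto simp: normal_words_def)
  show ?thesis
  proof (cases q)
    case Nil
    then have a: "w = a" "w \<in> verts G" using k(3) by (auto simp: awalk_simps)
    then have "pw u p * vx w \<doteq> pw u p" using pw_vx[OF k(2), of w] by simp
    then show ?thesis using real[of u p] k a Nil by (simp add: monomial_append gw_Nil)
  next
    case (Cons f r)
    then have f: "f \<in> arcs G" "tail G f = w" "awalk (head G f) r a" using k(3) by (auto simp: awalk_simps)
    have "pw u p * gw w q \<doteq> pw u p * (gw (head G f) r * gh f)"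
      using gw_Cons[of w f r a] k(3) Cons by (intro eqv_mult_left pw_in[OF k(2)]) simp
    then show ?thesis using ghost[OF k(2) f] k(1,4) Cons by (simp add: monomial_append)
  qed
qed

lemma normal_words_vx:
  assumes "keys y \<subseteq> normal_words m w" and w: "w \<in> verts G"
  shows "y * vx w \<doteq> y"
proof -
  have "y * vx w - y \<doteq> 0"
  proof (rule keys_linear_zero[where T = "\<lambda>x. x * vx w - x", OF assms(1)])
    fix k assume "k \<in> normal_words m w"
    then obtain u p q a where k: "k = Word (path_word u p @ ghost_word w q)" "awalk u p a" "awalk w q a"
      by (auto simp: normal_words_def)
    have "pw u p * (gw w q * vx w) \<doteq> pw u p * gw w q"
      using gw_vx[OF k(3) w] by (intro eqv_mult_left pw_in[OF k(2)]) simp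
    then show "monomial (letters k) * vx w - monomial (letters k) \<doteq> 0"
      using k by (simp add: eqv_zero_iff monomial_append mult.assoc) (simp add: eqv_def)
  qed (simp_all add: algebra_simps scale_mult_left)
  then show ?thesis using normal_words_in[OF assms(1)] w by (simp add: eqv_zero_iff) (simp add: eqv_def)
qed

lemma normal_words_0:
  assumes "keys y \<subseteq> normal_words 0 w"
  shows "\<exists>a. keys a \<subseteq> real_words w \<and> y \<doteq> a"
proof (rule keys_linear_eqv[where T = "\<lambda>x. x", OF assms])
  fix k assume "k \<in> normal_words 0 w"
  then obtain u p where k: "k = Word (path_word u p @ ghost_word w [])" "awalk u p w"
    by (auto simp: normal_words_def awalk_simps)
  have "w \<in> verts G" using k(2) by auto
  then have "monomial (letters k) \<doteq> pw u p"
    using pw_vx[OF k(2), of w] by (simp add: k(1) monomial_append gw_Nil)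
  moreover have "keys (pw u p :: ('v, 'e, 'k) free_elem) \<subseteq> real_words w"
    using k(2) by (auto simp: real_words_def)
  ultimately show "\<exists>y. keys y \<subseteq> real_words w \<and> monomial (letters k) \<doteq> y" by blast
qed simp_all

text \<open>
  The edge \<open>e\<close> cancels the last ghost edge, which reduces the bound \<open>Suc m\<close> on the length of the ghost
  part; this is what drives the induction in the comparison of ideals.
\<close>

lemma normal_words_ed:
  assumes y: "keys y \<subseteq> normal_words (Suc m) w" and e: "e \<in> out_arcs G w"
  shows "\<exists>z. keys z \<subseteq> normal_words m (head G e) \<and> y * ed e \<doteq> z"
proof (rule keys_linear_eqv[where T = "\<lambda>x. x * ed e", OF y])
  have e': "e \<in> arcs G" "tail G e = w" "head G e \<in> verts G" using e by auto
  have key: "keys (pw u p * gw (head G e) q :: ('v, 'e, 'k) free_elem) \<subseteq> normal_words m (head G e)"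
    if "awalk u p a" "awalk (head G e) q a" "length q \<le> m" for u p q a
    unfolding monomial_append[symmetric] using that by (auto simp: normal_words_def)
  fix k assume "k \<in> normal_words (Suc m) w"
  then show "\<exists>z. keys z \<subseteq> normal_words m (head G e) \<and> monomial (letters k) * ed e \<doteq> z"
  proof (cases rule: normal_word_cases)
    case (real u p)
    have e1: "awalk w [e] (head G e)" using e' by (auto simp: awalk_simps)
    have w2: "awalk u (p @ [e]) (head G e)" using real(1) e1 by (rule awalk_appendI)
    have "monomial (letters k) * ed e \<doteq> pw u p * pw w [e]"
      using real(2) e' by (intro eqv_mult) (auto simp: path_word_def eqv_refl)
    also have "\<dots> \<doteq> pw u (p @ [e])" by (rule eqv_sym[OF pw_append[OF real(1) e1]])
    also have "\<dots> \<doteq> pw u (p @ [e]) * gw (head G e) []"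
      using eqv_sym[OF pw_vx[OF w2, of "head G e"]] e' by (simp add: gw_Nil)
    finally show ?thesis using key[OF w2, of "[]"] e' by (auto simp: awalk_simps)
  next
    case (ghost u p f q a)
    have "monomial (letters k) * ed e \<doteq> (pw u p * (gw (head G f) q * gh f)) * ed e"
      using ghost e' by (intro eqv_mult_right) auto
    also have "\<dots> = pw u p * (gw (head G f) q * (gh f * ed e))" by (simp add: mult.assoc)
    also have "\<dots> \<doteq> pw u p * (gw (head G f) q * (if f = e then vx (head G f) else 0))"
      using gh_ed[OF ghost(2) e'(1)]
      by (intro eqv_mult_left pw_in[OF ghost(1)] gw_in[OF ghost(4)])
    finally have *: "monomial (letters k) * ed e \<doteq>
      pw u p * (gw (head G f) q * (if f = e then vx (head G f) else 0))" .
    show ?thesis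
    proof (cases "f = e")
      case True
      have "pw u p * (gw (head G e) q * vx (head G e)) \<doteq> pw u p * gw (head G e) q"
        using gw_vx[OF ghost(4), of "head G e"] True e'
        by (intro eqv_mult_left pw_in[OF ghost(1)]) simp
      with * True have "monomial (letters k) * ed e \<doteq> pw u p * gw (head G e) q"
        using eqv_trans by simp
      then show ?thesis using key ghost True by blast
    next
      case False
      with * show ?thesis by (intro exI[of _ 0]) simp
    qed
  qed
qed (simp_all add: algebra_simps scale_mult_left)

text \<open>
  A term that ends in the ghost edge \<open>f\<^sup>*\<close> vanishes when it is multiplied by a gap with \<open>f \<in> X\<close>. So
  only the terms without ghost edges survive once \<open>X\<close> contains the finitely many last ghost edges.
\<close>

lemma normal_words_gap:
  assumes y: "keys y \<subseteq> normal_words (Suc m) w" and w: "w \<in> verts G"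
  shows "\<exists>a Fe. keys a \<subseteq> real_words w \<and> finite Fe \<and> Fe \<subseteq> out_arcs G w \<and>
    (\<forall>X. finite X \<longrightarrow> Fe \<subseteq> X \<longrightarrow> X \<subseteq> out_arcs G w \<longrightarrow> y * gap w X \<doteq> a * gap w X)"
  using y
proof (induction y rule: poly_mapping_keys_induct)
  case zero
  show ?case by (intro exI[of _ 0] exI[of _ "{}"]) (simp add: eqv_refl)
next
  case (add k c y)
  then obtain a Fe where a: "keys a \<subseteq> real_words w" and Fe: "finite Fe" "Fe \<subseteq> out_arcs G w"
    and eq: "\<And>X. finite X \<Longrightarrow> Fe \<subseteq> X \<Longrightarrow> X \<subseteq> out_arcs G w \<Longrightarrow> y * gap w X \<doteq> a * gap w X"
    by blast
  have comb: "(single k c + y) * gap w X \<doteq> (scale c z + a) * gap w X"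
    if "monomial (letters k) * gap w X \<doteq> z * gap w X" "y * gap w X \<doteq> a * gap w X" for z X
    unfolding single_eq_scale distrib_right scale_mult_left using that by (intro eqv_add eqv_scale)
  from add.hyps(1) show ?case
  proof (cases rule: normal_word_cases)
    case (real u p)
    have "keys (pw u p :: ('v, 'e, 'k) free_elem) \<subseteq> real_words w"
      using real(1) by (auto simp: real_words_def)
    then have "keys (scale c (pw u p) + a) \<subseteq> real_words w"
      using keys_add[of "scale c (pw u p)" a] keys_scale[of c "pw u p"] a by blast
    moreover have "(single k c + y) * gap w X \<doteq> (scale c (pw u p) + a) * gap w X"
      if "finite X" "Fe \<subseteq> X" "X \<subseteq> out_arcs G w" for X
      using that w by (intro comb eq eqv_mult_right[OF real(2)]) auto
    ultimately show ?thesis using Fe by blast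
  next
    case (ghost u p f q b)
    have f: "f \<in> out_arcs G w" using ghost by auto
    have "(single k c + y) * gap w X \<doteq> (scale c 0 + a) * gap w X"
      if X: "finite X" "insert f Fe \<subseteq> X" "X \<subseteq> out_arcs G w" for X
    proof (rule comb)
      show "y * gap w X \<doteq> a * gap w X" using X by (intro eq) auto
      have "monomial (letters k) * gap w X \<doteq> (pw u p * (gw (head G f) q * gh f)) * gap w X"
        using X w by (intro eqv_mult_right[OF ghost(6)]) auto
      also have "\<dots> = pw u p * (gw (head G f) q * (gh f * gap w X))" by (simp add: mult.assoc)
      also have "\<dots> \<doteq> pw u p * (gw (head G f) q * 0)"
        using gh_gap[OF X(1,3) f] X
        by (intro eqv_mult_left pw_in[OF ghost(1)] gw_in[OF ghost(4)]) auto
      finally show "monomial (letters k) * gap w X \<doteq> 0 * gap w X" by simp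
    qed
    then show ?thesis using a Fe f by (intro exI[of _ a] exI[of _ "insert f Fe"]) auto
  qed
qed

lemma cycle_words_annihilated:
  assumes b: "keys b \<subseteq> cycle_words w" and z: "z \<in> free_algebra G"
    and kill: "\<And>f q. f \<in> arcs G \<Longrightarrow> tail G f = w \<Longrightarrow> awalk (head G f) q w \<Longrightarrow>
      Word (path_word w (f # q)) \<in> keys b \<Longrightarrow> z * ed f \<doteq> 0"
  shows "z * b \<doteq> 0"
proof (rule keys_linear_zero[where T = "\<lambda>x. z * x", OF b])
  fix k assume "k \<in> cycle_words w" and mem: "k \<in> keys b"
  then obtain p where p: "k = Word (path_word w p)" "awalk w p w" "p \<noteq> []"
    by (auto simp: cycle_words_def)
  then obtain f q where fq: "p = f # q" by (cases p) auto
  with p have f: "f \<in> arcs G" "tail G f = w" "awalk (head G f) q w" by (auto simp: awalk_simps)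
  have "z * pw w p \<doteq> z * (ed f * pw (head G f) q)"
    using pw_Cons[of w f q w] p fq by (intro eqv_mult_left z) simp
  also have "\<dots> = (z * ed f) * pw (head G f) q" by (simp add: mult.assoc)
  also have "\<dots> \<doteq> 0 * pw (head G f) q"
    using kill[OF f] mem p fq by (intro eqv_mult_right pw_in[OF f(3)]) simp
  finally show "z * monomial (letters k) \<doteq> 0" using p by simp
qed (simp_all add: distrib_left scale_mult_right)

text \<open>
  Induction on the length of the ghost parts of \<open>y\<close>. Let \<open>(H, S)\<close> be the pair of \<open>I\<close>.

  If there are none, \<open>shortest_path_extract\<close> and condition (K) put \<open>w\<close> into \<open>I\<close>, hence into
  \<open>J\<close>, unless \<open>y\<close> is zero.

  Otherwise all \<open>y * e\<close> are in \<open>J\<close> by induction, so that \<open>y\<close> may be replaced by \<open>y * gap w X\<close> for any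
  finite set \<open>X\<close> of edges from \<open>w\<close>, and for large \<open>X\<close> by \<open>a * gap w X\<close> with real paths in \<open>a\<close>. This is
  in \<open>J\<close> if \<open>w\<close> is in \<open>H\<close>, is regular or is in \<open>S\<close>. In the remaining case, if \<open>a \<noteq> 0\<close>, the ideal \<open>I\<close> contains
  \<open>(k w + b) * gap w X\<close> with \<open>k \<noteq> 0\<close> and closed paths in \<open>b\<close>. If only finitely many edges from \<open>w\<close>
  avoid \<open>H\<close>, put them into \<open>X\<close>: then \<open>gap w X\<close> kills the closed paths from the left, so it is in \<open>I\<close>
  itself, and \<open>w\<close> would be in \<open>H\<close> or in \<open>S\<close>. If there are infinitely many, one of them is neither in \<open>X\<close>
  nor the first edge of a closed path in \<open>b\<close>; conjugating by it shows that its range is in \<open>I\<close>.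
\<close>

lemma ideal_le_aux:
  fixes I J :: "('v, 'e, 'k) free_elem set"
  assumes K: "condition_K G" and I: "lpa_ideal G I" and J: "lpa_ideal G J" and JI: "J \<subseteq> I"
    and H: "vertex_set I \<subseteq> vertex_set J" and S: "\<And>v. v \<in> breaking_set I \<Longrightarrow> breaking_element (vertex_set I) v \<in> J"
    and y: "keys y \<subseteq> normal_words m w" "y \<in> I" and w: "w \<in> verts G"
  shows "y \<in> J"
  using y w
proof (induction m arbitrary: y w)
  case 0
  obtain a where a: "keys a \<subseteq> real_words w" "y \<doteq> a"
    using normal_words_0[OF 0(1)] by blast
  then have aI: "a \<in> I" using 0(2) lpa_ideal_eqv[OF I] by blast
  have "a \<in> J"
  proof (cases "a = 0")
    case False
    from shortest_path_extract[OF a(1) this] obtain u p k b where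
      ex: "awalk u p w" "k \<noteq> 0" "keys b \<subseteq> cycle_words w" "gw u p * a \<doteq> scale k (vx w) + b"
      by blast
    have "gw u p * a \<in> I" using aI by (intro lpa_idealD(8)[OF I] gw_in[OF ex(1)])
    then have "scale k (vx w) + b \<in> I" using lpa_ideal_eqv[OF I ex(4)] by simp
    with vx_mem_of_cycles[OF K I 0(3) ex(2,3)] have "vx w \<in> J" using H 0(3) by (auto simp: vertex_set_def)
    then have "a * vx w \<in> J" using lpa_idealD(8)[OF J lpa_idealD(1)[OF I aI]] by blast
    then show ?thesis using lpa_ideal_eqv[OF J real_words_vx[OF a(1) 0(3)]] by simp
  qed (use lpa_idealD(3)[OF J] in simp)
  then show ?case using lpa_ideal_eqv[OF J a(2)] by simp
next
  case (Suc m)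
  note w = Suc.prems(3)
  have yF: "y \<in> free_algebra G" using lpa_idealD(1)[OF I Suc.prems(2)] .
  have yJ_iff: "y \<in> J \<longleftrightarrow> y * gap w X \<in> J" if X: "finite X" "X \<subseteq> out_arcs G w" for X
  proof -
    have "y * ed e \<in> J" if e: "e \<in> out_arcs G w" for e
    proof -
      obtain z where z: "keys z \<subseteq> normal_words m (head G e)" "y * ed e \<doteq> z"
        using normal_words_ed[OF Suc.prems(1) e] by blast
      have "y * ed e \<in> I" using e Suc.prems(2) by (intro lpa_idealD(9)[OF I]) auto
      then have "z \<in> I" using lpa_ideal_eqv[OF I z(2)] by simp
      moreover have "head G e \<in> verts G" using e by auto
      ultimately have "z \<in> J" using Suc.IH[OF z(1)] by simp
      then show ?thesis using lpa_ideal_eqv[OF J z(2)] by simp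
    qed
    then have "y * ed e * gh e \<in> J" if "e \<in> out_arcs G w" for e
      using that by (intro lpa_idealD(9)[OF J, of "gh e" "y * ed e"]) auto
    then have "(\<Sum>e\<in>X. y * ed e * gh e) \<in> J"
      using X by (intro lpa_ideal_sum[OF J]) blast
    moreover have "y * vx w - y * gap w X = (\<Sum>e\<in>X. y * ed e * gh e)"
      by (simp add: gap_def right_diff_distrib sum_distrib_left mult.assoc)
    ultimately have "y * vx w \<in> J \<longleftrightarrow> y * gap w X \<in> J" using diff_mem_iff[OF J] by simp
    then show ?thesis using lpa_ideal_eqv[OF J normal_words_vx[OF Suc.prems(1) w]] by simp
  qed
  obtain a Fe where a: "keys a \<subseteq> real_words w" and Fe: "finite Fe" "Fe \<subseteq> out_arcs G w"
    and eq: "\<And>X. finite X \<Longrightarrow> Fe \<subseteq> X \<Longrightarrow> X \<subseteq> out_arcs G w \<Longrightarrow> y * gap w X \<doteq> a * gap w X"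
    using normal_words_gap[OF Suc.prems(1) w] by blast
  define H where "H = vertex_set I"
  have hered: "hereditary G H" using pair_admissible[OF I] by (auto simp: admissible_pairs_def H_def)
  let ?Z = "{e \<in> out_arcs G w. head G e \<notin> H}"
  consider "a = 0" | "w \<in> H" | "regular_vertex G w" | "w \<in> breaking_set I"
    | (bad) "a \<noteq> 0" "w \<notin> H" "\<not> regular_vertex G w" "w \<notin> breaking_set I" by blast
  then show ?case
  proof cases
    case 1
    have "y * gap w Fe \<doteq> 0" using eq[OF Fe(1) _ Fe(2)] 1 by simp
    then have "y * gap w Fe \<in> J" using lpa_ideal_eqv[OF J] lpa_idealD(3)[OF J] by blast
    then show ?thesis using yJ_iff[OF Fe] by simp
  next
    case 2
    then have "y * vx w \<in> J" using H H_def by (intro lpa_idealD(8)[OF J yF]) (auto simp: vertex_set_def)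
    then show ?thesis using lpa_ideal_eqv[OF J normal_words_vx[OF Suc.prems(1) w]] by simp
  next
    case 3
    then have "y * gap w (out_arcs G w) \<in> J"
      by (intro lpa_idealD(8)[OF J yF] lpa_idealD(2)[OF J] gap_out_arcs)
    then show ?thesis using yJ_iff[of "out_arcs G w"] 3 by (simp add: regular_vertex_def)
  next
    case 4
    then have fin: "finite ?Z" by (auto simp: breaking_set_def breaking_vertices_iff H_def)
    have "y * gap w ?Z \<in> J"
      using S[OF 4] by (intro lpa_idealD(8)[OF J yF]) (simp add: breaking_element_def H_def)
    moreover have "?Z \<subseteq> out_arcs G w" by auto
    ultimately show ?thesis using yJ_iff[OF fin] by blast
  next
    case bad
    from shortest_path_extract[OF a bad(1)] obtain u p k b where
      ex: "awalk u p w" "k \<noteq> 0" "keys b \<subseteq> cycle_words w" "gw u p * a \<doteq> scale k (vx w) + b"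
      by blast
    have memI: "(scale k (vx w) + b) * gap w X \<in> I"
      if X: "finite X" "Fe \<subseteq> X" "X \<subseteq> out_arcs G w" for X
    proof -
      have gF: "gap w X \<in> free_algebra G" using X w by simp
      have "gw u p * (y * gap w X) \<in> I"
        by (intro lpa_idealD(8)[OF I gw_in[OF ex(1)]] lpa_idealD(9)[OF I gF] Suc.prems(2))
      moreover have "gw u p * (y * gap w X) \<doteq> gw u p * (a * gap w X)"
        by (rule eqv_mult_left[OF eq[OF X] gw_in[OF ex(1)]])
      moreover have "gw u p * (a * gap w X) \<doteq> (scale k (vx w) + b) * gap w X"
        unfolding mult.assoc[symmetric] by (rule eqv_mult_right[OF ex(4) gF])
      ultimately show ?thesis using lpa_ideal_eqv[OF I] by blast
    qed
    have False
    proof (cases "finite ?Z")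
      case True
      define X where "X = Fe \<union> ?Z"
      have X: "finite X" "Fe \<subseteq> X" "X \<subseteq> out_arcs G w" using Fe True by (auto simp: X_def)
      have gF: "gap w X \<in> free_algebra G" using X w by simp
      have "gap w X * b \<doteq> 0"
      proof (rule cycle_words_annihilated[OF ex(3) gF])
        fix f q assume f: "f \<in> arcs G" "tail G f = w" "awalk (head G f) q w"
        have "head G f \<notin> H"
        proof
          assume "head G f \<in> H"
          then have "w \<in> H" using hered f(3) unfolding hereditary_def connects_def by blast
          with bad(2) show False ..
        qed
        then have "f \<in> X" using f by (auto simp: X_def)
        with gap_ed[OF X(1,3), of f] f show "gap w X * ed f \<doteq> 0" by auto
      qed
      then have "(gap w X * b) * gap w X \<doteq> 0 * gap w X" by (rule eqv_mult_right[OF _ gF])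
      moreover have "gap w X * vx w * gap w X \<doteq> gap w X"
        using eqv_trans[OF eqv_mult_right[OF gap_vx[OF X(1,3) w] gF] gap_gap[OF X(1,3) w]] .
      ultimately have "scale k (gap w X * vx w * gap w X) + (gap w X * b) * gap w X \<doteq>
          scale k (gap w X) + 0 * gap w X" by (intro eqv_add eqv_scale)
      then have "gap w X * ((scale k (vx w) + b) * gap w X) \<doteq> scale k (gap w X)"
        by (simp add: algebra_simps scale_mult_left scale_mult_right)
      moreover have "gap w X * ((scale k (vx w) + b) * gap w X) \<in> I"
        by (intro lpa_idealD(8)[OF I gF] memI X)
      ultimately have "gap w X \<in> I" using lpa_ideal_eqv[OF I] scale_mem_iff[OF I ex(2)] by blast
      moreover have "gap w ?Z \<in> I \<longleftrightarrow> gap w X \<in> I"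
        using X by (intro gap_mem_iff[OF I]) (auto simp: X_def H_def)
      ultimately have gapI: "gap w ?Z \<in> I" by simp
      have "?Z \<noteq> {}"
      proof
        assume "?Z = {}"
        with gapI have "vx w \<in> I" by (simp only: gap_empty)
        with bad(2) w show False by (simp add: H_def vertex_set_def)
      qed
      moreover have "infinite (out_arcs G w)"
        using bad(3) w \<open>?Z \<noteq> {}\<close> unfolding regular_vertex_def by blast
      ultimately have "w \<in> breaking_vertices G H" using bad(2) w True unfolding breaking_vertices_iff by blast
      with gapI bad(4) show False by (simp add: breaking_set_def breaking_element_def H_def)
    next
      case False
      \<comment> \<open>The first edges of the closed paths in \<open>b\<close>.\<close>
      define D where "D = hd ` {p. p \<noteq> [] \<and> Word (path_word w p) \<in> keys b}"
      have "finite (Fe \<union> D)" using Fe finite_cycles_of_keys[of w b] by (simp add: D_def)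
      with False have "infinite (?Z - (Fe \<union> D))" by (rule Diff_infinite_finite[rotated])
      then obtain e where "e \<in> ?Z - (Fe \<union> D)" using infinite_imp_nonempty by blast
      then have e: "e \<in> out_arcs G w" "e \<in> arcs G" "tail G e = w" "head G e \<notin> H" "e \<notin> Fe" "e \<notin> D" by auto
      have edF: "ed e \<in> free_algebra G" and ghF: "gh e \<in> free_algebra G"
        and gF: "gap w Fe \<in> free_algebra G" using e Fe w by auto
      have "gh e * b \<doteq> 0"
      proof (rule cycle_words_annihilated[OF ex(3) ghF])
        fix f q assume f: "f \<in> arcs G" "Word (path_word w (f # q)) \<in> keys b"
        then have "f \<in> D" unfolding D_def by force
        with e have "e \<noteq> f" by blast
        with gh_ed[OF e(2) f(1)] show "gh e * ed f \<doteq> 0" by simp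
      qed
      then have 1: "(gh e * b) * ed e \<doteq> 0 * ed e" by (rule eqv_mult_right[OF _ edF])
      have "gh e * vx w * ed e \<doteq> gh e * ed e"
        using gh_tail[OF e(2)] e by (intro eqv_mult_right edF) simp
      also have "\<dots> \<doteq> vx (head G e)" using gh_ed[OF e(2,2)] by simp
      finally have "scale k (gh e * vx w * ed e) + (gh e * b) * ed e \<doteq> scale k (vx (head G e)) + 0 * ed e"
        using 1 by (intro eqv_add eqv_scale)
      then have "gh e * (scale k (vx w) + b) * ed e \<doteq> scale k (vx (head G e))"
        by (simp add: algebra_simps scale_mult_left scale_mult_right)
      moreover have "gh e * (((scale k (vx w) + b) * gap w Fe) * ed e) \<doteq> gh e * (scale k (vx w) + b) * ed e"
      proof -
        have "(scale k (vx w) + b) * (gap w Fe * ed e) \<doteq> (scale k (vx w) + b) * ed e"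
          using gap_ed[OF Fe e(1)] e(5) eqvD(2)[OF ex(4)] by (intro eqv_mult_left) auto
        from eqv_mult_left[OF this ghF] show ?thesis by (simp add: mult.assoc)
      qed
      moreover have "gh e * (((scale k (vx w) + b) * gap w Fe) * ed e) \<in> I"
        by (intro lpa_idealD(8)[OF I ghF] lpa_idealD(9)[OF I edF] memI Fe order_refl)
      ultimately have "scale k (vx (head G e)) \<in> I" using lpa_ideal_eqv[OF I] by blast
      then have "vx (head G e) \<in> I" using scale_mem_iff[OF I ex(2)] by blast
      with e(2,4) show False by (simp add: H_def vertex_set_def)
    qed
    then show ?thesis ..
  qed
qed

text \<open>
  The ideal \<open>I \<inter> J\<close> takes the place of the smaller ideal in \<open>ideal_le_aux\<close>, and a local unit splits
  each element of \<open>I\<close> into parts that end at a single vertex.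
\<close>

lemma ideal_le_of_pair:
  fixes I J :: "('v, 'e, 'k) free_elem set"
  assumes K: "condition_K G" and I: "lpa_ideal G I" and J: "lpa_ideal G J"
    and H: "vertex_set I \<subseteq> vertex_set J" and S: "\<And>v. v \<in> breaking_set I \<Longrightarrow> breaking_element (vertex_set I) v \<in> J"
  shows "I \<subseteq> J"
proof
  fix x assume x: "x \<in> I"
  have IJ: "lpa_ideal G (I \<inter> J)" using lpa_ideal_Inter[of "{I, J}"] I J by fastforce
  from local_unit[OF lpa_idealD(1)[OF I x]] obtain V where V: "finite V" "V \<subseteq> verts G"
    and eq: "x * (\<Sum>v\<in>V. vx v) \<doteq> x" by blast
  have "x * vx v \<in> I \<inter> J" if v: "v \<in> verts G" for v
  proof -
    obtain m y where y: "keys y \<subseteq> normal_words m v" "x * vx v \<doteq> y"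
      using normal_form[OF lpa_idealD(1)[OF I x] v] by blast
    have "x * vx v \<in> I" using v x by (intro lpa_idealD(9)[OF I]) auto
    then have yI: "y \<in> I" using lpa_ideal_eqv[OF I y(2)] by simp
    have "y \<in> I \<inter> J"
    proof (rule ideal_le_aux[OF K I IJ _ _ _ y(1) yI v])
      show "vertex_set I \<subseteq> vertex_set (I \<inter> J)" using H by (auto simp: vertex_set_def)
      fix v assume "v \<in> breaking_set I"
      then show "breaking_element (vertex_set I) v \<in> I \<inter> J" using S by (auto simp: breaking_set_def)
    qed simp
    then show ?thesis using lpa_ideal_eqv[OF IJ y(2)] by simp
  qed
  then have "(\<Sum>v\<in>V. x * vx v) \<in> I \<inter> J" using V by (intro lpa_ideal_sum[OF IJ]) auto
  then have "x * (\<Sum>v\<in>V. vx v) \<in> I \<inter> J" by (simp add: sum_distrib_left)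
  then show "x \<in> J" using lpa_ideal_eqv[OF IJ eq] by simp
qed

end

section \<open>Branching systems and their annihilators\<close>

text \<open>
  Sets over the vertices, with injections \<open>ext e\<close> from the set over the range of \<open>e\<close> to the set over its
  source, disjoint for different edges, and jointly onto over a regular vertex. Paths with
  concatenation are the model example. Composition with these partial bijections makes the functions on
  \<open>X\<close> a module over the Leavitt path algebra; as all functions are admitted, no finiteness of supports
  has to be maintained.
\<close>

locale branching_system = leavitt G K
  for G :: "('v, 'e) pre_digraph" and K :: "'k::field itself" +
  fixes X :: "'x set" and src :: "'x \<Rightarrow> 'v" and ext :: "'e \<Rightarrow> 'x \<Rightarrow> 'x"
  assumes ext_mem: "e \<in> arcs G \<Longrightarrow> t \<in> X \<Longrightarrow> src t = head G e \<Longrightarrow> ext e t \<in> X"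
    and src_ext: "e \<in> arcs G \<Longrightarrow> t \<in> X \<Longrightarrow> src t = head G e \<Longrightarrow> src (ext e t) = tail G e"
    and ext_inject: "e \<in> arcs G \<Longrightarrow> f \<in> arcs G \<Longrightarrow> s \<in> X \<Longrightarrow> t \<in> X \<Longrightarrow> src s = head G e \<Longrightarrow>
      src t = head G f \<Longrightarrow> ext e s = ext f t \<Longrightarrow> e = f \<and> s = t"
    and regular_ext: "t \<in> X \<Longrightarrow> regular_vertex G (src t) \<Longrightarrow>
      \<exists>e\<in>arcs G. \<exists>s\<in>X. src s = head G e \<and> t = ext e s"
begin

definition range_of :: "'e \<Rightarrow> 'x set" where
  "range_of e = ext e ` {s \<in> X. src s = head G e}"

text \<open>
  An edge moves a point by removing that edge, a ghost edge by putting it in front. The order of the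
  letters is that of the induced action on functions, which is contravariant in the points.
\<close>

primrec move :: "('v, 'e) generator \<Rightarrow> 'x \<Rightarrow> 'x option" where
  "move (Vertex v) t = (if t \<in> X \<and> src t = v then Some t else None)"
| "move (Edge e) t = (if t \<in> range_of e then Some (THE s. s \<in> X \<and> src s = head G e \<and> t = ext e s) else None)"
| "move (Ghost e) t = (if t \<in> X \<and> src t = head G e then Some (ext e t) else None)"

primrec moves :: "('v, 'e) generator list \<Rightarrow> 'x \<Rightarrow> 'x option" where
  "moves [] t = Some t"
| "moves (g # w) t = Option.bind (move g t) (moves w)"

lemma moves_append: "moves (v @ w) t = Option.bind (moves v t) (moves w)"
  by (induction v arbitrary: t) (auto split: bind_split)

definition value_at :: "('x \<Rightarrow> 'k) \<Rightarrow> 'x option \<Rightarrow> 'k" where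
  "value_at \<phi> r = (case r of None \<Rightarrow> 0 | Some s \<Rightarrow> \<phi> s)"

lemma value_at_simps [simp]: "value_at \<phi> None = 0" "value_at \<phi> (Some s) = \<phi> s"
  by (simp_all add: value_at_def)

definition act :: "('v, 'e, 'k) free_elem \<Rightarrow> ('x \<Rightarrow> 'k) \<Rightarrow> 'x \<Rightarrow> 'k" where
  "act x \<phi> t = (\<Sum>k\<in>keys x. lookup x k * value_at \<phi> (moves (letters k) t))"

lemma act_superset:
  assumes "finite A" "keys x \<subseteq> A"
  shows "act x \<phi> t = (\<Sum>k\<in>A. lookup x k * value_at \<phi> (moves (letters k) t))"
  unfolding act_def using assms by (intro sum.mono_neutral_left) (auto simp: in_keys_iff)

lemma act_zero [simp]: "act 0 \<phi> t = 0"
  by (simp add: act_def)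

lemma act_add [simp]: "act (x + y) \<phi> t = act x \<phi> t + act y \<phi> t"
proof -
  let ?A = "keys x \<union> keys y"
  have "keys (x + y) \<subseteq> ?A" by (rule keys_add)
  then show ?thesis
    by (simp add: act_superset[of ?A] lookup_add distrib_right sum.distrib)
qed

lemma act_scale [simp]: "act (scale c x) \<phi> t = c * act x \<phi> t"
  unfolding act_superset[OF finite_keys keys_scale] by (simp add: act_def lookup_scale sum_distrib_left mult.assoc)

lemma act_uminus [simp]: "act (- x) \<phi> t = - act x \<phi> t"
  using act_scale[of "-1" x] by simp

lemma act_diff [simp]: "act (x - y) \<phi> t = act x \<phi> t - act y \<phi> t"
  using act_add[of x "- y"] by simp

lemma act_sum: "act (sum f A) \<phi> t = (\<Sum>a\<in>A. act (f a) \<phi> t)"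
  by (induction A rule: infinite_finite_induct) auto

lemma act_monomial: "act (monomial w) \<phi> t = value_at \<phi> (moves w t)"
  by (simp add: act_def) (simp add: monomial_def)

lemma act_monomial_mult: "act (monomial w * y) \<phi> t = value_at (act y \<phi>) (moves w t)"
  using subset_UNIV[of "keys y"]
proof (induction y rule: poly_mapping_keys_induct)
  case zero
  show ?case by (cases "moves w t") auto
next
  case (add k c y)
  then show ?case
    by (cases "moves w t")
      (simp_all add: distrib_left single_eq_scale scale_mult_right monomial_append[symmetric]
        act_monomial moves_append)
qed

lemma act_mult: "act (x * y) \<phi> t = act x (act y \<phi>) t"
  using subset_UNIV[of "keys x"]
  by (induction x rule: poly_mapping_keys_induct)
    (simp_all add: distrib_right single_eq_scale scale_mult_left act_monomial_mult act_monomial)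

lemma act_vx: "act (vx v) \<phi> t = (if t \<in> X \<and> src t = v then \<phi> t else 0)"
  by (simp add: act_monomial)

lemma act_gh: "act (gh e) \<phi> t = (if t \<in> X \<and> src t = head G e then \<phi> (ext e t) else 0)"
  by (simp add: act_monomial)

lemma act_ed:
  assumes "e \<in> arcs G" "s \<in> X" "src s = head G e"
  shows "act (ed e) \<phi> (ext e s) = \<phi> s"
proof -
  have "(THE s'. s' \<in> X \<and> src s' = head G e \<and> ext e s = ext e s') = s"
    using assms ext_inject by (intro the_equality) blast+
  moreover have "ext e s \<in> range_of e" using assms by (auto simp: range_of_def)
  ultimately show ?thesis by (simp add: act_monomial)
qed

lemma act_ed_0: "t \<notin> range_of e \<Longrightarrow> act (ed e) \<phi> t = 0"
  by (simp add: act_monomial)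

lemma range_ofD: "e \<in> arcs G \<Longrightarrow> t \<in> range_of e \<Longrightarrow> t \<in> X \<and> src t = tail G e"
  using ext_mem src_ext by (auto simp: range_of_def)

lemma range_of_unique: "e \<in> arcs G \<Longrightarrow> f \<in> arcs G \<Longrightarrow> t \<in> range_of e \<Longrightarrow> t \<in> range_of f \<Longrightarrow> e = f"
  using ext_inject unfolding range_of_def by blast

lemma act_ed_gh:
  assumes e: "e \<in> arcs G" shows "act (ed e * gh e) \<phi> t = (if t \<in> range_of e then \<phi> t else 0)"
proof (cases "t \<in> range_of e")
  case True
  then obtain s where "s \<in> X" "src s = head G e" "t = ext e s" by (auto simp: range_of_def)
  with True show ?thesis using act_ed[OF e] by (simp add: act_mult act_gh)
qed (simp add: act_mult act_ed_0)

text \<open>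
  The ranges of different edges are disjoint, so at most one of the subtracted terms is nonzero.
\<close>

lemma act_gap:
  assumes Z: "finite Z" "Z \<subseteq> out_arcs G v"
  shows "act (vx v - (\<Sum>e\<in>Z. ed e * gh e)) \<phi> t =
    (if t \<in> X \<and> src t = v \<and> (\<forall>e\<in>Z. t \<notin> range_of e) then \<phi> t else 0)"
proof -
  have arcs: "e \<in> arcs G" "tail G e = v" if "e \<in> Z" for e using Z that by auto
  have "(\<Sum>e\<in>Z. act (ed e * gh e) \<phi> t) = (\<Sum>e\<in>Z. if t \<in> range_of e then \<phi> t else 0)"
    using arcs by (intro sum.cong) (auto simp: act_ed_gh)
  also have "\<dots> = (if \<exists>e\<in>Z. t \<in> range_of e then \<phi> t else 0)"
  proof (cases "\<exists>e\<in>Z. t \<in> range_of e")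
    case True
    then obtain e0 where e0: "e0 \<in> Z" "t \<in> range_of e0" by blast
    then have "(\<Sum>e\<in>Z. if t \<in> range_of e then \<phi> t else 0) = (\<Sum>e\<in>Z. if e = e0 then \<phi> t else 0)"
      using arcs range_of_unique by (intro sum.cong) auto
    with e0 Z True show ?thesis by simp
  qed simp
  finally have "act (vx v - (\<Sum>e\<in>Z. ed e * gh e)) \<phi> t =
      (if t \<in> X \<and> src t = v then \<phi> t else 0) - (if \<exists>e\<in>Z. t \<in> range_of e then \<phi> t else 0)"
    by (simp add: act_sum act_vx)
  moreover have "t \<in> X \<and> src t = v" if "\<exists>e\<in>Z. t \<in> range_of e"
    using that arcs range_ofD by metis
  ultimately show ?thesis by auto
qed

definition annihilator :: "('v, 'e, 'k) free_elem set" where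
  "annihilator = {x \<in> free_algebra G. \<forall>\<phi> t. act x \<phi> t = 0}"

lemma act_relation:
  assumes "x \<in> leavitt_relations G" shows "act x \<phi> t = 0"
  using assms
proof cases
  case (vertex v w)
  then show ?thesis by (simp add: act_mult act_vx)
next
  case (edge_source e)
  then show ?thesis using range_ofD[of e t] act_ed_0[of t e] by (auto simp: act_mult act_vx)
next
  case (edge_range e)
  show ?thesis
  proof (cases "t \<in> range_of e")
    case True
    then obtain s where "s \<in> X" "src s = head G e" "t = ext e s" by (auto simp: range_of_def)
    with edge_range show ?thesis by (simp add: act_mult act_ed act_vx)
  qed (use edge_range in \<open>simp add: act_mult act_ed_0\<close>)
next
  case (ghost_range e)
  then show ?thesis by (simp add: act_mult act_vx act_gh)
next
  case (ghost_source e)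
  then show ?thesis using ext_mem src_ext by (simp add: act_mult act_vx act_gh)
next
  case (CK1 e f)
  show ?thesis
  proof (cases "t \<in> X \<and> src t = head G e")
    case True
    have "ext e t \<in> range_of e" using True by (auto simp: range_of_def)
    then have "ext e t \<notin> range_of f" if "e \<noteq> f" using that CK1 range_of_unique by blast
    with True CK1 show ?thesis by (cases "e = f") (simp_all add: act_mult act_gh act_ed act_ed_0 act_vx)
  qed (use CK1 in \<open>auto simp: act_mult act_gh act_vx\<close>)
next
  case (CK2 v)
  then have fin: "finite (out_arcs G v)" by (simp add: regular_vertex_def)
  have "\<exists>e\<in>out_arcs G v. t \<in> range_of e" if t: "t \<in> X" "src t = v"
  proof -
    from regular_ext[OF t(1)] t CK2 obtain e s where e: "e \<in> arcs G" "s \<in> X" "src s = head G e" "t = ext e s"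
      by blast
    then have "t \<in> range_of e" by (auto simp: range_of_def)
    with range_ofD[OF e(1) this] t e(1) show ?thesis by auto
  qed
  then show ?thesis unfolding CK2(1) act_gap[OF fin order_refl] by auto
qed

lemma lpa_ideal_annihilator: "lpa_ideal G annihilator"
proof -
  have act_0: "act a (\<lambda>_. 0) t = 0" for a t
    by (simp add: act_def value_at_def option.case_eq_if)
  have kernel: "act x \<phi> t = 0" if "x \<in> leavitt_kernel G" for x \<phi> t
    using that
  proof (induction arbitrary: \<phi> t)
    case (mult_left a x)
    then have "act x \<phi> = (\<lambda>_. 0)" by auto
    then show ?case by (simp add: act_mult act_0)
  qed (simp_all add: act_relation act_mult)
  have ann: "act x \<phi> = (\<lambda>_. 0)" if "x \<in> annihilator" for x \<phi>
    using that by (auto simp: annihilator_def)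
  show ?thesis
    unfolding lpa_ideal_def
  proof (intro conjI ballI allI)
    show "annihilator \<subseteq> free_algebra G" by (auto simp: annihilator_def)
    show "leavitt_kernel G \<subseteq> annihilator"
      using kernel leavitt_kernel_subset by (auto simp: annihilator_def)
  next
    fix x y assume "x \<in> annihilator" "y \<in> annihilator"
    then show "x + y \<in> annihilator" by (simp add: annihilator_def)
  next
    fix c x assume "x \<in> annihilator"
    then show "scale c x \<in> annihilator" by (simp add: annihilator_def)
  next
    fix a x :: "('v, 'e, 'k) free_elem" assume a: "a \<in> free_algebra G" and x: "x \<in> annihilator"
    then have "x \<in> free_algebra G" by (simp add: annihilator_def)
    with a show "a * x \<in> annihilator" "x * a \<in> annihilator"
      unfolding annihilator_def by (simp_all add: act_mult ann[OF x] act_0)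
  qed
qed

lemma vx_annihilator_iff:
  assumes "v \<in> verts G" shows "vx v \<in> annihilator \<longleftrightarrow> (\<forall>t\<in>X. src t \<noteq> v)"
proof
  assume "vx v \<in> annihilator"
  then have "act (vx v) (\<lambda>_. 1) t = 0" for t by (simp add: annihilator_def)
  then show "\<forall>t\<in>X. src t \<noteq> v" unfolding act_vx by (metis one_neq_zero)
qed (use assms in \<open>auto simp: annihilator_def act_vx\<close>)

lemma gap_annihilator_iff:
  assumes v: "v \<in> verts G" and Z: "finite Z" "Z \<subseteq> out_arcs G v"
  shows "gap v Z \<in> annihilator \<longleftrightarrow> (\<forall>t\<in>X. src t = v \<longrightarrow> (\<exists>e\<in>Z. t \<in> range_of e))"
proof
  assume "gap v Z \<in> annihilator"
  then have "act (gap v Z) (\<lambda>_. 1) t = 0" for t by (simp add: annihilator_def)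
  then show "\<forall>t\<in>X. src t = v \<longrightarrow> (\<exists>e\<in>Z. t \<in> range_of e)"
    unfolding gap_def act_gap[OF Z] by (metis one_neq_zero)
next
  assume "\<forall>t\<in>X. src t = v \<longrightarrow> (\<exists>e\<in>Z. t \<in> range_of e)"
  then have "act (gap v Z) \<phi> t = 0" for \<phi> t unfolding gap_def act_gap[OF Z] by auto
  then show "gap v Z \<in> annihilator" using v Z by (simp add: annihilator_def)
qed

end

section \<open>An ideal for every admissible pair\<close>

context leavitt
begin

text \<open>
  A boundary path is encoded as an infinite sequence of its vertices and next edges; after it has
  stopped, the last vertex is repeated with \<open>None\<close>. It may stop where the corresponding path of the
  quotient graph may: at a vertex that is neither regular nor in \<open>S\<close>. Stopping at a breaking vertex
  \<open>v \<notin> S\<close> corresponds to ending in the sink \<open>v'\<close>.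
\<close>

definition boundary_step :: "'v set \<Rightarrow> 'v set \<Rightarrow> 'v \<times> 'e option \<Rightarrow> 'v \<times> 'e option \<Rightarrow> bool" where
  "boundary_step H S a b \<longleftrightarrow> (case snd a of
      None \<Rightarrow> \<not> regular_vertex G (fst a) \<and> fst a \<notin> S \<and> b = a
    | Some e \<Rightarrow> e \<in> arcs G \<and> tail G e = fst a \<and> head G e \<notin> H \<and> fst b = head G e)"

definition boundary_paths :: "'v set \<Rightarrow> 'v set \<Rightarrow> (nat \<Rightarrow> 'v \<times> 'e option) set" where
  "boundary_paths H S =
     {p. fst (p 0) \<in> verts G - H \<and> (\<forall>n. boundary_step H S (p n) (p (Suc n)))}"

definition prepend :: "'e \<Rightarrow> (nat \<Rightarrow> 'v \<times> 'e option) \<Rightarrow> nat \<Rightarrow> 'v \<times> 'e option" where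
  "prepend e p = case_nat (tail G e, Some e) p"

lemma boundary_path_tail:
  assumes p: "p \<in> boundary_paths H S" and e: "snd (p 0) = Some e"
  shows "e \<in> arcs G" "tail G e = fst (p 0)" "head G e \<notin> H" "fst (p 1) = head G e"
    "(\<lambda>n. p (Suc n)) \<in> boundary_paths H S" "p = prepend e (\<lambda>n. p (Suc n))"
proof -
  have st: "boundary_step H S (p n) (p (Suc n))" for n
    using p by (simp add: boundary_paths_def)
  from st[of 0] e show e': "e \<in> arcs G" "tail G e = fst (p 0)" "head G e \<notin> H" "fst (p 1) = head G e"
    by (simp_all add: boundary_step_def)
  show "(\<lambda>n. p (Suc n)) \<in> boundary_paths H S"
    unfolding boundary_paths_def using st e' by auto
  show "p = prepend e (\<lambda>n. p (Suc n))"
  proof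
    fix n show "p n = prepend e (\<lambda>n. p (Suc n)) n"
      using e e'(2) by (cases n) (simp_all add: prepend_def prod_eq_iff)
  qed
qed

lemma prepend_boundary_path:
  assumes hered: "hereditary G H" and e: "e \<in> arcs G" and p: "p \<in> boundary_paths H S" "fst (p 0) = head G e"
  shows "prepend e p \<in> boundary_paths H S"
proof -
  have "head G e \<notin> H" using p by (simp add: boundary_paths_def)
  moreover from this have "tail G e \<notin> H" using hered e unfolding hereditary_iff_arcs by blast
  ultimately show ?thesis using e p
    by (auto simp: boundary_paths_def boundary_step_def prepend_def split: nat.split)
qed

lemma prepend_eq_iff: "prepend e p = prepend f q \<longleftrightarrow> e = f \<and> p = q"
proof
  assume eq: "prepend e p = prepend f q"
  have "e = f" using fun_cong[OF eq, of 0] by (simp add: prepend_def)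
  moreover have "p n = q n" for n using fun_cong[OF eq, of "Suc n"] by (simp add: prepend_def)
  ultimately show "e = f \<and> p = q" by auto
qed simp

lemma branching_boundary_paths:
  assumes hered: "hereditary G H"
  shows "branching_system G (boundary_paths H S) (\<lambda>p. fst (p 0)) prepend"
proof
  fix e p assume "e \<in> arcs G" "p \<in> boundary_paths H S" "fst (p 0) = head G e"
  then show "prepend e p \<in> boundary_paths H S" by (rule prepend_boundary_path[OF hered])
  show "fst (prepend e p 0) = tail G e" by (simp add: prepend_def)
next
  fix p assume p: "p \<in> boundary_paths H S" and reg: "regular_vertex G (fst (p 0))"
  have "snd (p 0) \<noteq> None"
  proof
    assume "snd (p 0) = None"
    moreover have "boundary_step H S (p 0) (p (Suc 0))" using p by (simp add: boundary_paths_def)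
    ultimately show False using reg by (simp add: boundary_step_def)
  qed
  then obtain e where "snd (p 0) = Some e" by blast
  from boundary_path_tail[OF p this]
  show "\<exists>e\<in>arcs G. \<exists>s\<in>boundary_paths H S. fst (s 0) = head G e \<and> p = prepend e s"
    by (metis One_nat_def)
qed (use prepend_eq_iff in blast)

text \<open>
  Start in \<open>v\<close>, stop as soon as this is allowed, and otherwise follow an edge that avoids \<open>H\<close>. There is
  one at a regular vertex by saturation, and at a vertex in \<open>S\<close> because it is a breaking vertex.
\<close>

lemma ex_boundary_path:
  assumes H: "hereditary G H" "saturated G H" and S: "S \<subseteq> breaking_vertices G H"
    and v: "v \<in> verts G" "v \<notin> H"
  shows "\<exists>p\<in>boundary_paths H S. fst (p 0) = v"
proof -
  define next_arc where "next_arc w = (if \<not> regular_vertex G w \<and> w \<notin> S then None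
    else Some (SOME e. e \<in> out_arcs G w \<and> head G e \<notin> H))" for w
  define go where "go = (\<lambda>(w, a). case a of None \<Rightarrow> (w, a) | Some e \<Rightarrow> (head G e, next_arc (head G e)))"
  define p where "p n = (go ^^ n) (v, next_arc v)" for n
  have arc: "e \<in> arcs G \<and> tail G e = w \<and> head G e \<notin> H"
    if w: "w \<notin> H" and "next_arc w = Some e" for w e
  proof -
    from that have cases: "regular_vertex G w \<or> w \<in> S" and e: "e = (SOME e. e \<in> out_arcs G w \<and> head G e \<notin> H)"
      by (auto simp: next_arc_def split: if_splits)
    from cases have "\<exists>e. e \<in> out_arcs G w \<and> head G e \<notin> H"
    proof
      assume "regular_vertex G w"
      then show ?thesis using H(2) w unfolding saturated_def by blast
    next
      assume "w \<in> S"
      then have "w \<in> breaking_vertices G H" using S by blast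
      then show ?thesis unfolding breaking_vertices_iff by blast
    qed
    from someI_ex[OF this] show ?thesis unfolding e by auto
  qed
  have p_Suc: "p (Suc n) = go (p n)" for n by (simp add: p_def)
  have inv: "fst (p n) \<notin> H \<and> snd (p n) = next_arc (fst (p n))" for n
  proof (induction n)
    case (Suc n)
    then show ?case using arc[of "fst (p n)"] unfolding p_Suc go_def
      by (auto split: prod.splits option.splits)
  qed (use v in \<open>simp add: p_def\<close>)
  have "boundary_step H S (p n) (p (Suc n))" for n
  proof (cases "snd (p n)")
    case None
    with inv[of n] have "\<not> regular_vertex G (fst (p n)) \<and> fst (p n) \<notin> S"
      by (auto simp: next_arc_def split: if_splits)
    with None show ?thesis unfolding boundary_step_def p_Suc go_def by (cases "p n") simp
  next
    case (Some e)
    with inv[of n] arc[of "fst (p n)" e] show ?thesis unfolding boundary_step_def p_Suc go_def by (cases "p n") simp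
  qed
  moreover have "p 0 = (v, next_arc v)" by (simp add: p_def)
  ultimately have "p \<in> boundary_paths H S" "fst (p 0) = v" using v by (simp_all add: boundary_paths_def)
  then show ?thesis by blast
qed

text \<open>
  Boundary paths start at each vertex outside \<open>H\<close> and at no other vertex, which gives the vertex set. The
  element \<open>v\<^sup>H\<close> projects onto the paths from \<open>v\<close> without a first edge; there is such a path,
  the one that stops at \<open>v\<close>, exactly if \<open>v \<notin> S\<close>.
\<close>

lemma ex_ideal_of_pair:
  assumes "(H, S) \<in> admissible_pairs G"
  shows "\<exists>A. lpa_ideal G A \<and> vertex_set A = H \<and> breaking_set A = S"
proof -
  have H: "hereditary G H" "saturated G H" and S: "S \<subseteq> breaking_vertices G H"
    using assms by (auto simp: admissible_pairs_def)
  interpret branching_system G K "boundary_paths H S" "\<lambda>p. fst (p 0)" prepend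
    by (rule branching_boundary_paths[OF H(1)])
  have src: "fst (p 0) \<in> verts G - H" if "p \<in> boundary_paths H S" for p
    using that by (simp add: boundary_paths_def)
  have vs: "vertex_set annihilator = H"
  proof -
    have "vx v \<in> annihilator \<longleftrightarrow> v \<in> H" if "v \<in> verts G" for v
      using vx_annihilator_iff[OF that] ex_boundary_path[OF H S that] src by blast
    moreover have "H \<subseteq> verts G" using H by (simp add: hereditary_def)
    ultimately show ?thesis by (auto simp: vertex_set_def)
  qed
  have "breaking_element H v \<in> annihilator \<longleftrightarrow> v \<in> S" if v: "v \<in> breaking_vertices G H" for v
  proof -
    let ?Z = "{e \<in> out_arcs G v. head G e \<notin> H}"
    have vv: "v \<in> verts G" "v \<notin> H" "finite ?Z" "\<not> regular_vertex G v"
      using v by (auto simp: breaking_vertices_iff regular_vertex_def)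
    have iff: "breaking_element H v \<in> annihilator \<longleftrightarrow>
      (\<forall>t\<in>boundary_paths H S. fst (t 0) = v \<longrightarrow> (\<exists>e\<in>?Z. t \<in> range_of e))"
      unfolding breaking_element_def by (rule gap_annihilator_iff) (use vv in auto)
    show ?thesis
    proof
      assume vS: "v \<in> S"
      have "\<exists>e\<in>?Z. t \<in> range_of e" if t: "t \<in> boundary_paths H S" "fst (t 0) = v" for t
      proof -
        have "boundary_step H S (t 0) (t (Suc 0))" using t(1) by (simp add: boundary_paths_def)
        with vS t obtain e where e: "snd (t 0) = Some e"
          by (cases "snd (t 0)") (auto simp: boundary_step_def)
        note tl = boundary_path_tail[OF t(1) e]
        have "prepend e (\<lambda>n. t (Suc n)) \<in> range_of e"
          unfolding range_of_def using tl(4,5) by (intro imageI) simp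
        then have "t \<in> range_of e" by (simp only: tl(6)[symmetric])
        moreover have "e \<in> ?Z" using tl(1-3) t(2) by simp
        ultimately show ?thesis by blast
      qed
      then show "breaking_element H v \<in> annihilator" unfolding iff by blast
    next
      assume mem: "breaking_element H v \<in> annihilator"
      show "v \<in> S"
      proof (rule ccontr)
        assume "v \<notin> S"
        then have t: "(\<lambda>_. (v, None)) \<in> boundary_paths H S"
          using vv by (simp add: boundary_paths_def boundary_step_def)
        with mem obtain e where "(\<lambda>_. (v, None)) \<in> range_of e" unfolding iff by auto
        then obtain s where "(\<lambda>_. (v, None)) = prepend e s" unfolding range_of_def by blast
        from fun_cong[OF this, of 0] show False by (simp add: prepend_def)
      qed
    qed
  qed
  then have "breaking_set annihilator = S" unfolding breaking_set_def vs using S by auto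
  with vs lpa_ideal_annihilator show ?thesis by blast
qed

end

section \<open>Incomparable ideals when condition (K) fails\<close>

context wf_digraph
begin

text \<open>
  If no two edges of \<open>A\<close> have the same source, a walk in \<open>A\<close> is determined by its first vertex and its
  length.
\<close>

lemma prefix_of_walk_in_functional_arcs:
  assumes A: "inj_on (tail G) A"
  shows "awalk x c y \<Longrightarrow> awalk x q z \<Longrightarrow> set c \<subseteq> A \<Longrightarrow> set q \<subseteq> A \<Longrightarrow> length c \<le> length q \<Longrightarrow> prefix c q"
proof (induction c arbitrary: x q)
  case (Cons e c)
  then obtain f r where q: "q = f # r" by (cases q) auto
  have "tail G e = tail G f" using Cons.prems q by (auto simp: awalk_simps)
  then have "e = f" using A Cons.prems q by (auto dest: inj_onD)
  with Cons q show ?case by (auto simp: awalk_simps)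
qed simp

text \<open>
  Let all closed walks at \<open>v\<close> have the same edges and let \<open>c\<close> be a shortest one. It visits no vertex twice,
  as it could be shortened otherwise, so its edges have different sources, and every closed walk at \<open>v\<close>
  uses only these edges.
\<close>

lemma ex_isolated_cycle:
  assumes "\<not> condition_K G"
  obtains v c where "awalk v c v" "c \<noteq> []" "distinct (map (tail G) c)"
    "\<And>q. awalk v q v \<Longrightarrow> q \<noteq> [] \<Longrightarrow> prefix c q"
proof -
  obtain u p v where p: "awalk u p u" "p \<noteq> []" "v \<in> set (awalk_verts u p)"
    and set_p: "\<And>q. awalk v q v \<Longrightarrow> q \<noteq> [] \<Longrightarrow> set q = set p"
    using assms unfolding condition_K_def closed_path_def by blast
  obtain q r where qr: "p = q @ r" "awalk u q v" "awalk v r u"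
    using awalk_decomp[OF p(1,3)] by blast
  have "awalk v (r @ q) v" using qr by (meson awalk_appendI)
  moreover have "r @ q \<noteq> []" using qr p by auto
  ultimately obtain c where c: "awalk v c v" "c \<noteq> []"
    and short: "\<And>q. awalk v q v \<Longrightarrow> q \<noteq> [] \<Longrightarrow> length c \<le> length q"
    using ex_has_least_nat[of "\<lambda>q. awalk v q v \<and> q \<noteq> []" "r @ q" length] by blast
  have split: "awalk v (take i c) (tail G (c ! i)) \<and> awalk (tail G (c ! i)) (drop i c) v"
    if "i < length c" for i
  proof -
    have "awalk v (take i c @ drop i c) v" using c by simp
    then have *: "awalk v (take i c) (awlast v (take i c))" "awalk (awlast v (take i c)) (drop i c) v"
      by (simp_all only: awalk_append_iff)
    moreover have "drop i c = c ! i # drop (Suc i) c" using that by (simp add: Cons_nth_drop_Suc)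
    ultimately have "awlast v (take i c) = tail G (c ! i)" by (simp add: awalk_Cons_iff)
    with * show ?thesis by simp
  qed
  have "distinct (map (tail G) c)"
  proof (rule ccontr)
    assume "\<not> ?thesis"
    then obtain i j where "i \<noteq> j" "i < length c" "j < length c" "tail G (c ! i) = tail G (c ! j)"
      by (auto simp: distinct_conv_nth)
    then obtain i j where ij: "i < j" "j < length c" "tail G (c ! i) = tail G (c ! j)"
      by (metis linorder_neqE_nat)
    then have "awalk v (take i c @ drop j c) v" using split[of i] split[of j]
      by (metis awalk_appendI order.strict_trans)
    moreover have "take i c @ drop j c \<noteq> []" using ij by simp
    ultimately show False using short[of "take i c @ drop j c"] ij by simp
  qed
  moreover have "prefix c q" if q: "awalk v q v" "q \<noteq> []" for q
  proof (rule prefix_of_walk_in_functional_arcs)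
    show "inj_on (tail G) (set c)" using calculation by (simp add: distinct_map)
    show "awalk v c v" "awalk v q v" "length c \<le> length q" using c q short by auto
    show "set q \<subseteq> set c" using set_p[OF c] set_p[OF q] by simp
  qed simp
  ultimately show ?thesis using that[OF c] by blast
qed

text \<open>
  Walks to \<open>v\<close> that do not pass through \<open>v\<close> before, with a counter modulo \<open>m\<close>.
\<close>

definition cycle_states :: "'a \<Rightarrow> nat \<Rightarrow> ('a \<times> 'b list \<times> nat) set" where
  "cycle_states v m = {(u, p, i). awalk u p v \<and> v \<notin> tail G ` set p \<and> i < m}"

text \<open>
  An edge from \<open>v\<close> completes a return to \<open>v\<close>; the walk is forgotten and only counted.
\<close>

definition cycle_ext :: "'a \<Rightarrow> nat \<Rightarrow> 'b \<Rightarrow> 'a \<times> 'b list \<times> nat \<Rightarrow> 'a \<times> 'b list \<times> nat" where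
  "cycle_ext v m e = (\<lambda>(u, p, i). if tail G e = v then (v, [], Suc i mod m) else (tail G e, e # p, i))"

end

context leavitt
begin

context
  fixes v :: "'v" and c :: "'e list" and m :: nat
  assumes c: "awalk v c v" "c \<noteq> []" "distinct (map (tail G) c)"
    and unique: "\<And>q. awalk v q v \<Longrightarrow> q \<noteq> [] \<Longrightarrow> prefix c q"
    and m: "0 < m"
begin

text \<open>
  The walk \<open>e # p\<close> begins with \<open>c\<close>, and it cannot continue because it would pass through \<open>v\<close> again.
\<close>

lemma first_return_unique:
  assumes e: "e \<in> arcs G" "tail G e = v" and p: "awalk (head G e) p v" "v \<notin> tail G ` set p"
  shows "e # p = c"
proof -
  have w: "awalk v (e # p) v" using e p by (auto simp: awalk_simps)
  then obtain r where r: "e # p = c @ r" using unique by (auto simp: prefix_def)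
  have "r = []"
  proof (rule ccontr)
    assume "r \<noteq> []"
    then obtain f r' where f: "r = f # r'" by (cases r) auto
    have "awalk v r v" using w unfolding r by (rule awalk_remainder[OF c(1)])
    then have "tail G f = v" using f by (auto simp: awalk_simps)
    moreover have "f \<in> set p" using r f c(2) by (cases c) auto
    ultimately show False using p(2) by blast
  qed
  with r show ?thesis by simp
qed

lemma cycle_Cons:
  obtains e p where "c = e # p" "e \<in> arcs G" "tail G e = v" "awalk (head G e) p v" "v \<notin> tail G ` set p"
proof -
  obtain e p where ep: "c = e # p" using c(2) by (cases c) auto
  with c(1) have "e \<in> arcs G" "tail G e = v" "awalk (head G e) p v" by (auto simp: awalk_simps)
  moreover have "v \<notin> tail G ` set p" using c(3) ep \<open>tail G e = v\<close> by auto
  ultimately show ?thesis using that ep by blast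
qed

lemma branching_cycle_states: "branching_system G (cycle_states v m) fst (cycle_ext v m)"
proof
  fix e t assume e: "e \<in> arcs G" and t: "t \<in> cycle_states v m" "fst t = head G e"
  have vv: "v \<in> verts G" using c(1) by auto
  obtain p i where t': "t = (head G e, p, i)" using t by (cases t) auto
  show "cycle_ext v m e t \<in> cycle_states v m" "fst (cycle_ext v m e t) = tail G e"
    using e t t' m vv by (auto simp: cycle_states_def cycle_ext_def awalk_simps)
next
  fix e f s t assume e: "e \<in> arcs G" and f: "f \<in> arcs G" and s: "s \<in> cycle_states v m" "fst s = head G e"
    and t: "t \<in> cycle_states v m" "fst t = head G f" and eq: "cycle_ext v m e s = cycle_ext v m f t"
  obtain p i where s': "s = (head G e, p, i)" "awalk (head G e) p v" "v \<notin> tail G ` set p" "i < m"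
    using s by (cases s) (auto simp: cycle_states_def)
  obtain q j where t': "t = (head G f, q, j)" "awalk (head G f) q v" "v \<notin> tail G ` set q" "j < m"
    using t by (cases t) (auto simp: cycle_states_def)
  show "e = f \<and> s = t"
  proof (cases "tail G e = v")
    case True
    with eq s'(1) t'(1) have fv: "tail G f = v" and ij: "Suc i mod m = Suc j mod m"
      by (auto simp: cycle_ext_def split: if_splits)
    have "e # p = f # q"
      using first_return_unique[OF e True s'(2,3)] first_return_unique[OF f fv t'(2,3)] by simp
    moreover have "i = j" using ij s'(4) t'(4) by (simp add: mod_Suc split: if_splits)
    ultimately show ?thesis using s' t' by simp
  next
    case False
    with eq s'(1) t'(1) show ?thesis by (auto simp: cycle_ext_def split: if_splits)
  qed
next
  fix t assume t: "t \<in> cycle_states v m" and "regular_vertex G (fst t)"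
  obtain u p i where t': "t = (u, p, i)" "awalk u p v" "v \<notin> tail G ` set p" "i < m"
    using t by (cases t) (auto simp: cycle_states_def)
  show "\<exists>e\<in>arcs G. \<exists>s\<in>cycle_states v m. fst s = head G e \<and> t = cycle_ext v m e s"
  proof (cases p)
    case Nil
    then have u: "u = v" using t' by (simp add: awalk_simps)
    obtain e r where e: "c = e # r" "e \<in> arcs G" "tail G e = v" "awalk (head G e) r v" "v \<notin> tail G ` set r"
      by (rule cycle_Cons)
    \<comment> \<open>The counter was \<open>i - 1\<close> modulo \<open>m\<close> before the return to \<open>v\<close>.\<close>
    have "Suc ((i + m - 1) mod m) mod m = i"
    proof -
      have "Suc ((i + m - 1) mod m) mod m = Suc (i + m - 1) mod m" by (rule mod_Suc_eq)
      also have "Suc (i + m - 1) = i + m" using m by simp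
      finally show ?thesis using t'(4) by simp
    qed
    then have "t = cycle_ext v m e (head G e, r, (i + m - 1) mod m)"
      using t' u Nil e by (simp add: cycle_ext_def)
    moreover have "(head G e, r, (i + m - 1) mod m) \<in> cycle_states v m"
      using e m by (simp add: cycle_states_def)
    ultimately show ?thesis using e(2) by (metis fst_conv)
  next
    case (Cons e r)
    then have e: "e \<in> arcs G" "tail G e = u" "tail G e \<noteq> v" "awalk (head G e) r v"
      using t' by (auto simp: awalk_simps)
    then have "t = cycle_ext v m e (head G e, r, i)" using t' Cons by (simp add: cycle_ext_def)
    moreover have "(head G e, r, i) \<in> cycle_states v m" using e t' Cons by (simp add: cycle_states_def)
    ultimately show ?thesis using e(1) by (metis fst_conv)
  qed
qed

interpretation branching_system G K "cycle_states v m" fst "cycle_ext v m"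
  by (rule branching_cycle_states)

lemma cycle_states_at_base: "t \<in> cycle_states v m \<and> fst t = v \<longleftrightarrow> (\<exists>i<m. t = (v, [], i))"
proof
  assume "t \<in> cycle_states v m \<and> fst t = v"
  then obtain p i where t: "t = (v, p, i)" "awalk v p v" "v \<notin> tail G ` set p" "i < m"
    by (cases t) (auto simp: cycle_states_def)
  have "p = []"
  proof (rule ccontr)
    assume "p \<noteq> []"
    with t(2) have "tail G (hd p) = v" "hd p \<in> set p" by (cases p; auto simp: awalk_simps)+
    with t(3) show False by blast
  qed
  with t show "\<exists>i<m. t = (v, [], i)" by blast
next
  assume "\<exists>i<m. t = (v, [], i)"
  then show "t \<in> cycle_states v m \<and> fst t = v"
    using c(1) by (auto simp: cycle_states_def awalk_simps)
qed

text \<open>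
  The letters of a ghost word are read from the last edge of \<open>p\<close> to the first, so the walk is built up
  from its end.
\<close>

lemma moves_to_base:
  assumes "awalk u p v" "v \<notin> tail G ` set p" "i < m"
  shows "moves (map Ghost (rev p)) (v, [], i) = Some (u, p, i)"
  using assms
proof (induction p arbitrary: u)
  case (Cons f r)
  then have f: "f \<in> arcs G" "tail G f = u" "awalk (head G f) r v" "v \<notin> tail G ` set r" "u \<noteq> v"
    by (auto simp: awalk_simps)
  then have "(head G f, r, i) \<in> cycle_states v m" using Cons.prems by (simp add: cycle_states_def)
  moreover have "moves (map Ghost (rev r)) (v, [], i) = Some (head G f, r, i)"
    using Cons.IH f Cons.prems by blast
  moreover have "cycle_ext v m f (head G f, r, i) = (u, f # r, i)" using f by (simp add: cycle_ext_def)
  ultimately show ?case using f by (simp add: moves_append)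
qed (simp add: awalk_simps)

lemma moves_cycle: "i < m \<Longrightarrow> moves (ghost_word v c) (v, [], i) = Some (v, [], Suc i mod m)"
proof -
  assume i: "i < m"
  obtain e p where e: "c = e # p" "e \<in> arcs G" "tail G e = v" "awalk (head G e) p v" "v \<notin> tail G ` set p"
    by (rule cycle_Cons)
  have "(head G e, p, i) \<in> cycle_states v m" using e i by (simp add: cycle_states_def)
  moreover have "cycle_ext v m e (head G e, p, i) = (v, [], Suc i mod m)"
    using e by (simp add: cycle_ext_def)
  ultimately show ?thesis using moves_to_base[OF e(4,5) i] e
    by (simp add: ghost_word_def moves_append)
qed

lemma act_cycle_power:
  assumes "0 < j" "i < m"
  shows "act ((vx v * gw v c) ^ j) \<phi> (v, [], i) = \<phi> (v, [], (i + j) mod m)"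
  using assms
proof (induction j arbitrary: i rule: nat_induct_non_zero)
  case 1
  have "act (vx v * gw v c) \<phi> (v, [], i) = act (gw v c) \<phi> (v, [], i)"
    using cycle_states_at_base[of "(v, [], i)"] 1 by (simp add: act_mult act_vx)
  then show ?case using moves_cycle[OF 1] by (simp add: act_monomial)
next
  case (Suc j)
  have "act (vx v * gw v c) \<psi> (v, [], i) = \<psi> (v, [], Suc i mod m)" for \<psi>
    using cycle_states_at_base[of "(v, [], i)"] moves_cycle[OF Suc.prems] Suc.prems
    by (simp add: act_mult act_vx act_monomial)
  then show ?case using Suc.IH[of "Suc i mod m"] m
    by (simp only: power_Suc act_mult mod_less_divisor) (simp add: mod_simps)
qed

lemma cycle_power_in: "0 < j \<Longrightarrow> (vx v * gw v c) ^ j \<in> free_algebra G"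
proof -
  assume j: "0 < j"
  have "v \<in> verts G" using c(1) by auto
  then have mem: "vx v * gw v c \<in> free_algebra G" using gw_in[OF c(1)] by simp
  from j show ?thesis by (induction j rule: nat_induct_non_zero) (simp_all add: mem)
qed

text \<open>
  The ghost path of \<open>c\<close> increases the counter, so its \<open>j\<close>-th power acts like \<open>v\<close> exactly if \<open>m\<close>
  divides \<open>j\<close>. The factor \<open>v\<close> only makes it evident that points away from \<open>v\<close> are sent to zero.
\<close>

lemma cycle_power_annihilator_iff:
  assumes j: "0 < j"
  shows "vx v - (vx v * gw v c) ^ j \<in> annihilator \<longleftrightarrow> m dvd j"
proof
  assume "vx v - (vx v * gw v c) ^ j \<in> annihilator"
  then have "act (vx v - (vx v * gw v c) ^ j) (\<lambda>t. if t = (v, [], 0) then 1 else 0) (v, [], 0) = 0"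
    by (simp add: annihilator_def)
  then have "j mod m = 0"
    using act_cycle_power[OF j m] cycle_states_at_base[of "(v, [], 0)"] m
    by (simp add: act_vx split: if_splits)
  then show "m dvd j" by auto
next
  assume dvd: "m dvd j"
  have "act (vx v - (vx v * gw v c) ^ j) \<phi> t = 0" for \<phi> t
  proof (cases "\<exists>i<m. t = (v, [], i)")
    case True
    then obtain i where i: "i < m" "t = (v, [], i)" by blast
    have "(i + j) mod m = i" using dvd i by (auto simp: mod_add_right_eq[symmetric])
    then show ?thesis using act_cycle_power[OF j i(1)] cycle_states_at_base[of t] i
      by (simp add: act_vx)
  next
    case False
    then have nb: "\<not> (t \<in> cycle_states v m \<and> fst t = v)" using cycle_states_at_base by blast
    obtain j' where "j = Suc j'" using j by (cases j) auto
    with nb show ?thesis by (auto simp: act_vx act_mult)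
  qed
  moreover have "vx v \<in> free_algebra G" using c(1) by auto
  ultimately show "vx v - (vx v * gw v c) ^ j \<in> annihilator"
    using cycle_power_in[OF j] by (simp add: annihilator_def)
qed

lemma ex_cycle_ideal:
  "\<exists>A. lpa_ideal G A \<and> (\<forall>j>0. vx v - (vx v * gw v c) ^ j \<in> A \<longleftrightarrow> m dvd j)"
  using lpa_ideal_annihilator cycle_power_annihilator_iff by blast

end

lemma condition_K_if_chain:
  assumes chain: "\<And>A B :: ('v, 'e, 'k) free_elem set. lpa_ideal G A \<Longrightarrow> lpa_ideal G B \<Longrightarrow> A \<subseteq> B \<or> B \<subseteq> A"
  shows "condition_K G"
proof (rule ccontr)
  assume "\<not> condition_K G"
  then obtain v c where c: "awalk v c v" "c \<noteq> []" "distinct (map (tail G) c)"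
    "\<And>q. awalk v q v \<Longrightarrow> q \<noteq> [] \<Longrightarrow> prefix c q" by (rule ex_isolated_cycle) blast
  \<comment> \<open>Neither of the lengths 2 and 3 of the two rotations divides the other.\<close>
  let ?y = "\<lambda>j :: nat. vx v - (vx v * gw v c) ^ j"
  obtain A where A: "lpa_ideal G A" "\<forall>j>0. ?y j \<in> A \<longleftrightarrow> 2 dvd j"
    using ex_cycle_ideal[OF c, of 2] by auto
  obtain B where B: "lpa_ideal G B" "\<forall>j>0. ?y j \<in> B \<longleftrightarrow> 3 dvd j"
    using ex_cycle_ideal[OF c, of 3] by auto
  have "?y 2 \<in> A" "?y 2 \<notin> B" "?y 3 \<in> B" "?y 3 \<notin> A" using A(2) B(2) by auto
  with chain[OF A(1) B(1)] show False by blast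
qed

end

section \<open>The grading\<close>

definition degree_part :: "int \<Rightarrow> ('v, 'e, 'k::field) free_elem \<Rightarrow> ('v, 'e, 'k) free_elem" where
  "degree_part n x = (\<Sum>k\<in>{k \<in> keys x. word_degree k = n}. single k (lookup x k))"

lemma lookup_degree_part:
  "lookup (degree_part n x) k = (if word_degree k = n then lookup x k else 0)"
proof -
  let ?A = "{k \<in> keys x. word_degree k = n}"
  have "lookup (degree_part n x) k = (\<Sum>l\<in>?A. if l = k then lookup x l else 0)"
    by (simp add: degree_part_def lookup_sum lookup_single when_def)
  also have "\<dots> = (if k \<in> ?A then lookup x k else 0)" by simp
  finally show ?thesis by (auto simp: in_keys_iff)
qed

lemma degree_part_simps [simp]:
  "degree_part n 0 = 0" "degree_part n (x + y) = degree_part n x + degree_part n y"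
  "degree_part n (x - y) = degree_part n x - degree_part n y"
  "degree_part n (scale c x) = scale c (degree_part n x)"
  by (rule poly_mapping_eqI; simp add: lookup_degree_part lookup_add lookup_minus lookup_scale)+

lemma degree_part_sum: "degree_part n (sum f A) = (\<Sum>a\<in>A. degree_part n (f a))"
  by (induction A rule: infinite_finite_induct) auto

lemma keys_degree_part: "keys (degree_part n x) = {k \<in> keys x. word_degree k = n}"
  by (auto simp: in_keys_iff lookup_degree_part split: if_splits)

lemma degree_part_in [simp]: "x \<in> free_algebra E \<Longrightarrow> degree_part n x \<in> free_algebra E"
  by (auto simp: free_algebra_def keys_degree_part)

lemma sum_degree_part:
  assumes "finite D" "word_degree ` keys x \<subseteq> D"
  shows "(\<Sum>n\<in>D. degree_part n x) = x"
proof (rule poly_mapping_eqI)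
  fix k
  have "(\<Sum>n\<in>D. if word_degree k = n then lookup x k else 0) = lookup x k"
    using assms by (cases "lookup x k = 0") (auto simp: in_keys_iff image_subset_iff)
  then show "lookup (\<Sum>n\<in>D. degree_part n x) k = lookup x k"
    by (simp add: lookup_sum lookup_degree_part)
qed

definition homogeneous :: "int \<Rightarrow> ('v, 'e, 'k::field) free_elem \<Rightarrow> bool" where
  "homogeneous n x \<longleftrightarrow> (\<forall>k\<in>keys x. word_degree k = n)"

lemma degree_part_homogeneous: "homogeneous d x \<Longrightarrow> degree_part n x = (if n = d then x else 0)"
  by (rule poly_mapping_eqI) (auto simp: homogeneous_def lookup_degree_part in_keys_iff)

lemma homogeneous_degree_part: "homogeneous n (degree_part n x)"
  by (simp add: homogeneous_def keys_degree_part)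

lemma homogeneous_zero [simp]: "homogeneous n 0"
  by (simp add: homogeneous_def)

lemma homogeneous_monomial: "homogeneous n (monomial w) \<longleftrightarrow> word_degree (Word w) = n"
  by (simp add: homogeneous_def)

lemma homogeneous_add: "homogeneous n x \<Longrightarrow> homogeneous n y \<Longrightarrow> homogeneous n (x + y)"
  unfolding homogeneous_def using keys_add[of x y] by blast

lemma homogeneous_scale: "homogeneous n x \<Longrightarrow> homogeneous n (scale c x)"
  unfolding homogeneous_def using keys_scale[of c x] by blast

lemma homogeneous_diff: "homogeneous n x \<Longrightarrow> homogeneous n y \<Longrightarrow> homogeneous n (x - y)"
  using homogeneous_add[of n x "- y"] homogeneous_scale[of n y "-1"] by simp

lemma homogeneous_sum: "(\<And>a. a \<in> A \<Longrightarrow> homogeneous n (f a)) \<Longrightarrow> homogeneous n (sum f A)"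
  by (induction A rule: infinite_finite_induct) (auto intro: homogeneous_add)

lemma homogeneous_relation:
  assumes "x \<in> leavitt_relations E" shows "\<exists>n. homogeneous n x"
proof -
  have "homogeneous 0 x \<or> homogeneous 1 x \<or> homogeneous (- 1) x"
    using assms
    by cases (auto simp: monomial_append[symmetric] homogeneous_monomial word_degree_def
        intro!: homogeneous_diff homogeneous_sum)
  then show ?thesis by blast
qed

lemma degree_part_single_mult:
  "degree_part n (single k c * y) = single k c * degree_part (n - word_degree k) y"
  "degree_part n (y * single k c) = degree_part (n - word_degree k) y * single k c"
proof -
  have single: "degree_part n (single k c) =
      (if word_degree k = n then single k c else 0)" for n k and c :: 'c
    by (rule poly_mapping_eqI) (simp add: lookup_degree_part lookup_single when_def)
  show "degree_part n (single k c * y) = single k c * degree_part (n - word_degree k) y"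
    using subset_UNIV[of "keys y"]
    by (induction y rule: poly_mapping_keys_induct)
      (auto simp: distrib_left mult_single single word_degree_add)
  show "degree_part n (y * single k c) = degree_part (n - word_degree k) y * single k c"
    using subset_UNIV[of "keys y"]
    by (induction y rule: poly_mapping_keys_induct)
      (auto simp: distrib_right mult_single single word_degree_add)
qed

context leavitt
begin

lemma degree_part_mult_mem:
  fixes A :: "('v, 'e, 'k) free_elem set"
  assumes A: "lpa_ideal G A" and x: "\<And>n. degree_part n x \<in> A" and a: "a \<in> free_algebra G"
  shows "degree_part n (a * x) \<in> A \<and> degree_part n (x * a) \<in> A"
proof -
  from a have "keys a \<subseteq> {w. letters w \<noteq> [] \<and> set (letters w) \<subseteq> generators G}"
    by (simp add: free_algebra_iff)
  then show ?thesis
  proof (induction a rule: poly_mapping_keys_induct)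
    case (add k c a)
    then have "single k c \<in> free_algebra G"
      by (simp add: single_eq_scale free_algebra_monomial)
    then have "single k c * degree_part (n - word_degree k) x \<in> A"
      "degree_part (n - word_degree k) x * single k c \<in> A"
      using lpa_idealD(8,9)[OF A _ x] by auto
    with add.IH lpa_idealD(4)[OF A] show ?case
      by (simp add: distrib_left distrib_right degree_part_single_mult)
  qed (simp add: lpa_idealD(3)[OF A])
qed

lemma degree_part_kernel:
  "x \<in> leavitt_kernel G \<Longrightarrow> degree_part n x \<in> (leavitt_kernel G :: ('v, 'e, 'k) free_elem set)"
proof (induction arbitrary: n rule: leavitt_kernel.induct)
  case (relation x)
  then obtain d where "homogeneous d x" using homogeneous_relation by blast
  with relation show ?case by (simp add: degree_part_homogeneous leavitt_kernel.intros)
next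
  case (mult_left a x)
  then show ?case using degree_part_mult_mem[OF lpa_ideal_kernel] by blast
next
  case (mult_right a x)
  then show ?case using degree_part_mult_mem[OF lpa_ideal_kernel] by blast
qed (simp_all add: leavitt_kernel.intros)

lemma lpa_ideal_homogeneous_part:
  fixes A :: "('v, 'e, 'k) free_elem set"
  assumes A: "lpa_ideal G A"
  shows "lpa_ideal G {x \<in> free_algebra G. \<forall>n. degree_part n x \<in> A}"
  unfolding lpa_ideal_def
proof (intro conjI ballI allI)
  show "leavitt_kernel G \<subseteq> {x \<in> free_algebra G. \<forall>n. degree_part n x \<in> A}"
    using degree_part_kernel leavitt_kernel_subset lpa_idealD(2)[OF A] by blast
next
  fix a x :: "('v, 'e, 'k) free_elem"
  assume a: "a \<in> free_algebra G" and x: "x \<in> {x \<in> free_algebra G. \<forall>n. degree_part n x \<in> A}"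
  have "degree_part n (a * x) \<in> A \<and> degree_part n (x * a) \<in> A" for n
    by (rule degree_part_mult_mem[OF A _ a]) (use x in simp)
  with a x show "a * x \<in> {x \<in> free_algebra G. \<forall>n. degree_part n x \<in> A}"
    "x * a \<in> {x \<in> free_algebra G. \<forall>n. degree_part n x \<in> A}" by auto
qed (use lpa_idealD[OF A] in auto)

text \<open>
  The elements of \<open>A\<close> with all homogeneous components in \<open>A\<close> form an ideal. It contains the vertices and
  the elements \<open>v\<^sup>H\<close> that \<open>A\<close> contains, since these have degree zero, so it is all of \<open>A\<close>.
\<close>

lemma degree_part_mem:
  assumes K: "condition_K G" and A: "lpa_ideal G A" and x: "x \<in> A"
  shows "degree_part n x \<in> (A :: ('v, 'e, 'k) free_elem set)"
proof -
  let ?J = "{x \<in> free_algebra G. \<forall>n. degree_part n x \<in> A}"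
  have hom: "y \<in> ?J" if "y \<in> A" "homogeneous 0 y" for y
    using that lpa_idealD(1,3)[OF A] by (simp add: degree_part_homogeneous)
  have "A \<subseteq> ?J"
  proof (rule ideal_le_of_pair[OF K A lpa_ideal_homogeneous_part[OF A]])
    show "vertex_set A \<subseteq> vertex_set ?J"
      using hom by (auto simp: vertex_set_def homogeneous_monomial word_degree_def)
    fix v assume "v \<in> breaking_set A"
    then have "breaking_element (vertex_set A) v \<in> A" by (simp add: breaking_set_def)
    moreover have "homogeneous 0 (breaking_element (vertex_set A) v)"
      unfolding breaking_element_def gap_def
      by (intro homogeneous_diff homogeneous_sum)
        (simp_all add: monomial_append[symmetric] homogeneous_monomial word_degree_def)
    ultimately show "breaking_element (vertex_set A) v \<in> ?J" by (rule hom)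
  qed
  with x show ?thesis by blast
qed

end

section \<open>Ideals of the algebra of cosets\<close>

context leavitt
begin

abbreviation L :: "('k, ('v, 'e, 'k) free_elem set) module" where
  "L \<equiv> leavitt_path_algebra G"

abbreviation cls :: "('v, 'e, 'k) free_elem \<Rightarrow> ('v, 'e, 'k) free_elem set" where
  "cls \<equiv> leavitt_class G"

lemma mem_cls_iff: "x \<in> free_algebra G \<Longrightarrow> y \<in> cls x \<longleftrightarrow> y \<doteq> x"
proof -
  assume x: "x \<in> free_algebra G"
  have "y \<in> free_algebra G" if "y - x \<in> leavitt_kernel G"
    using free_algebra_add[OF _ x, of "y - x"] that leavitt_kernel_subset by auto
  with x show ?thesis by (auto simp: leavitt_class_def eqv_def)
qed

lemma cls_eq_iff:
  assumes "x \<in> free_algebra G" "y \<in> free_algebra G" shows "cls x = cls y \<longleftrightarrow> x \<doteq> y"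
proof
  assume "cls x = cls y"
  moreover have "x \<in> cls x" using assms eqv_refl by (simp add: mem_cls_iff)
  ultimately show "x \<doteq> y" using assms by (simp add: mem_cls_iff)
next
  assume xy: "x \<doteq> y"
  have "z \<in> cls x \<longleftrightarrow> z \<in> cls y" for z
    using assms eqv_trans[OF _ xy] eqv_trans[OF _ eqv_sym[OF xy]] by (auto simp: mem_cls_iff)
  then show "cls x = cls y" by blast
qed

lemma UN_cls:
  assumes "x \<in> free_algebra G" "\<And>x'. x' \<doteq> x \<Longrightarrow> f x' = c"
  shows "(\<Union>x'\<in>cls x. f x') = c"
  using assms eqv_refl[OF assms(1)] by (auto simp: mem_cls_iff)

lemma carrier_L: "carrier L = cls ` free_algebra G"
  by (simp add: leavitt_path_algebra_def)

lemma L_zero: "\<zero>\<^bsub>L\<^esub> = cls 0"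
  by (simp add: leavitt_path_algebra_def)

lemma L_mult:
  assumes "x \<in> free_algebra G" "y \<in> free_algebra G" shows "cls x \<otimes>\<^bsub>L\<^esub> cls y = cls (x * y)"
proof -
  have "cls (x' * y') = cls (x * y)" if "x' \<doteq> x" "y' \<doteq> y" for x' y'
    using eqv_mult[OF that] by (simp add: cls_eq_iff eqvD)
  then show ?thesis
    using assms by (simp add: leavitt_path_algebra_def) (intro UN_cls; simp)
qed

lemma L_add:
  assumes "x \<in> free_algebra G" "y \<in> free_algebra G" shows "cls x \<oplus>\<^bsub>L\<^esub> cls y = cls (x + y)"
proof -
  have "cls (x' + y') = cls (x + y)" if "x' \<doteq> x" "y' \<doteq> y" for x' y'
    using eqv_add[OF that] by (simp add: cls_eq_iff eqvD)
  then show ?thesis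
    using assms by (simp add: leavitt_path_algebra_def) (intro UN_cls; simp)
qed

lemma L_smult:
  assumes "x \<in> free_algebra G" shows "k \<odot>\<^bsub>L\<^esub> cls x = cls (scale k x)"
proof -
  have "cls (scale k x') = cls (scale k x)" if "x' \<doteq> x" for x'
    using eqv_scale[OF that, of k] by (simp add: cls_eq_iff eqvD)
  then show ?thesis
    using assms by (simp add: leavitt_path_algebra_def) (intro UN_cls; simp)
qed

lemma abelian_group_L: "abelian_group L"
proof (rule abelian_groupI)
  fix x y z assume "x \<in> carrier L" "y \<in> carrier L" "z \<in> carrier L"
  then obtain a b c where abc: "a \<in> free_algebra G" "b \<in> free_algebra G" "c \<in> free_algebra G"
    "x = cls a" "y = cls b" "z = cls c" by (auto simp: carrier_L)
  show "x \<oplus>\<^bsub>L\<^esub> y \<in> carrier L" "x \<oplus>\<^bsub>L\<^esub> y \<oplus>\<^bsub>L\<^esub> z = x \<oplus>\<^bsub>L\<^esub> (y \<oplus>\<^bsub>L\<^esub> z)" "x \<oplus>\<^bsub>L\<^esub> y = y \<oplus>\<^bsub>L\<^esub> x"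
    using abc by (auto simp: L_add carrier_L algebra_simps)
next
  show "\<zero>\<^bsub>L\<^esub> \<in> carrier L" by (simp add: L_zero carrier_L)
next
  fix x assume "x \<in> carrier L"
  then obtain a where a: "a \<in> free_algebra G" "x = cls a" by (auto simp: carrier_L)
  then show "\<zero>\<^bsub>L\<^esub> \<oplus>\<^bsub>L\<^esub> x = x" by (simp add: L_add L_zero)
  have "cls (- a) \<oplus>\<^bsub>L\<^esub> x = \<zero>\<^bsub>L\<^esub>" using a by (simp add: L_add L_zero)
  then show "\<exists>y\<in>carrier L. y \<oplus>\<^bsub>L\<^esub> x = \<zero>\<^bsub>L\<^esub>" using a by (auto simp: carrier_L)
qed

definition rep_ideal :: "('v, 'e, 'k) free_elem set set \<Rightarrow> ('v, 'e, 'k) free_elem set" where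
  "rep_ideal I = {x \<in> free_algebra G. cls x \<in> I}"

lemma image_rep_ideal: "I \<subseteq> carrier L \<Longrightarrow> cls ` rep_ideal I = I"
  by (auto simp: rep_ideal_def carrier_L)

lemma rep_ideal_image:
  assumes A: "lpa_ideal G A" shows "rep_ideal (cls ` A) = A"
proof -
  have "x \<in> A" if "x \<in> free_algebra G" "y \<in> A" "cls x = cls y" for x y
    using that lpa_idealD(1)[OF A] lpa_ideal_eqv[OF A] by (simp add: cls_eq_iff)
  then show ?thesis using lpa_idealD(1)[OF A] by (auto simp: rep_ideal_def)
qed

text \<open>
  An ideal of the ring is closed under scalars because it is closed under multiplication by scalar
  multiples of local units.
\<close>

lemma lpa_ideal_rep_ideal:
  assumes I: "two_sided_ideal I L" shows "lpa_ideal G (rep_ideal I)"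
proof -
  interpret abelian_group L by (rule abelian_group_L)
  interpret I: additive_subgroup I L using I by (simp add: two_sided_ideal_def)
  have mult: "cls a \<otimes>\<^bsub>L\<^esub> x \<in> I" "x \<otimes>\<^bsub>L\<^esub> cls a \<in> I" if "x \<in> I" "a \<in> free_algebra G" for x a
    using I that by (auto simp: two_sided_ideal_def carrier_L)
  show ?thesis
    unfolding lpa_ideal_def
  proof (intro conjI ballI allI)
    show "leavitt_kernel G \<subseteq> rep_ideal I"
    proof
      fix x :: "('v, 'e, 'k) free_elem" assume x: "x \<in> leavitt_kernel G"
      then have xF: "x \<in> free_algebra G" using leavitt_kernel_subset by blast
      with x have "cls x = \<zero>\<^bsub>L\<^esub>" by (simp add: L_zero cls_eq_iff eqv_zero_iff)
      with xF have "x \<in> free_algebra G" "cls x = \<zero>\<^bsub>L\<^esub>" by simp_all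
      then show "x \<in> rep_ideal I" using I.zero_closed by (simp add: rep_ideal_def)
    qed
  next
    fix x y assume "x \<in> rep_ideal I" "y \<in> rep_ideal I"
    then show "x + y \<in> rep_ideal I" using I.a_closed by (auto simp: rep_ideal_def L_add[symmetric])
  next
    fix c x assume x: "x \<in> rep_ideal I"
    then have xF: "x \<in> free_algebra G" by (simp add: rep_ideal_def)
    from local_unit[OF this] obtain V where V: "finite V" "V \<subseteq> verts G" and eq: "(\<Sum>v\<in>V. vx v) * x \<doteq> x"
      by blast
    have uF: "(\<Sum>v\<in>V. vx v :: ('v, 'e, 'k) free_elem) \<in> free_algebra G" using V by (intro free_algebra_sum) auto
    have "scale c (\<Sum>v\<in>V. vx v) * x \<doteq> scale c x"
      unfolding scale_mult_left by (rule eqv_scale[OF eq])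
    then have "cls (scale c (\<Sum>v\<in>V. vx v) * x) = cls (scale c x)"
      using eqvD cls_eq_iff by blast
    then have "cls (scale c x) = cls (scale c (\<Sum>v\<in>V. vx v)) \<otimes>\<^bsub>L\<^esub> cls x"
      using L_mult[OF free_algebra_scale[OF uF] xF] by simp
    with mult(1)[of "cls x" "scale c (\<Sum>v\<in>V. vx v)"] x uF show "scale c x \<in> rep_ideal I"
      by (simp add: rep_ideal_def)
  next
    fix a x :: "('v, 'e, 'k) free_elem" assume "a \<in> free_algebra G" "x \<in> rep_ideal I"
    then show "a * x \<in> rep_ideal I" "x * a \<in> rep_ideal I"
      using mult by (auto simp: rep_ideal_def L_mult[symmetric])
  qed (auto simp: rep_ideal_def)
qed

lemma two_sided_ideal_image:
  assumes A: "lpa_ideal G A" shows "two_sided_ideal (cls ` A) L"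
proof -
  interpret abelian_group L by (rule abelian_group_L)
  note F = lpa_idealD(1)[OF A]
  have "subgroup (cls ` A) (add_monoid L)"
  proof (rule add.subgroupI)
    show "cls ` A \<subseteq> carrier L" using F by (auto simp: carrier_L)
    show "cls ` A \<noteq> {}" using lpa_idealD(3)[OF A] by auto
  next
    fix x assume "x \<in> cls ` A"
    then obtain a where a: "a \<in> A" "x = cls a" by auto
    have "\<ominus>\<^bsub>L\<^esub> x = cls (- a)"
      using a F by (intro minus_equality) (auto simp: L_add L_zero carrier_L)
    with a lpa_idealD(6)[OF A] show "\<ominus>\<^bsub>L\<^esub> x \<in> cls ` A" by blast
  next
    fix x y assume "x \<in> cls ` A" "y \<in> cls ` A"
    then show "x \<oplus>\<^bsub>L\<^esub> y \<in> cls ` A" using F lpa_idealD(4)[OF A] by (auto simp: L_add)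
  qed
  then have "additive_subgroup (cls ` A) L" by (rule additive_subgroupI)
  moreover have "x \<otimes>\<^bsub>L\<^esub> a \<in> cls ` A \<and> a \<otimes>\<^bsub>L\<^esub> x \<in> cls ` A" if "a \<in> cls ` A" "x \<in> carrier L" for a x
    using that F lpa_idealD(8,9)[OF A] by (auto simp: carrier_L L_mult)
  ultimately show ?thesis by (auto simp: two_sided_ideal_def)
qed

lemma two_sided_ideal_subset: "two_sided_ideal I L \<Longrightarrow> I \<subseteq> carrier L"
  unfolding two_sided_ideal_def using additive_subgroup.a_subset by blast

text \<open>
  A homogeneous word reduces to zero or to some \<open>\<mu>\<nu>\<^sup>*\<close> of the same degree.
\<close>

lemma component_eq: "leavitt_component G n = cls ` {x \<in> free_algebra G. homogeneous n x}"
proof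
  let ?X = "{cls (monomial (path_word u p @ ghost_word w q)) | u p w q.
          (\<exists>a. awalk u p a) \<and> (\<exists>b. awalk w q b) \<and> int (length p) - int (length q) = n}"
  have degree: "word_degree (Word (path_word u p @ ghost_word w q)) = int (length p) - int (length q)" for u w :: 'v and p q :: "'e list"
    by (simp add: word_degree_def path_word_def ghost_word_def o_def sum_list_triv)
  have comp: "leavitt_component G n = linear_span L ?X" by (simp add: leavitt_component_def)
  show "leavitt_component G n \<subseteq> cls ` {x \<in> free_algebra G. homogeneous n x}"
  proof
    fix z :: "('v, 'e, 'k) free_elem set" assume "z \<in> leavitt_component G n"
    then have "z \<in> linear_span L ?X" by (simp add: comp)
    then show "z \<in> cls ` {x \<in> free_algebra G. homogeneous n x}"
    proof induction
      case zero
      show ?case by (auto simp: L_zero)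
    next
      case (step x y c)
      then obtain u p w q a b where x: "x = cls (monomial (path_word u p @ ghost_word w q))"
        "awalk u p a" "awalk w q b" "int (length p) - int (length q) = n" by blast
      from step obtain y' where y: "y = cls y'" "y' \<in> free_algebra G" "homogeneous n y'" by blast
      have xF: "(monomial (path_word u p @ ghost_word w q) :: ('v, 'e, 'k) free_elem) \<in> free_algebra G"
        using x pw_in[OF x(2)] gw_in[OF x(3)] by (simp add: monomial_append)
      have "c \<odot>\<^bsub>L\<^esub> x \<oplus>\<^bsub>L\<^esub> y = cls (scale c (monomial (path_word u p @ ghost_word w q)) + y')"
        using x y xF by (simp add: L_smult L_add)
      moreover have "homogeneous n (scale c (monomial (path_word u p @ ghost_word w q)) + y')"
        using x y degree by (intro homogeneous_add homogeneous_scale) (auto simp: homogeneous_monomial)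
      ultimately show ?case using xF y by auto
    qed
  qed
  show "cls ` {x \<in> free_algebra G. homogeneous n x} \<subseteq> leavitt_component G n"
  proof clarify
    fix x :: "('v, 'e, 'k) free_elem" assume "x \<in> free_algebra G" "homogeneous n x"
    then have "keys x \<subseteq>
      {k. letters k \<noteq> [] \<and> set (letters k) \<subseteq> generators G \<and> word_degree k = n}"
      by (auto simp: free_algebra_def homogeneous_def)
    then have "cls x \<in> linear_span L ?X"
    proof (induction x rule: poly_mapping_keys_induct)
      case zero
      show ?case using linear_span.zero[of L] by (simp add: L_zero)
    next
      case (add k c y)
      then have k: "letters k \<noteq> []" "set (letters k) \<subseteq> generators G" "word_degree k = n" by auto
      have kF: "(monomial (letters k) :: ('v, 'e, 'k) free_elem) \<in> free_algebra G" using k by (simp add: free_algebra_monomial)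
      have yF: "y \<in> free_algebra G" by (rule keys_free_algebra[OF add.hyps(4)]) auto
      have eq: "cls (single k c + y) = c \<odot>\<^bsub>L\<^esub> cls (monomial (letters k)) \<oplus>\<^bsub>L\<^esub> cls y"
        using kF yF by (simp add: single_eq_scale L_smult L_add)
      from word_normal_form[OF k(1,2)] show ?case
      proof (elim disjE exE conjE)
        assume "monomial (letters k) \<doteq> 0"
        then have "scale c (monomial (letters k)) + y \<doteq> scale c 0 + y"
          by (intro eqv_add eqv_scale eqv_refl yF)
        then have "cls (single k c + y) = cls y"
          using kF yF by (simp add: cls_eq_iff single_eq_scale)
        with add.IH show ?thesis by simp
      next
        fix u p a z q
        assume pq: "awalk u p a" "awalk z q a" "word_degree (Word (letters k)) = int (length p) - int (length q)"
          "monomial (letters k) \<doteq> pw u p * gw z q"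
        have "cls (monomial (letters k)) = cls (monomial (path_word u p @ ghost_word z q))"
          using pq(4) kF pw_in[OF pq(1)] gw_in[OF pq(2)] by (simp add: cls_eq_iff monomial_append)
        moreover have "int (length p) - int (length q) = n" using pq(3) k(3) by simp
        then have "cls (monomial (path_word u p @ ghost_word z q)) \<in> ?X" using pq(1,2) by blast
        ultimately have "cls (monomial (letters k)) \<in> ?X" by simp
        then show ?thesis unfolding eq using add.IH by (rule linear_span.step)
      qed
    qed
    then show "cls x \<in> leavitt_component G n" by (simp add: comp)
  qed
qed

lemma finsum_cls:
  assumes "finite A" "\<And>n. n \<in> A \<Longrightarrow> f n = cls (g n)" "\<And>n. n \<in> A \<Longrightarrow> g n \<in> free_algebra G"
  shows "(\<Oplus>\<^bsub>L\<^esub>n\<in>A. f n) = cls (\<Sum>n\<in>A. g n)"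
proof -
  interpret abelian_group L by (rule abelian_group_L)
  show ?thesis using assms
  proof (induction A)
    case (insert n A)
    then have "f \<in> A \<rightarrow> carrier L" "f n \<in> carrier L" by (auto simp: carrier_L)
    with insert show ?case by (simp add: L_add)
  qed (simp add: L_zero)
qed

text \<open>
  Homogeneous components are well defined modulo the kernel, as the relations are homogeneous. So the
  members of a family of homogeneous elements are recovered from its sum, and each element of the
  ideal is the sum of its components, which are in the ideal by \<open>degree_part_mem\<close>.
\<close>

lemma graded_ideal_if_condition_K:
  assumes K: "condition_K G" and I: "two_sided_ideal I L"
  shows "graded_ideal G I"
proof -
  define A where "A = rep_ideal I"
  have A: "lpa_ideal G A" unfolding A_def by (rule lpa_ideal_rep_ideal[OF I])
  have IA: "I = cls ` A" unfolding A_def by (rule image_rep_ideal[OF two_sided_ideal_subset[OF I], symmetric])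
  have mem: "cls x \<in> I \<longleftrightarrow> x \<in> A" if "x \<in> free_algebra G" for x using that by (simp add: A_def rep_ideal_def)
  define D where "D = {f. (\<forall>n. f n \<in> I \<inter> leavitt_component G n) \<and> finite {n. f n \<noteq> \<zero>\<^bsub>L\<^esub>}}"
  define s where "s f = (\<Oplus>\<^bsub>L\<^esub>n\<in>{n. f n \<noteq> \<zero>\<^bsub>L\<^esub>}. f n)" for f :: "int \<Rightarrow> ('v, 'e, 'k) free_elem set"
  have reps: "\<exists>g x. (\<forall>n. f n = cls (g n) \<and> g n \<in> A) \<and> x \<in> A \<and> s f = cls x \<and> (\<forall>n. degree_part n x \<doteq> g n)"
    if f: "f \<in> D" for f
  proof -
    have "\<exists>y. y \<in> free_algebra G \<and> homogeneous n y \<and> f n = cls y" for n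
      using f by (auto simp: D_def component_eq)
    then obtain g where g: "\<And>n. g n \<in> free_algebra G" "\<And>n. homogeneous n (g n)" "\<And>n. f n = cls (g n)"
      by metis
    let ?S = "{n. f n \<noteq> \<zero>\<^bsub>L\<^esub>}"
    have fin: "finite ?S" using f by (simp add: D_def)
    have gA: "g n \<in> A" for n using f g mem by (auto simp: D_def)
    have "degree_part n (\<Sum>n\<in>?S. g n) = (\<Sum>m\<in>?S. if n = m then g m else 0)" for n
      unfolding degree_part_sum by (intro sum.cong refl degree_part_homogeneous g)
    then have "degree_part n (\<Sum>n\<in>?S. g n) = (if n \<in> ?S then g n else 0)" for n
      using fin by simp
    moreover have "0 \<doteq> g n" if "n \<notin> ?S" for n
      using that g by (simp add: L_zero cls_eq_iff eqv_sym)
    ultimately have "degree_part n (\<Sum>n\<in>?S. g n) \<doteq> g n" for n using eqv_refl[OF g(1)] by simp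
    moreover have "s f = cls (\<Sum>n\<in>?S. g n)" unfolding s_def using fin g by (intro finsum_cls) auto
    moreover have "(\<Sum>n\<in>?S. g n) \<in> A" using gA by (intro lpa_ideal_sum[OF A])
    ultimately show ?thesis using g gA by blast
  qed
  have "bij_betw s D I"
    unfolding bij_betw_def
  proof
    show "inj_on s D"
    proof (rule inj_onI)
      fix f f' assume f: "f \<in> D" and f': "f' \<in> D" and eq: "s f = s f'"
      obtain g x where g: "\<And>n. f n = cls (g n)" "\<And>n. g n \<in> A" "x \<in> A" "s f = cls x" "\<And>n. degree_part n x \<doteq> g n"
        using reps[OF f] by blast
      obtain g' x' where g': "\<And>n. f' n = cls (g' n)" "\<And>n. g' n \<in> A" "x' \<in> A" "s f' = cls x'"
        "\<And>n. degree_part n x' \<doteq> g' n" using reps[OF f'] by blast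
      have xx': "x - x' \<in> leavitt_kernel G"
        using eq g g' lpa_idealD(1)[OF A] by (simp add: cls_eq_iff eqv_def)
      have "f n = f' n" for n
      proof -
        have "degree_part n x - degree_part n x' \<in> leavitt_kernel G"
          using degree_part_kernel[OF xx', of n] by simp
        then have "degree_part n x \<doteq> degree_part n x'"
          using g(3) g'(3) lpa_idealD(1)[OF A] by (simp add: eqv_def)
        then have "g n \<doteq> g' n" using g(5) g'(5) eqv_sym eqv_trans by blast
        then show ?thesis using g g' lpa_idealD(1)[OF A] by (simp add: cls_eq_iff)
      qed
      then show "f = f'" by blast
    qed
    show "s ` D = I"
    proof
      show "s ` D \<subseteq> I" using reps by (fastforce simp: IA)
      show "I \<subseteq> s ` D"
      proof
        fix z assume "z \<in> I"
        then obtain x where x: "x \<in> A" "z = cls x" by (auto simp: IA)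
        then have xF: "x \<in> free_algebra G" using lpa_idealD(1)[OF A] by blast
        let ?f = "\<lambda>n. cls (degree_part n x)" and ?S = "{n. cls (degree_part n x) \<noteq> \<zero>\<^bsub>L\<^esub>}"
        let ?D = "word_degree ` keys x"
        have zero: "degree_part n x = 0" if "n \<notin> ?D" for n
          using that by (intro poly_mapping_eqI) (auto simp: lookup_degree_part in_keys_iff)
        have sub: "?S \<subseteq> ?D" using zero by (auto simp: L_zero)
        have fin: "finite ?S" by (rule finite_subset[OF sub]) simp
        have "?f n \<in> I \<inter> leavitt_component G n" for n
          using degree_part_mem[OF K A x(1), of n] xF homogeneous_degree_part[of n x]
          unfolding IA component_eq by (intro IntI imageI) simp_all
        with fin have fD: "?f \<in> D" by (simp add: D_def)
        have "x = (\<Sum>n\<in>?D. degree_part n x)" by (rule sum_degree_part[symmetric]) auto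
        also have "\<dots> = (\<Sum>n\<in>?S. degree_part n x) + (\<Sum>n\<in>?D - ?S. degree_part n x)"
          using sub by (simp add: sum.subset_diff add.commute)
        finally have "x = (\<Sum>n\<in>?S. degree_part n x) + (\<Sum>n\<in>?D - ?S. degree_part n x)" .
        from arg_cong[OF this, of "\<lambda>y. y - (\<Sum>n\<in>?S. degree_part n x)"]
        have "x - (\<Sum>n\<in>?S. degree_part n x) = (\<Sum>n\<in>?D - ?S. degree_part n x)"
          unfolding add_diff_cancel_left' .
        also have "\<dots> \<in> leavitt_kernel G"
          using xF by (intro lpa_ideal_sum[OF lpa_ideal_kernel]) (simp add: L_zero cls_eq_iff eqv_zero_iff)
        finally have "x \<doteq> (\<Sum>n\<in>?S. degree_part n x)" using xF by (simp add: eqv_def)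
        moreover have "s ?f = cls (\<Sum>n\<in>?S. degree_part n x)"
          unfolding s_def using fin xF by (intro finsum_cls) auto
        ultimately have "z = s ?f" using x xF by (simp add: cls_eq_iff)
        with fD show "z \<in> s ` D" by blast
      qed
    qed
  qed
  then show ?thesis using I unfolding graded_ideal_def internal_direct_sum_def D_def s_def by simp
qed

end

section \<open>Least members of families of ideals\<close>

definition has_least :: "('a set \<Rightarrow> bool) \<Rightarrow> bool" where
  "has_least P \<longleftrightarrow> (\<forall>\<J>. \<J> \<noteq> {} \<longrightarrow> (\<forall>J\<in>\<J>. P J) \<longrightarrow> (\<exists>M\<in>\<J>. \<forall>J\<in>\<J>. M \<subseteq> J))"

lemma has_leastE:
  assumes "has_least P" "J \<in> \<J>" "\<And>J. J \<in> \<J> \<Longrightarrow> P J"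
  obtains M where "M \<in> \<J>" "\<And>J. J \<in> \<J> \<Longrightarrow> M \<subseteq> J"
proof -
  have "\<J> \<noteq> {}" using assms(2) by auto
  then show ?thesis using assms(1,3) that unfolding has_least_def by meson
qed

lemma has_least_chain: "has_least P \<Longrightarrow> P A \<Longrightarrow> P B \<Longrightarrow> A \<subseteq> B \<or> B \<subseteq> A"
  by (rule has_leastE[of P A "{A, B}"]) auto

lemma well_order_on_inclusion_iff:
  "well_order_on {I. P I} {(I, J). P I \<and> P J \<and> I \<subseteq> J} \<longleftrightarrow> has_least P"
proof
  let ?r = "{(I, J). P I \<and> P J \<and> I \<subseteq> J}"
  assume wo: "well_order_on {I. P I} ?r"
  then have tot: "A \<subseteq> B \<or> B \<subseteq> A" if "P A" "P B" for A B
    using that unfolding well_order_on_def linear_order_on_def total_on_def by blast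
  have wf: "wf (?r - Id)" using wo by (simp add: well_order_on_def)
  show "has_least P"
    unfolding has_least_def
  proof (intro allI impI)
    fix \<J> assume "\<J> \<noteq> {}" and J: "\<forall>J\<in>\<J>. P J"
    then obtain M where M: "M \<in> \<J>" "\<And>J. (J, M) \<in> ?r - Id \<Longrightarrow> J \<notin> \<J>"
      using wf unfolding wf_eq_minimal by blast
    have "M \<subseteq> J" if "J \<in> \<J>" for J using M(2)[of J] tot[of M J] M(1) that J by auto
    with M(1) show "\<exists>M\<in>\<J>. \<forall>J\<in>\<J>. M \<subseteq> J" by blast
  qed
next
  let ?r = "{(I, J). P I \<and> P J \<and> I \<subseteq> J}"
  assume least: "has_least P"
  have "wf (?r - Id)"
    unfolding wf_eq_minimal
  proof (intro allI impI)
    fix Q :: "'a set set" and x assume x: "x \<in> Q"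
    \<comment> \<open>A set that does not satisfy \<open>P\<close> has no predecessor at all.\<close>
    show "\<exists>z\<in>Q. \<forall>y. (y, z) \<in> ?r - Id \<longrightarrow> y \<notin> Q"
    proof (cases "P x")
      case True
      then obtain M where "M \<in> Q \<inter> {I. P I}" "\<And>J. J \<in> Q \<inter> {I. P I} \<Longrightarrow> M \<subseteq> J"
        using has_leastE[OF least, of x "Q \<inter> {I. P I}"] x by blast
      then show ?thesis by (intro bexI[of _ M]) auto
    next
      case False
      with x show ?thesis by (intro bexI[of _ x]) auto
    qed
  qed
  moreover have "linear_order_on {I. P I} ?r"
    unfolding linear_order_on_def partial_order_on_def preorder_on_def
    using has_least_chain[OF least] by (auto simp: refl_on_def trans_def antisym_def total_on_def)
  ultimately show "well_order_on {I. P I} ?r" by (simp add: well_order_on_def)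
qed

text \<open>
  A family without a least member does not contain its intersection, so it exhibits the intersection as
  completely reducible. Conversely, the least member of a family is the intersection of the family.
\<close>

lemma irreducible_iff_has_least:
  assumes C: "P C" "\<And>I. P I \<Longrightarrow> I \<subseteq> C"
    and Inter: "\<And>\<J>. \<J> \<noteq> {} \<Longrightarrow> (\<And>J. J \<in> \<J> \<Longrightarrow> P J) \<Longrightarrow> P (\<Inter>\<J>)"
  shows "(\<forall>I. P I \<and> I \<noteq> C \<longrightarrow> \<not> (\<exists>\<J>. (\<forall>J\<in>\<J>. P J \<and> I \<subset> J) \<and> I = C \<inter> \<Inter>\<J>)) \<longleftrightarrow> has_least P"
proof
  assume irr: "\<forall>I. P I \<and> I \<noteq> C \<longrightarrow> \<not> (\<exists>\<J>. (\<forall>J\<in>\<J>. P J \<and> I \<subset> J) \<and> I = C \<inter> \<Inter>\<J>)"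
  show "has_least P"
    unfolding has_least_def
  proof (intro allI impI, rule ccontr)
    fix \<J> assume ne: "\<J> \<noteq> {}" and J: "\<forall>J\<in>\<J>. P J" and no: "\<not> (\<exists>M\<in>\<J>. \<forall>J\<in>\<J>. M \<subseteq> J)"
    have "\<Inter>\<J> \<notin> \<J>"
    proof
      assume "\<Inter>\<J> \<in> \<J>"
      moreover have "\<forall>J\<in>\<J>. \<Inter>\<J> \<subseteq> J" by (simp add: Inter_lower)
      ultimately show False using no by (meson bexI)
    qed
    then have sub: "P J \<and> \<Inter>\<J> \<subset> J" if "J \<in> \<J>" for J
      using that J Inter_lower[OF that] by auto
    obtain J0 where J0: "J0 \<in> \<J>" using ne by blast
    have J0C: "\<Inter>\<J> \<subset> J0" "J0 \<subseteq> C" using sub[OF J0] C(2) by auto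
    have "P (\<Inter>\<J>)" by (rule Inter[OF ne]) (use J in simp)
    moreover have "\<Inter>\<J> \<noteq> C" "\<Inter>\<J> = C \<inter> \<Inter>\<J>" using J0C by auto
    ultimately show False using irr sub by meson
  qed
next
  assume least: "has_least P"
  show "\<forall>I. P I \<and> I \<noteq> C \<longrightarrow> \<not> (\<exists>\<J>. (\<forall>J\<in>\<J>. P J \<and> I \<subset> J) \<and> I = C \<inter> \<Inter>\<J>)"
  proof (intro allI impI notI, elim exE conjE)
    fix I \<J> assume "P I" "I \<noteq> C" and J: "\<forall>J\<in>\<J>. P J \<and> I \<subset> J" and I: "I = C \<inter> \<Inter>\<J>"
    then obtain J where "J \<in> \<J>" by auto
    then obtain M where M: "M \<in> \<J>" "\<And>J. J \<in> \<J> \<Longrightarrow> M \<subseteq> J"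
      using has_leastE[OF least, of J \<J>] J by blast
    then have "M \<subseteq> I" using I J C(2) by blast
    with J M(1) show False by blast
  qed
qed

section \<open>The equivalences\<close>

context leavitt
begin

lemma pair_mono:
  fixes A B :: "('v, 'e, 'k) free_elem set"
  assumes A: "lpa_ideal G A" and B: "lpa_ideal G B" and le: "A \<subseteq> B"
  shows "admissible_le (vertex_set A, breaking_set A) (vertex_set B, breaking_set B)"
proof -
  have "breaking_set A \<subseteq> breaking_vertices G (vertex_set A)" by (auto simp: breaking_set_def)
  moreover have "vertex_set A \<subseteq> vertex_set B" using le by (auto simp: vertex_set_def)
  moreover have "breaking_element (vertex_set A) v \<in> B" if "v \<in> breaking_set A" for v
    using that le by (auto simp: breaking_set_def)
  ultimately show ?thesis using admissible_le_pair_iff[OF B] by blast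
qed

lemma ideal_le_of_admissible_le:
  fixes A B :: "('v, 'e, 'k) free_elem set"
  assumes K: "condition_K G" and A: "lpa_ideal G A" and B: "lpa_ideal G B"
    and le: "admissible_le (vertex_set A, breaking_set A) (vertex_set B, breaking_set B)"
  shows "A \<subseteq> B"
proof -
  have "breaking_set A \<subseteq> breaking_vertices G (vertex_set A)" by (auto simp: breaking_set_def)
  from admissible_le_pair_iff[OF B this] le show ?thesis
    by (intro ideal_le_of_pair[OF K A B]) auto
qed

lemma chain_admissible_pairs:
  assumes least: "has_least (lpa_ideal G :: ('v, 'e, 'k) free_elem set \<Rightarrow> bool)"
  shows "Complete_Partial_Order.chain admissible_le (admissible_pairs G)"
proof (rule chainI)
  fix p q assume p: "p \<in> admissible_pairs G" and q: "q \<in> admissible_pairs G"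
  obtain A :: "('v, 'e, 'k) free_elem set" where A: "lpa_ideal G A" "p = (vertex_set A, breaking_set A)"
    using ex_ideal_of_pair p by (metis surj_pair)
  obtain B :: "('v, 'e, 'k) free_elem set" where B: "lpa_ideal G B" "q = (vertex_set B, breaking_set B)"
    using ex_ideal_of_pair q by (metis surj_pair)
  from has_least_chain[OF least A(1) B(1)] show "admissible_le p q \<or> admissible_le q p"
    using pair_mono A B by auto
qed

text \<open>
  The ideals whose pair is strictly above \<open>(H, S)\<close> have a least member; its pair is the least one
  strictly above \<open>(H, S)\<close>.
\<close>

lemma strong_csp_of_has_least:
  assumes least: "has_least (lpa_ideal G :: ('v, 'e, 'k) free_elem set \<Rightarrow> bool)"
    and adm: "(H, S) \<in> admissible_pairs G" and H: "H \<noteq> verts G"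
  shows "strong_csp (quotient_graph G H S) (verts (quotient_graph G H S))"
proof -
  have hs: "hereditary G H" "saturated G H" and S: "S \<subseteq> breaking_vertices G H"
    using adm by (auto simp: admissible_pairs_def)
  define \<A> :: "('v, 'e, 'k) free_elem set set" where
    "\<A> = {A. lpa_ideal G A \<and> admissible_le (H, S) (vertex_set A, breaking_set A) \<and>
      \<not> admissible_le (vertex_set A, breaking_set A) (H, S)}"
  have Hv: "H \<subseteq> verts G" using hs by (simp add: hereditary_def)
  have "vertex_set (free_algebra G) = verts G"
    using vertex_set_eq_verts_iff[OF lpa_ideal_free_algebra] by simp
  moreover have "S \<subseteq> verts G" using S breaking_vertices_subset by blast
  ultimately have "free_algebra G \<in> \<A>"
    unfolding \<A>_def using lpa_ideal_free_algebra Hv H by (auto simp: admissible_le_def)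
  then obtain M where M: "M \<in> \<A>" "\<And>A. A \<in> \<A> \<Longrightarrow> M \<subseteq> A"
    by (rule has_leastE[OF least]) (auto simp: \<A>_def)
  then have MI: "lpa_ideal G M" "admissible_le (H, S) (vertex_set M, breaking_set M)"
    "\<not> admissible_le (vertex_set M, breaking_set M) (H, S)" by (auto simp: \<A>_def)
  have "\<exists>t\<in>verts (quotient_graph G H S). \<forall>Y. Y \<noteq> {} \<longrightarrow> hereditary (quotient_graph G H S) Y \<longrightarrow>
      saturated (quotient_graph G H S) Y \<longrightarrow> t \<in> Y"
  proof (rule common_vertex_of_least_pair[OF hs S _ _ _ MI(3)])
    show "vertex_set M \<subseteq> verts G" by (auto simp: vertex_set_def)
    show "breaking_set M \<subseteq> breaking_vertices G (vertex_set M)" by (auto simp: breaking_set_def)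
    show "H \<subseteq> vertex_set M" using MI(2) by (simp add: admissible_le_def)
    fix H' S' assume adm': "(H', S') \<in> admissible_pairs G" "admissible_le (H, S) (H', S')"
      "\<not> admissible_le (H', S') (H, S)"
    obtain A :: "('v, 'e, 'k) free_elem set" where A: "lpa_ideal G A" "vertex_set A = H'" "breaking_set A = S'"
      using ex_ideal_of_pair[OF adm'(1)] by blast
    then have "A \<in> \<A>" using adm' by (simp add: \<A>_def)
    then show "admissible_le (vertex_set M, breaking_set M) (H', S')"
      using pair_mono[OF MI(1) A(1) M(2)] A by simp
  qed
  then show ?thesis
    using wf_digraph.strong_csp_iff[OF wf_quotient_graph[OF hs]] by blast
qed

text \<open>
  The traces of the ideals in \<open>\<J>\<close> are nonempty hereditary saturated sets of the quotient graph of the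
  pair of \<open>A\<close>, so they share a vertex. It yields an element of all these ideals that is not in \<open>A\<close>:
  the element \<open>w\<^sup>H\<close> if the vertex is \<open>Inr w\<close>, the vertex \<open>w\<close> if it is \<open>Inl w\<close> and \<open>w\<close> is no breaking
  vertex, and for a breaking vertex \<open>w\<close> the range of any edge from \<open>w\<close> that avoids \<open>H\<close>.
\<close>

lemma irreducible_of_strong_csp:
  assumes K: "condition_K G"
    and csp: "\<And>H S. (H, S) \<in> admissible_pairs G \<Longrightarrow> H \<noteq> verts G \<Longrightarrow>
      strong_csp (quotient_graph G H S) (verts (quotient_graph G H S))"
    and A: "lpa_ideal G A" "A \<noteq> free_algebra G"
    and \<J>: "\<And>J. J \<in> \<J> \<Longrightarrow> lpa_ideal G J \<and> A \<subset> J"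
  shows "A \<noteq> free_algebra G \<inter> \<Inter>(\<J> :: ('v, 'e, 'k) free_elem set set)"
proof
  assume Inter: "A = free_algebra G \<inter> \<Inter>\<J>"
  have mem_A: "x \<in> A" if "x \<in> free_algebra G" "\<And>J. J \<in> \<J> \<Longrightarrow> x \<in> J" for x
    using that Inter by blast
  define H S where "H = vertex_set A" and "S = breaking_set A"
  have adm: "(H, S) \<in> admissible_pairs G" unfolding H_def S_def by (rule pair_admissible[OF A(1)])
  then have hs: "hereditary G H" "saturated G H" and S: "S \<subseteq> breaking_vertices G H"
    by (auto simp: admissible_pairs_def)
  have "H \<noteq> verts G" using vertex_set_eq_verts_iff[OF A(1)] A(2) by (simp add: H_def)
  from csp[OF adm this] obtain t where tv: "t \<in> verts (quotient_graph G H S)"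
    and t: "\<And>Y. Y \<noteq> {} \<Longrightarrow> hereditary (quotient_graph G H S) Y \<Longrightarrow> saturated (quotient_graph G H S) Y \<Longrightarrow> t \<in> Y"
    unfolding wf_digraph.strong_csp_iff[OF wf_quotient_graph[OF hs]] by blast
  have le: "H \<subseteq> vertex_set J" and trace: "t \<in> trace H S (vertex_set J) (breaking_set J)"
    if J: "J \<in> \<J>" for J
  proof -
    have JI: "lpa_ideal G J" "A \<subseteq> J" "\<not> J \<subseteq> A" using \<J>[OF J] by auto
    have adm_le: "admissible_le (H, S) (vertex_set J, breaking_set J)"
      unfolding H_def S_def by (rule pair_mono[OF A(1) JI(1,2)])
    then show "H \<subseteq> vertex_set J" by (simp add: admissible_le_def)
    have nle: "\<not> admissible_le (vertex_set J, breaking_set J) (H, S)"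
      using ideal_le_of_admissible_le[OF K JI(1) A(1)] JI(3) by (auto simp: H_def S_def)
    have admJ: "hereditary G (vertex_set J)" "saturated G (vertex_set J)"
      "breaking_set J \<subseteq> breaking_vertices G (vertex_set J)" "vertex_set J \<subseteq> verts G"
      using pair_admissible[OF JI(1)] by (auto simp: admissible_pairs_def vertex_set_def)
    have le: "H \<subseteq> vertex_set J" "S \<subseteq> vertex_set J \<union> breaking_set J"
      using adm_le by (auto simp: admissible_le_def)
    show "t \<in> trace H S (vertex_set J) (breaking_set J)"
      by (rule t[OF trace_nonempty[OF hs admJ(3,4) le(1) nle]
            trace_hereditary_saturated[OF hs admJ(1-3) le]])
  qed
  show False
  proof (cases t)
    case (Inl w)
    then have w: "w \<in> verts G" "w \<notin> H" using tv verts_quotient(1)[OF hs] by blast+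
    have alt: "w \<in> vertex_set J \<or> w \<in> breaking_vertices G H \<and> head G ` out_arcs G w \<subseteq> vertex_set J"
      if "J \<in> \<J>" for J using trace[OF that] unfolding Inl trace_iff(1)[OF hs] by blast
    show False
    proof (cases "w \<in> breaking_vertices G H")
      case True
      then obtain e where e: "e \<in> out_arcs G w" "head G e \<notin> H" unfolding breaking_vertices_iff by blast
      have "head G e \<in> vertex_set J" if J: "J \<in> \<J>" for J
      proof -
        have "hereditary G (vertex_set J)"
          using pair_admissible \<J>[OF J] by (auto simp: admissible_pairs_def)
        then show ?thesis using alt[OF J] e(1) unfolding hereditary_iff_arcs by auto
      qed
      then have "vx (head G e) \<in> A" using e(1) by (intro mem_A) (auto simp: vertex_set_def)
      with e show False by (auto simp: H_def vertex_set_def)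
    next
      case False
      then have "w \<in> vertex_set J" if "J \<in> \<J>" for J using alt[OF that] by blast
      then have "vx w \<in> A" using w by (intro mem_A) (auto simp: vertex_set_def)
      with w show False by (simp add: H_def vertex_set_def)
    qed
  next
    case (Inr w)
    have w: "w \<in> breaking_vertices G H" "w \<notin> S" using tv verts_quotient(2)[OF hs] Inr by blast+
    then have wv: "w \<in> verts G" "w \<notin> H" by (auto simp: breaking_vertices_iff)
    have "breaking_element H w \<in> J" if J: "J \<in> \<J>" for J
      using trace[OF J] breaking_element_mem_iff[OF _ w(1) le[OF J]] \<J>[OF J]
      unfolding Inr trace_iff(2)[OF hs] by blast
    then have "breaking_element H w \<in> A" using wv by (intro mem_A) auto
    then have "w \<in> H \<union> S"
      using breaking_element_mem_iff[OF A(1) w(1)] by (simp add: H_def S_def)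
    with w wv show False by blast
  qed
qed

lemma lpa_has_least_iff:
  "has_least (lpa_ideal G :: ('v, 'e, 'k) free_elem set \<Rightarrow> bool) \<longleftrightarrow>
    condition_K G \<and> Complete_Partial_Order.chain admissible_le (admissible_pairs G) \<and>
    (\<forall>(H, S) \<in> admissible_pairs G. H \<noteq> verts G \<longrightarrow>
      strong_csp (quotient_graph G H S) (verts (quotient_graph G H S)))"
proof
  assume least: "has_least (lpa_ideal G :: ('v, 'e, 'k) free_elem set \<Rightarrow> bool)"
  have "condition_K G" by (rule condition_K_if_chain) (rule has_least_chain[OF least])
  then show "condition_K G \<and> Complete_Partial_Order.chain admissible_le (admissible_pairs G) \<and>
    (\<forall>(H, S) \<in> admissible_pairs G. H \<noteq> verts G \<longrightarrow>
      strong_csp (quotient_graph G H S) (verts (quotient_graph G H S)))"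
    using chain_admissible_pairs[OF least] strong_csp_of_has_least[OF least] by blast
next
  assume "condition_K G \<and> Complete_Partial_Order.chain admissible_le (admissible_pairs G) \<and>
    (\<forall>(H, S) \<in> admissible_pairs G. H \<noteq> verts G \<longrightarrow>
      strong_csp (quotient_graph G H S) (verts (quotient_graph G H S)))"
  then have K: "condition_K G" and csp: "\<And>H S. (H, S) \<in> admissible_pairs G \<Longrightarrow> H \<noteq> verts G \<Longrightarrow>
      strong_csp (quotient_graph G H S) (verts (quotient_graph G H S))" by auto
  have "(\<forall>I. lpa_ideal G I \<and> I \<noteq> free_algebra G \<longrightarrow>
      \<not> (\<exists>\<J>. (\<forall>J\<in>\<J>. lpa_ideal G J \<and> I \<subset> J) \<and> I = free_algebra G \<inter> \<Inter>(\<J> :: ('v, 'e, 'k) free_elem set set))) \<longleftrightarrow>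
    has_least (lpa_ideal G :: ('v, 'e, 'k) free_elem set \<Rightarrow> bool)"
    by (rule irreducible_iff_has_least)
      (use lpa_ideal_free_algebra lpa_idealD(1) lpa_ideal_Inter in blast)+
  moreover have "\<forall>I. lpa_ideal G I \<and> I \<noteq> free_algebra G \<longrightarrow>
      \<not> (\<exists>\<J>. (\<forall>J\<in>\<J>. lpa_ideal G J \<and> I \<subset> J) \<and> I = free_algebra G \<inter> \<Inter>(\<J> :: ('v, 'e, 'k) free_elem set set))"
    using irreducible_of_strong_csp[OF K csp] by blast
  ultimately show "has_least (lpa_ideal G :: ('v, 'e, 'k) free_elem set \<Rightarrow> bool)" by simp
qed

lemma two_sided_ideal_Inter:
  assumes ne: "\<J> \<noteq> {}" and \<J>: "\<And>I. I \<in> \<J> \<Longrightarrow> two_sided_ideal I L"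
  shows "two_sided_ideal (\<Inter>\<J>) L"
proof -
  have "lpa_ideal G (\<Inter>(rep_ideal ` \<J>))"
    using ne \<J> by (intro lpa_ideal_Inter) (auto intro: lpa_ideal_rep_ideal)
  moreover have "\<Inter>(rep_ideal ` \<J>) = rep_ideal (\<Inter>\<J>)" using ne by (auto simp: rep_ideal_def)
  ultimately have "two_sided_ideal (cls ` rep_ideal (\<Inter>\<J>)) L" by (metis two_sided_ideal_image)
  moreover have "\<Inter>\<J> \<subseteq> carrier L" using ne \<J> two_sided_ideal_subset by blast
  ultimately show ?thesis by (simp add: image_rep_ideal)
qed

lemma has_least_two_sided_iff:
  "has_least (\<lambda>I. two_sided_ideal I L) \<longleftrightarrow> has_least (lpa_ideal G :: ('v, 'e, 'k) free_elem set \<Rightarrow> bool)"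
proof
  assume least: "has_least (\<lambda>I. two_sided_ideal I L)"
  show "has_least (lpa_ideal G :: ('v, 'e, 'k) free_elem set \<Rightarrow> bool)"
    unfolding has_least_def
  proof (intro allI impI)
    fix \<A> :: "('v, 'e, 'k) free_elem set set" assume "\<A> \<noteq> {}" and \<A>: "\<forall>A\<in>\<A>. lpa_ideal G A"
    then obtain A where "A \<in> \<A>" by blast
    then have "cls ` A \<in> image cls ` \<A>" by blast
    then obtain I where I: "I \<in> image cls ` \<A>" "\<And>J. J \<in> image cls ` \<A> \<Longrightarrow> I \<subseteq> J"
      by (rule has_leastE[OF least]) (use \<A> two_sided_ideal_image in auto)
    then obtain M where M: "M \<in> \<A>" "I = cls ` M" by blast
    have "M \<subseteq> A" if "A \<in> \<A>" for A
    proof -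
      have "cls ` M \<subseteq> cls ` A" using I(2)[of "cls ` A"] M that by blast
      then have "rep_ideal (cls ` M) \<subseteq> rep_ideal (cls ` A)" by (auto simp: rep_ideal_def)
      then show ?thesis using \<A> M that by (simp add: rep_ideal_image)
    qed
    with M show "\<exists>M\<in>\<A>. \<forall>A\<in>\<A>. M \<subseteq> A" by blast
  qed
next
  assume least: "has_least (lpa_ideal G :: ('v, 'e, 'k) free_elem set \<Rightarrow> bool)"
  show "has_least (\<lambda>I. two_sided_ideal I L)"
    unfolding has_least_def
  proof (intro allI impI)
    fix \<J> :: "('v, 'e, 'k) free_elem set set set" assume "\<J> \<noteq> {}" and \<J>: "\<forall>I\<in>\<J>. two_sided_ideal I L"
    then obtain I where "I \<in> \<J>" by blast
    then have "rep_ideal I \<in> rep_ideal ` \<J>" by blast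
    then obtain A where A: "A \<in> rep_ideal ` \<J>" "\<And>B. B \<in> rep_ideal ` \<J> \<Longrightarrow> A \<subseteq> B"
      by (rule has_leastE[OF least]) (use \<J> lpa_ideal_rep_ideal in auto)
    then obtain M where M: "M \<in> \<J>" "A = rep_ideal M" by blast
    have "M \<subseteq> I" if "I \<in> \<J>" for I
    proof -
      have "rep_ideal M \<subseteq> rep_ideal I" using A(2)[of "rep_ideal I"] M that by blast
      then have "cls ` rep_ideal M \<subseteq> cls ` rep_ideal I" by blast
      then show ?thesis using \<J> M that two_sided_ideal_subset by (simp add: image_rep_ideal)
    qed
    with M show "\<exists>M\<in>\<J>. \<forall>I\<in>\<J>. M \<subseteq> I" by blast
  qed
qed

lemma all_completely_irreducible_iff:
  "(\<forall>I. proper_ideal I L \<longrightarrow> completely_irreducible I L) \<longleftrightarrow> has_least (\<lambda>I. two_sided_ideal I L)"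
proof -
  have carrier: "two_sided_ideal (carrier L) L"
    unfolding carrier_L by (rule two_sided_ideal_image[OF lpa_ideal_free_algebra])
  have "(\<forall>I. two_sided_ideal I L \<and> I \<noteq> carrier L \<longrightarrow>
      \<not> (\<exists>\<J>. (\<forall>J\<in>\<J>. two_sided_ideal J L \<and> I \<subset> J) \<and> I = carrier L \<inter> \<Inter>\<J>)) \<longleftrightarrow>
    has_least (\<lambda>I. two_sided_ideal I L)"
    by (rule irreducible_iff_has_least)
      (use carrier two_sided_ideal_subset two_sided_ideal_Inter in blast)+
  then show ?thesis unfolding completely_irreducible_def proper_ideal_def by blast
qed

end

theorem theorem5p8:
  fixes E :: "('v, 'e) pre_digraph"
    and L :: "('k::field, ('v, 'e, 'k) free_elem set) module"
  assumes "wf_digraph E" and "verts E \<noteq> {}"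
    and "L = leavitt_path_algebra E"
  shows
    "((\<forall>I. proper_ideal I L \<longrightarrow> completely_irreducible I L)
      \<longleftrightarrow>
      ((\<forall>I. two_sided_ideal I L \<longrightarrow> graded_ideal E I)
        \<and> well_order_on {I. two_sided_ideal I L}
            {(I, J). two_sided_ideal I L \<and> two_sided_ideal J L \<and> I \<subseteq> J}))
     \<and>
     (((\<forall>I. two_sided_ideal I L \<longrightarrow> graded_ideal E I)
        \<and> well_order_on {I. two_sided_ideal I L}
            {(I, J). two_sided_ideal I L \<and> two_sided_ideal J L \<and> I \<subseteq> J})
      \<longleftrightarrow>
      (condition_K E
        \<and> Complete_Partial_Order.chain admissible_le (admissible_pairs E)
        \<and> (\<forall>(H, S) \<in> admissible_pairs E. H \<noteq> verts E \<longrightarrow>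
              strong_csp (quotient_graph E H S) (verts (quotient_graph E H S)))))"
proof -
  interpret leavitt E "TYPE('k)"
    using assms(1) by (simp add: leavitt_def)
  have graded: "\<forall>I. two_sided_ideal I L \<longrightarrow> graded_ideal E I"
    if "has_least (\<lambda>I. two_sided_ideal I L)"
  proof -
    have "condition_K E"
      using that unfolding assms(3) has_least_two_sided_iff lpa_has_least_iff by blast
    then show ?thesis using graded_ideal_if_condition_K unfolding assms(3) by blast
  qed
  have two: "((\<forall>I. two_sided_ideal I L \<longrightarrow> graded_ideal E I)
        \<and> well_order_on {I. two_sided_ideal I L}
            {(I, J). two_sided_ideal I L \<and> two_sided_ideal J L \<and> I \<subseteq> J})
      \<longleftrightarrow> has_least (\<lambda>I. two_sided_ideal I L)"
    unfolding well_order_on_inclusion_iff using graded by blast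
  show ?thesis
    unfolding two unfolding assms(3) all_completely_irreducible_iff
    by (simp only: has_least_two_sided_iff lpa_has_least_iff)
qed

end
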